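(* Let $G=V_n(q_0)G_0$ be a primitive affine group, and suppose that $G_0^\infty$ is quasisimple with $G_0^\infty/Z(G_0^\infty)\cong A_r$, that $V=V_n(q_0)$ is the fully deleted permutation module, and that $V$ is absolutely irreducible for $G_0^\infty$ and cannot be realised over a proper subfield of $\mathbb{F}_{q_0}$. Then: (1) $\mathrm{orbdiam}(G,V)=1$ if and only if $r=6$ and $q_0=2$. (2) $\mathrm{orbdiam}(G,V)=2$ if and only if one of the following holds: (a) $q_0=2$ and $r=5$, $8$ or $10$; (b) $q_0=3$ and $r=6$; (c) $q_0=5$, $r=5$ and $4\times A_5\leq G_0$.
   Context: A primitive affine group is a group $G=VG_0\leq A\Gamma L(V)$, where $V=V_n(q_0)$ is an $n$-dimensional vector space over $\mathbb{F}_{q_0}$ acting on itself by translations, and $G_0\leq \Gamma L(V)$, the stabilizer of $0$, acts irreducibly on $V$. $G_0^\infty$ is the last term of the derived series of $G_0$. For a transitive group $G$ on a finite set $\Omega$, a non-diagonal orbital is a $G$-orbit on $\Omega\times\Omega$ other than the diagonal; the corresponding orbital graph is the undirected graph with vertex set $\Omega$ whose edges are the pairs in the orbital. If $G$ is primitive all of these graphs are connected, and $\mathrm{orbdiam}(G,\Omega)$ is the supremum of their diameters. Fully deleted permutation module: for $A_r$ or $S_r$ acting on $\mathbb{F}_{q_0}^r$ by permuting coordinates, let $W=\{(a_1,\dots,a_r):\sum a_i=0\}$ and $T=\mathrm{Span}(1,\dots,1)$; the fully deleted permutation module is $W/(W\cap T)$. It has dimension $r-1$ if $p\nmid r$ and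 $r-2$ if $p\mid r$, where $p$ is the characteristic of $\mathbb{F}_{q_0}$. In (2)(c), the factor $4$ is the cyclic group $\mathbb{F}_5^*$ of scalars. *)

theory Defs
  imports
    "HOL-Analysis.Determinants"
    "HOL-Algebra.Sym_Groups"
    "HOL-Algebra.SimpleGroups"
    "HOL-Algebra.Bij"
    "HOL-Algebra.Group_Action"
    "HOL-Algebra.Algebraic_Closure_Type"
    "HOL-Library.Extended_Nat"
begin

section \<open>Groups\<close>

definition perm_grp :: "'a set \<Rightarrow> ('a \<Rightarrow> 'a) set \<Rightarrow> ('a \<Rightarrow> 'a) monoid" where
  "perm_grp \<Omega> G = (BijGroup \<Omega>)\<lparr>carrier := G\<rparr>"

definition group_center :: "('a, 'b) monoid_scheme \<Rightarrow> 'a set" where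
  "group_center G = {z \<in> carrier G. \<forall>g\<in>carrier G. z \<otimes>\<^bsub>G\<^esub> g = g \<otimes>\<^bsub>G\<^esub> z}"

text \<open>The derived series is decreasing, so for a finite group its last term is the intersection
  of all its terms.\<close>

definition last_derived :: "('a, 'b) monoid_scheme \<Rightarrow> 'a set \<Rightarrow> 'a set" where
  "last_derived G H = (\<Inter>k. (derived G ^^ k) H)"

definition quasisimple :: "('a, 'b) monoid_scheme \<Rightarrow> bool" where
  "quasisimple G \<longleftrightarrow>
     group G \<and> derived G (carrier G) = carrier G \<and> simple_group (G Mod group_center G)"


section \<open>Orbital graphs\<close>

definition nondiagonal_orbitals :: "('a \<Rightarrow> 'a) set \<Rightarrow> 'a set \<Rightarrow> ('a \<times> 'a) set set" where
  "nondiagonal_orbitals G \<Omega> =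
     orbits (perm_grp \<Omega> G) (\<Omega> \<times> \<Omega>) (\<lambda>g. map_prod g g) - {Id_on \<Omega>}"

text \<open>An undirected graph is represented by its symmetric adjacency relation.  The distance is
  \<open>\<infinity>\<close> between vertices in different components.\<close>

definition orbital_graph :: "('a \<times> 'a) set \<Rightarrow> ('a \<times> 'a) set" where
  "orbital_graph \<Delta> = \<Delta> \<union> \<Delta>\<inverse>"

definition graph_dist :: "('a \<times> 'a) set \<Rightarrow> 'a \<Rightarrow> 'a \<Rightarrow> enat" where
  "graph_dist E x y = (INF k\<in>{k. (x, y) \<in> E ^^ k}. enat k)"

definition graph_diam :: "'a set \<Rightarrow> ('a \<times> 'a) set \<Rightarrow> enat" where
  "graph_diam \<Omega> E = (SUP (x, y)\<in>\<Omega> \<times> \<Omega>. graph_dist E x y)"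

definition orbdiam :: "('a \<Rightarrow> 'a) set \<Rightarrow> 'a set \<Rightarrow> enat" where
  "orbdiam G \<Omega> = (SUP \<Delta>\<in>nondiagonal_orbitals G \<Omega>. graph_diam \<Omega> (orbital_graph \<Delta>))"


section \<open>Primitive affine groups\<close>

text \<open>The vector space \<open>V\<^sub>n(q\<^sub>0)\<close> is \<open>'k ^ 'n\<close>, where \<open>q\<^sub>0 = CARD('k)\<close> and \<open>n = CARD('n)\<close>.\<close>

definition field_aut :: "('k::field \<Rightarrow> 'k) \<Rightarrow> bool" where
  "field_aut s \<longleftrightarrow> bij s \<and> (\<forall>a b. s (a + b) = s a + s b) \<and> (\<forall>a b. s (a * b) = s a * s b)"

definition GammaL :: "('k::field ^ 'n \<Rightarrow> 'k ^ 'n) set" where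
  "GammaL = {g. bij g \<and> (\<forall>x y. g (x + y) = g x + g y) \<and>
                (\<exists>s. field_aut s \<and> (\<forall>c x. g (c *s x) = s c *s g x))}"

definition translation_set :: "('k::field ^ 'n \<Rightarrow> 'k ^ 'n) set" where
  "translation_set = {t. \<exists>v. t = (\<lambda>x. x + v)}"

definition nonzero_scalars :: "('k::field ^ 'n \<Rightarrow> 'k ^ 'n) set" where
  "nonzero_scalars = {z. \<exists>c. c \<noteq> 0 \<and> z = (\<lambda>x. c *s x)}"

text \<open>Note that \<open>'k ^ 'n\<close> is never the zero space.\<close>

definition irreducible_on :: "('k::field ^ 'n \<Rightarrow> 'k ^ 'n) set \<Rightarrow> bool" where
  "irreducible_on H \<longleftrightarrow>
     (\<forall>U. vec.subspace U \<and> (\<forall>h\<in>H. h ` U \<subseteq> U) \<longrightarrow> U = {0} \<or> U = UNIV)"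

definition primitive_affine ::
    "('k::field ^ 'n \<Rightarrow> 'k ^ 'n) set \<Rightarrow> ('k ^ 'n \<Rightarrow> 'k ^ 'n) set \<Rightarrow> bool" where
  "primitive_affine G G0 \<longleftrightarrow>
     subgroup G0 (BijGroup UNIV) \<and> G0 \<subseteq> GammaL \<and>
     G = translation_set <#>\<^bsub>BijGroup UNIV\<^esub> G0 \<and> irreducible_on G0"

text \<open>The next two notions are meant for sets \<open>H\<close> of linear maps.  They are applied to the last
  term of the derived series of a subgroup of \<open>GammaL\<close>, which is linear because the semilinear
  maps modulo the linear ones form an abelian group.\<close>

definition absolutely_irreducible_on :: "('k::field ^ 'n \<Rightarrow> 'k ^ 'n) set \<Rightarrow> bool" where
  "absolutely_irreducible_on H \<longleftrightarrow>
     irreducible_on ((\<lambda>h x. map_matrix to_ac (matrix h) *v x) ` H)"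

definition realisable_over_proper_subfield :: "('k::field ^ 'n \<Rightarrow> 'k ^ 'n) set \<Rightarrow> bool" where
  "realisable_over_proper_subfield H \<longleftrightarrow>
     (\<exists>K (P :: 'k ^ 'n ^ 'n). subfield K ring_of_type_algebra \<and> K \<noteq> UNIV \<and> invertible P \<and>
        (\<forall>h\<in>H. \<forall>i j. (matrix_inv P ** matrix h ** P) $ i $ j \<in> K))"


section \<open>The fully deleted permutation module\<close>

text \<open>Vectors of \<open>'k\<^sup>r\<close> are functions on \<open>nat\<close> vanishing outside \<open>{1..r}\<close>, the set permuted
  by \<open>alt_group r\<close>.\<close>

definition zero_sum_vecs :: "nat \<Rightarrow> (nat \<Rightarrow> 'k::field) set" where
  "zero_sum_vecs r = {a. (\<forall>i. i \<notin> {1..r} \<longrightarrow> a i = 0) \<and> (\<Sum>i=1..r. a i) = 0}"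

definition constant_vecs :: "nat \<Rightarrow> (nat \<Rightarrow> 'k::field) set" where
  "constant_vecs r = {a. \<exists>c. a = (\<lambda>i. if i \<in> {1..r} then c else 0)}"

definition deleted_rel :: "nat \<Rightarrow> ((nat \<Rightarrow> 'k::field) \<times> (nat \<Rightarrow> 'k)) set" where
  "deleted_rel r = {(a, b). a \<in> zero_sum_vecs r \<and> b \<in> zero_sum_vecs r \<and>
                            (\<lambda>i. a i - b i) \<in> zero_sum_vecs r \<inter> constant_vecs r}"

definition deleted_class :: "nat \<Rightarrow> (nat \<Rightarrow> 'k::field) \<Rightarrow> (nat \<Rightarrow> 'k) set" where
  "deleted_class r a = deleted_rel r `` {a}"

definition deleted_module :: "nat \<Rightarrow> (nat \<Rightarrow> 'k::field) set set" where
  "deleted_module r = zero_sum_vecs r // deleted_rel r"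

text \<open>The permutation \<open>p\<close> moves the \<open>i\<close>-th coordinate to position \<open>p i\<close>.\<close>

definition permute_coords :: "(nat \<Rightarrow> nat) \<Rightarrow> (nat \<Rightarrow> 'k) \<Rightarrow> (nat \<Rightarrow> 'k)" where
  "permute_coords p a = (\<lambda>i. a (inv' p i))"

text \<open>\<open>H\<close> acts on the deleted module through an isomorphism \<open>\<psi>\<close> from \<open>H / Z(H)\<close> to the
  alternating group, and \<open>\<Phi>\<close> is an isomorphism of \<open>H\<close>-modules onto \<open>'k ^ 'n\<close>.\<close>

definition fully_deleted_perm_module :: "nat \<Rightarrow> ('k::field ^ 'n \<Rightarrow> 'k ^ 'n) set \<Rightarrow> bool" where
  "fully_deleted_perm_module r H \<longleftrightarrow>
     (let HG = perm_grp UNIV H; Z = group_center HG in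
      \<exists>\<psi> \<in> iso (HG Mod Z) (alt_group r). \<exists>\<Phi> :: (nat \<Rightarrow> 'k) set \<Rightarrow> 'k ^ 'n.
        bij_betw \<Phi> (deleted_module r) UNIV \<and>
        (\<forall>a\<in>zero_sum_vecs r. \<forall>b\<in>zero_sum_vecs r.
           \<Phi> (deleted_class r (\<lambda>i. a i + b i)) =
             \<Phi> (deleted_class r a) + \<Phi> (deleted_class r b)) \<and>
        (\<forall>c. \<forall>a\<in>zero_sum_vecs r.
           \<Phi> (deleted_class r (\<lambda>i. c * a i)) = c *s \<Phi> (deleted_class r a)) \<and>
        (\<forall>h\<in>H. \<forall>a\<in>zero_sum_vecs r.
           \<Phi> (deleted_class r (permute_coords (\<psi> (Z #>\<^bsub>HG\<^esub> h)) a)) =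
             h (\<Phi> (deleted_class r a))))"

text \<open>\<open>G0\<close> contains the direct product of the group of nonzero scalars and a copy of the
  alternating group.\<close>

definition contains_scalars_times_alt :: "nat \<Rightarrow> ('k::field ^ 'n \<Rightarrow> 'k ^ 'n) set \<Rightarrow> bool" where
  "contains_scalars_times_alt r G0 \<longleftrightarrow>
     (\<exists>A. subgroup A (perm_grp UNIV G0) \<and> perm_grp UNIV A \<cong> alt_group r \<and>
        (\<lambda>(z, a). z \<otimes>\<^bsub>perm_grp UNIV G0\<^esub> a)
          \<in> hom (perm_grp UNIV nonzero_scalars \<times>\<times> perm_grp UNIV A) (perm_grp UNIV G0) \<and>
        inj_on (\<lambda>(z, a). z \<otimes>\<^bsub>perm_grp UNIV G0\<^esub> a) (nonzero_scalars \<times> A))"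

end

theory Submission
  imports Defs
begin

text \<open>Write \<open>q\<close> for the order of the field.  Since \<open>G = V G0\<close>, the orbital graph through
\<open>(0, v)\<close> is the Cayley graph of \<open>V\<close> whose connection set consists of the vectors
\<open>g v\<close> and \<open>- g v\<close> with \<open>g \<in> G0\<close>.  So \<open>orbdiam\<close> is at most one or two if and only if, for every
\<open>v \<noteq> 0\<close>, every vector is a sum of at most one or two of these (\<open>orbdiam_le_1\<close>, \<open>orbdiam_le_2\<close>),
and the question is which vectors are such sums.

The group \<open>H\<close> acts on \<open>V\<close> as \<open>A\<^sub>r\<close> acts on zero-sum vectors modulo constants.  The differences
of coordinate vectors, here called roots, contain a basis on which \<open>H\<close> has entries in the prime
field; hence the field is prime (\<open>field_is_prime\<close>), \<open>G0\<close> acts linearly, and \<open>G0\<close> normalises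
\<open>H\<close>.

Lower bounds.  Among the elements \<open>h\<close> of order three in \<open>H\<close> the three-cycles are those for which the
image of \<open>h - 1\<close> is a plane, except when \<open>q = 3\<close> and \<open>r = 6\<close>, where an outer automorphism of \<open>A\<^sub>6\<close>
intervenes (\<open>cyc3_of_order_3\<close>).  So \<open>G0\<close> permutes the three-cycles and their planes.  A root spans
the intersection of two such planes, whence \<open>G0\<close> maps roots to multiples of roots (\<open>G0_root\<close>); for
\<open>q = r = 5\<close>, where other lines are such intersections as well, roots are recognised as the vectors
fixed by three-cycles (\<open>quinary_keeps_roots\<close>).  A sum of two multiples of roots is constant outside four positions, modulo constants if these lie in the
module, so a vector with at least five entries different from every admissible constant is not such
a sum (\<open>not_cover2_if_far\<close>).  Vectors of this kind exist except in the few cases of the theorem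
(\<open>generic_not_cover2\<close>).

The remaining cases.  For \<open>q = 2\<close> the module consists of the even subsets, modulo complements when
\<open>r\<close> is even, and \<open>A\<^sub>r\<close> is transitive on the subsets of each size.  For \<open>q = 3\<close> and \<open>r = 6\<close> there are
three orbits of nonzero vectors under \<open>H\<close>, of sizes 20, 30 and 30.  They cover \<open>V\<close> in two steps, and
\<open>G0\<close> cannot fuse orbits of different sizes, since \<open>H\<close> is normal in \<open>G0\<close>.  For \<open>q = r = 5\<close> every
element of \<open>G0\<close> is a scalar times a permutation modulo \<open>H\<close> (\<open>G0_mod_H\<close>).  If all scalars are present,
there are three orbits and each covers \<open>V\<close> in two steps.  If not, then either roots go
to roots up to sign, and \<open>(0, 1, 2, 3, 4)\<close> is not a sum of two roots; or scalars \<open>2\<close> and \<open>3\<close> occur only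
together with odd permutations, and then \<open>G0\<close> moves \<open>(0, 1, 2, 3, 4)\<close> only to even rearrangements
of it, no two of which add up to a root (\<open>E12_not_sum\<close>).\<close>

section \<open>Orbital graphs of affine groups\<close>

lemma BijGroup_UNIV:
  "carrier (BijGroup UNIV) = {f. bij f}" "\<one>\<^bsub>BijGroup UNIV\<^esub> = id"
  "bij f \<Longrightarrow> bij g \<Longrightarrow> f \<otimes>\<^bsub>BijGroup UNIV\<^esub> g = f \<circ> g"
  by (auto simp: BijGroup_def Bij_def compose_def fun_eq_iff)

lemma BijGroup_UNIV_inv: "bij f \<Longrightarrow> inv\<^bsub>BijGroup UNIV\<^esub> f = inv' f"
  by (rule group.inv_equality[OF group_BijGroup])
     (auto simp: BijGroup_UNIV bij_imp_bij_inv bij_is_inj)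

lemma perm_grp_simps:
  "carrier (perm_grp \<Omega> G) = G" "monoid.mult (perm_grp \<Omega> G) = monoid.mult (BijGroup \<Omega>)"
  "one (perm_grp \<Omega> G) = one (BijGroup \<Omega>)"
  by (simp_all add: perm_grp_def)

text \<open>The neighbours of \<open>0\<close> in the orbital graph through \<open>(0, v)\<close>.\<close>

definition sphere :: "('v \<Rightarrow> 'v) set \<Rightarrow> 'v::ab_group_add \<Rightarrow> 'v set" where
  "sphere G0 v = {w. \<exists>g\<in>G0. w = g v \<or> w = - g v}"

definition cover1 :: "('v \<Rightarrow> 'v) set \<Rightarrow> 'v::ab_group_add \<Rightarrow> 'v \<Rightarrow> bool" where
  "cover1 G0 v w \<longleftrightarrow> w = 0 \<or> w \<in> sphere G0 v"

definition cover2 :: "('v \<Rightarrow> 'v) set \<Rightarrow> 'v::ab_group_add \<Rightarrow> 'v \<Rightarrow> bool" where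
  "cover2 G0 v w \<longleftrightarrow> cover1 G0 v w \<or> (\<exists>x\<in>sphere G0 v. \<exists>y\<in>sphere G0 v. w = x + y)"

text \<open>An infimum of extended naturals below a finite bound is attained.\<close>

lemma graph_dist_le: "graph_dist E x y \<le> enat k \<longleftrightarrow> (\<exists>j\<le>k. (x, y) \<in> E ^^ j)"
proof -
  have "graph_dist E x y \<le> enat k \<longleftrightarrow> graph_dist E x y < enat (Suc k)"
    by (cases "graph_dist E x y") auto
  also have "\<dots> \<longleftrightarrow> (\<exists>j\<in>{j. (x, y) \<in> E ^^ j}. enat j < enat (Suc k))"
    unfolding graph_dist_def by (rule INF_less_iff)
  finally show ?thesis by (auto simp: less_Suc_eq_le)
qed

lemma graph_diam_le: "graph_diam \<Omega> E \<le> enat k \<longleftrightarrow> (\<forall>x\<in>\<Omega>. \<forall>y\<in>\<Omega>. \<exists>j\<le>k. (x, y) \<in> E ^^ j)"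
  by (auto simp: graph_diam_def SUP_le_iff graph_dist_le)

context
  fixes G G0 :: "('k::{field,finite} ^ 'n \<Rightarrow> 'k ^ 'n) set"
  assumes prim: "primitive_affine G G0"
begin

lemma point_stabilizer_subgroup: "subgroup G0 (BijGroup UNIV)"
  using prim by (simp add: primitive_affine_def)

lemma point_stabilizer:
  "g \<in> G0 \<Longrightarrow> bij g" "g \<in> G0 \<Longrightarrow> inv' g \<in> G0" "f \<in> G0 \<Longrightarrow> g \<in> G0 \<Longrightarrow> f \<circ> g \<in> G0" "id \<in> G0"
  "g \<in> G0 \<Longrightarrow> g (x + y) = g x + g y"
proof -
  note s = point_stabilizer_subgroup
  show b: "bij g" if "g \<in> G0" for g using subgroup.subset[OF s] that by (auto simp: BijGroup_UNIV)
  show "inv' g \<in> G0" if "g \<in> G0" for g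
    using subgroup.m_inv_closed[OF s that] b[OF that] by (simp add: BijGroup_UNIV_inv)
  show "f \<circ> g \<in> G0" if "f \<in> G0" "g \<in> G0" for f g
    using subgroup.m_closed[OF s that] b that by (simp add: BijGroup_UNIV)
  show "id \<in> G0" using subgroup.one_closed[OF s] by (simp add: BijGroup_UNIV)
  show "g (x + y) = g x + g y" if "g \<in> G0" for g x y
    using prim that by (auto simp: primitive_affine_def GammaL_def)
qed

lemma point_stabilizer_diff: "g \<in> G0 \<Longrightarrow> g (x - y) = g x - g y"
  using point_stabilizer(5)[of g "x - y" y] by (simp add: algebra_simps)

lemma affine_elements: "G = {f. \<exists>g\<in>G0. \<exists>v. f = (\<lambda>x. g x + v)}"
proof -
  have t: "bij (\<lambda>x. x + v)" for v :: "'k ^ 'n"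
    by (rule bij_betw_byWitness[where f' = "\<lambda>x. x - v"]) auto
  have m: "(\<lambda>x. x + v) \<otimes>\<^bsub>BijGroup UNIV\<^esub> g = (\<lambda>x. g x + v)" if "g \<in> G0" for g v
    using BijGroup_UNIV(3)[OF t point_stabilizer(1)[OF that]] by (simp add: comp_def)
  have "G = (\<Union>t\<in>translation_set. \<Union>g\<in>G0. {t \<otimes>\<^bsub>BijGroup UNIV\<^esub> g})"
    using prim by (simp add: primitive_affine_def set_mult_def)
  also have "\<dots> = {f. \<exists>g\<in>G0. \<exists>v. f = (\<lambda>x. g x + v)}"
  proof (intro equalityI subsetI)
    fix f assume "f \<in> (\<Union>t\<in>translation_set. \<Union>g\<in>G0. {t \<otimes>\<^bsub>BijGroup UNIV\<^esub> g})"
    then obtain v g where g: "g \<in> G0" and f: "f = (\<lambda>x. x + v) \<otimes>\<^bsub>BijGroup UNIV\<^esub> g"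
      unfolding translation_set_def by (elim UN_E) auto
    have "f = (\<lambda>x. g x + v)" using f m[OF g, of v] by simp
    then show "f \<in> {f. \<exists>g\<in>G0. \<exists>v. f = (\<lambda>x. g x + v)}" using g by blast
  next
    fix f assume "f \<in> {f. \<exists>g\<in>G0. \<exists>v. f = (\<lambda>x. g x + v)}"
    then obtain g v where g: "g \<in> G0" and f: "f = (\<lambda>x. g x + v)" by blast
    have "f = (\<lambda>x. x + v) \<otimes>\<^bsub>BijGroup UNIV\<^esub> g" using f m[OF g, of v] by simp
    moreover have "(\<lambda>x. x + v) \<in> translation_set" by (auto simp: translation_set_def)
    ultimately show "f \<in> (\<Union>t\<in>translation_set. \<Union>g\<in>G0. {t \<otimes>\<^bsub>BijGroup UNIV\<^esub> g})"
      using g by (intro UN_I[of "\<lambda>x. x + v"] UN_I[of g]) auto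
  qed
  finally show ?thesis .
qed

text \<open>Translations allow any base point, so an orbital is determined by the orbit of a difference
under the point stabiliser.\<close>

lemma nondiagonal_orbitals_affine:
  "nondiagonal_orbitals G UNIV = (\<lambda>v. {(a, b). \<exists>g\<in>G0. b - a = g v}) ` (UNIV - {0})"
proof -
  have orb: "orbit (perm_grp UNIV G) (\<lambda>g. map_prod g g) (x, y) = {(a, b). \<exists>g\<in>G0. b - a = g (y - x)}" for x y
  proof -
    have "(\<exists>f\<in>G. p = (f x, f y)) \<longleftrightarrow> (\<exists>g\<in>G0. snd p - fst p = g (y - x))" for p
    proof
      assume "\<exists>f\<in>G. p = (f x, f y)"
      then show "\<exists>g\<in>G0. snd p - fst p = g (y - x)"
        unfolding affine_elements by (auto simp: point_stabilizer_diff)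
    next
      assume "\<exists>g\<in>G0. snd p - fst p = g (y - x)"
      then obtain g where g: "g \<in> G0" "snd p - fst p = g y - g x" by (auto simp: point_stabilizer_diff)
      then have "p = (g x + (fst p - g x), g y + (fst p - g x))"
        by (simp add: prod_eq_iff algebra_simps)
      then show "\<exists>f\<in>G. p = (f x, f y)"
        unfolding affine_elements using g(1)
        by (intro bexI[of _ "\<lambda>z. g z + (fst p - g x)"]) auto
    qed
    then show ?thesis by (auto simp: orbit_def perm_grp_simps) fastforce+
  qed
  have Id: "{(a, b). \<exists>g\<in>G0. b - a = g v} = Id_on UNIV \<longleftrightarrow> v = 0" for v :: "'k ^ 'n"
  proof
    assume "v = 0"
    moreover have "(\<exists>g\<in>G0. c = g 0) \<longleftrightarrow> c = 0" for c :: "'k ^ 'n"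
      using point_stabilizer_diff[of _ 0 0] point_stabilizer(4) by fastforce
    ultimately show "{(a, b). \<exists>g\<in>G0. b - a = g v} = Id_on UNIV" by auto
  next
    assume *: "{(a, b). \<exists>g\<in>G0. b - a = g v} = Id_on UNIV"
    have "(0, v) \<in> {(a, b). \<exists>g\<in>G0. b - a = g v}" using point_stabilizer(4) by (auto intro!: bexI[of _ id])
    then show "v = 0" unfolding * by auto
  qed
  have "nondiagonal_orbitals G UNIV = (\<lambda>v. {(a, b). \<exists>g\<in>G0. b - a = g v}) ` UNIV - {Id_on UNIV}"
  proof -
    have "orbits (perm_grp UNIV G) (UNIV \<times> UNIV) (\<lambda>g. map_prod g g)
            = (\<lambda>v. {(a, b). \<exists>g\<in>G0. b - a = g v}) ` UNIV" (is "?L = ?f ` _")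
    proof
      show "?L \<subseteq> ?f ` UNIV" unfolding orbits_def by (auto simp: orb)
      have "?f v \<in> ?L" for v
      proof -
        have "?f v = orbit (perm_grp UNIV G) (\<lambda>g. map_prod g g) (0, v)" by (simp add: orb)
        then show ?thesis unfolding orbits_def by blast
      qed
      then show "?f ` UNIV \<subseteq> ?L" by blast
    qed
    then show ?thesis by (simp add: nondiagonal_orbitals_def)
  qed
  also have "\<dots> = (\<lambda>v. {(a, b). \<exists>g\<in>G0. b - a = g v}) ` (UNIV - {0})"
    (is "range ?f - _ = _")
  proof -
    have "?f v = Id_on UNIV \<longleftrightarrow> v = 0" for v by (rule Id)
    then show ?thesis by (intro equalityI subsetI; elim DiffE imageE; hypsubst) (simp_all only: Diff_iff singleton_iff UNIV_I image_iff, blast+)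
  qed
  finally show ?thesis .
qed

lemma orbital_graph_affine: "orbital_graph {(a, b). \<exists>g\<in>G0. b - a = g v} = {(a, b). b - a \<in> sphere G0 v}"
proof -
  have "a - b = g v \<longleftrightarrow> b - a = - g v" for a b :: "'k ^ 'n" and g by (metis minus_diff_eq minus_minus)
  then show ?thesis by (auto simp: orbital_graph_def sphere_def)
qed

lemma orbdiam_le:
  "orbdiam G UNIV \<le> enat k \<longleftrightarrow>
     (\<forall>v. v \<noteq> 0 \<longrightarrow> (\<forall>x y. \<exists>j\<le>k. (x, y) \<in> {(a, b). b - a \<in> sphere G0 v} ^^ j))"
  by (auto simp: orbdiam_def SUP_le_iff nondiagonal_orbitals_affine orbital_graph_affine graph_diam_le)

lemma orbdiam_le_1: "orbdiam G UNIV \<le> 1 \<longleftrightarrow> (\<forall>v w. v \<noteq> 0 \<longrightarrow> cover1 G0 v w)"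
proof -
  have "(\<exists>j\<le>1. (x, y) \<in> {(a, b). b - a \<in> S} ^^ j) \<longleftrightarrow> y - x = 0 \<or> y - x \<in> S" for x y :: "'k ^ 'n" and S
  proof -
    have "(\<exists>j\<le>1. (x, y) \<in> R ^^ j) \<longleftrightarrow> (x, y) \<in> R ^^ 0 \<or> (x, y) \<in> R ^^ 1" for R
      by (metis One_nat_def bot_nat_0.extremum le_Suc_eq le_zero_eq)
    then show ?thesis by auto
  qed
  note * = this
  have "(\<forall>x y. P (y - x)) \<longleftrightarrow> (\<forall>w. P w)" for P :: "'k ^ 'n \<Rightarrow> bool"
    by (auto dest: spec[of _ 0])
  from this[of "\<lambda>w. w = 0 \<or> w \<in> sphere G0 v" for v] show ?thesis
    unfolding one_enat_def orbdiam_le * cover1_def by simp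
qed

lemma orbdiam_le_2: "orbdiam G UNIV \<le> 2 \<longleftrightarrow> (\<forall>v w. v \<noteq> 0 \<longrightarrow> cover2 G0 v w)"
proof -
  have "(\<exists>j\<le>2. (x, y) \<in> {(a, b). b - a \<in> S} ^^ j) \<longleftrightarrow>
      y - x = 0 \<or> y - x \<in> S \<or> (\<exists>s\<in>S. \<exists>t\<in>S. y - x = s + t)" for x y :: "'k ^ 'n" and S
  proof -
    have 1: "(\<exists>j\<le>2. (x, y) \<in> R ^^ j) \<longleftrightarrow> (x, y) \<in> R ^^ 0 \<or> (x, y) \<in> R ^^ 1 \<or> (x, y) \<in> R O R" for R
    proof -
      have "j \<le> 2 \<longleftrightarrow> j = 0 \<or> j = 1 \<or> j = 2" for j :: nat by auto
      moreover have "R ^^ 2 = R O R" by (simp add: numeral_2_eq_2)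
      ultimately show ?thesis by metis
    qed
    have 2: "(x, y) \<in> {(a, b). b - a \<in> S} O {(a, b). b - a \<in> S} \<longleftrightarrow> (\<exists>s\<in>S. \<exists>t\<in>S. y - x = s + t)" (is "?L \<longleftrightarrow> ?R")
    proof
      assume ?L
      then obtain z where "z - x \<in> S" "y - z \<in> S" by auto
      moreover have "y - x = (z - x) + (y - z)" by simp
      ultimately show ?R by blast
    next
      assume ?R
      then obtain s t where "s \<in> S" "t \<in> S" "y - x = s + t" by blast
      moreover then have "y - (x + s) = t" by (simp add: algebra_simps)
      ultimately show ?L by (intro relcompI[of _ "x + s"]) auto
    qed
    show ?thesis unfolding 1 2 by auto
  qed
  note * = this
  have e2: "(2::enat) = enat 2" by (simp add: numeral_eq_enat)
  have "(\<forall>x y. P (y - x)) \<longleftrightarrow> (\<forall>w. P w)" for P :: "'k ^ 'n \<Rightarrow> bool"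
    by (auto dest: spec[of _ 0])
  from this[of "\<lambda>w. w = 0 \<or> w \<in> sphere G0 v \<or> (\<exists>s\<in>sphere G0 v. \<exists>t\<in>sphere G0 v. w = s + t)" for v]
  show ?thesis unfolding e2 orbdiam_le * cover2_def cover1_def by simp
qed

lemma orbdiam_not_le_0: "\<not> orbdiam G UNIV \<le> 0"
proof
  assume "orbdiam G UNIV \<le> 0"
  moreover have "(1 :: 'k ^ 'n) \<noteq> 0" by (simp add: vec_eq_iff)
  ultimately have "\<exists>j\<le>0. (0, 1) \<in> {(a, b). b - a \<in> sphere G0 1} ^^ j"
    unfolding zero_enat_def orbdiam_le by blast
  then show False by simp
qed

lemma orbdiam_eq_1: "orbdiam G UNIV = 1 \<longleftrightarrow> (\<forall>v w. v \<noteq> 0 \<longrightarrow> cover1 G0 v w)"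
proof -
  have "d = 1 \<longleftrightarrow> d \<le> 1 \<and> \<not> d \<le> 0" for d :: enat
    by (cases d) (auto simp: one_enat_def zero_enat_def)
  then show ?thesis using orbdiam_le_1 orbdiam_not_le_0 by simp
qed

lemma orbdiam_eq_2:
  "orbdiam G UNIV = 2 \<longleftrightarrow> (\<forall>v w. v \<noteq> 0 \<longrightarrow> cover2 G0 v w) \<and> \<not> (\<forall>v w. v \<noteq> 0 \<longrightarrow> cover1 G0 v w)"
proof -
  have "d = 2 \<longleftrightarrow> d \<le> 2 \<and> \<not> d \<le> 1" for d :: enat
    by (cases d) (auto simp: one_enat_def numeral_eq_enat)
  then show ?thesis using orbdiam_le_1 orbdiam_le_2 by simp
qed

section \<open>The last term of the derived series\<close>

text \<open>Conjugation by \<open>g\<close> is an endomorphism of the ambient group that maps \<open>G0\<close> onto itself, and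
endomorphisms commute with forming derived subgroups.\<close>

lemma last_derived_facts:
  assumes H: "H = last_derived (BijGroup UNIV) G0"
  shows "subgroup H (BijGroup UNIV)" "H \<subseteq> G0" "\<And>g h. g \<in> G0 \<Longrightarrow> h \<in> H \<Longrightarrow> g \<circ> h \<circ> inv' g \<in> H"
proof -
  let ?B = "BijGroup UNIV :: ('k ^ 'n \<Rightarrow> 'k ^ 'n) monoid"
  interpret B: group ?B by (rule group_BijGroup)
  have sub: "subgroup ((derived ?B ^^ k) G0) ?B" for k
    by (rule B.exp_of_derived_is_subgroup[OF point_stabilizer_subgroup])
  have "subgroup (\<Inter> (range (\<lambda>k. (derived ?B ^^ k) G0))) ?B"
    by (intro B.subgroups_Inter) (auto simp: sub)
  then show "subgroup H ?B" by (simp add: H last_derived_def)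
  show "H \<subseteq> G0" using INF_lower[of 0 UNIV "\<lambda>k. (derived ?B ^^ k) G0"] by (simp add: H last_derived_def)
  fix g h assume g: "g \<in> G0" and h: "h \<in> H"
  let ?c = "\<lambda>h. g \<circ> h \<circ> inv' g"
  have bg: "bij g" "bij (inv' g)" using point_stabilizer(1,2) g by auto
  have gg: "inv' g \<circ> g = id" "g \<circ> inv' g = id" using bg(1) by (auto simp: bij_is_inj surj_iff[symmetric] bij_is_surj)
  have "?c \<in> hom ?B ?B"
  proof (rule homI)
    fix x y assume xy: "x \<in> carrier ?B" "y \<in> carrier ?B"
    then have b: "bij x" "bij y" by (auto simp: BijGroup_UNIV)
    have "?c (x \<circ> y) = ?c x \<circ> ?c y" using gg by (metis comp_id fun.map_comp)
    then show "?c (x \<otimes>\<^bsub>?B\<^esub> y) = ?c x \<otimes>\<^bsub>?B\<^esub> ?c y" using b bg by (simp add: BijGroup_UNIV bij_comp)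
  qed (auto simp: BijGroup_UNIV bg bij_comp)
  then interpret c: group_hom ?B ?B ?c by unfold_locales
  have img: "?c ` G0 = G0"
  proof
    show "?c ` G0 \<subseteq> G0" using point_stabilizer(2,3) g by auto
    show "G0 \<subseteq> ?c ` G0"
    proof
      fix x assume x: "x \<in> G0"
      have "?c (inv' g \<circ> x \<circ> g) = x" using gg by (metis comp_id fun.map_comp id_comp)
      moreover have "inv' g \<circ> x \<circ> g \<in> G0" using point_stabilizer(2,3) g x by auto
      ultimately show "x \<in> ?c ` G0" by (metis imageI)
    qed
  qed
  have "?c h \<in> (derived ?B ^^ k) G0" for k
  proof -
    have "h \<in> (derived ?B ^^ k) G0" using h by (auto simp: H last_derived_def)
    then have "?c h \<in> ?c ` ((derived ?B ^^ k) G0)" by blast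
    also have "\<dots> = (derived ?B ^^ k) (?c ` G0)"
      using c.exp_of_derived_img[OF subgroup.subset[OF point_stabilizer_subgroup]] by simp
    finally show ?thesis by (simp only: img)
  qed
  then show "?c h \<in> H" by (auto simp: H last_derived_def)
qed

end

section \<open>Alternating groups of degree at most four\<close>

lemma permutes_eqI:
  assumes "p permutes S" "q permutes S" "\<And>x. x \<in> S \<Longrightarrow> p x = q x" shows "p = q"
proof
  fix x show "p x = q x"
    using assms permutes_not_in[of p S x] permutes_not_in[of q S x] by (cases "x \<in> S") auto
qed

text \<open>Excludes the odd permutations in the case distinctions below.\<close>

lemma not_even_transpose:
  assumes "p permutes S" "evenperm p" "a \<in> S" "b \<in> S" "a \<noteq> b"
    and "p a = b" "p b = a" "\<And>x. x \<in> S - {a, b} \<Longrightarrow> p x = x"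
  shows False
proof -
  have "p = Transposition.transpose a b"
    by (rule permutes_eqI[OF assms(1) permutes_swap_id[OF assms(3,4)]])
       (use assms in \<open>auto simp: Transposition.transpose_def\<close>)
  then show False using assms(2,5) by (simp add: evenperm_swap)
qed

lemma card_alt_group_le_2: assumes "r \<le> 2" shows "card (carrier (alt_group r)) \<le> 1"
proof (cases "r = 2")
  case True
  then show ?thesis using alt_group_card_carrier[of r] by (simp add: fact_numeral)
next
  case False
  then have "r = 0 \<or> r = 1" using assms by linarith
  then have "card (carrier (sym_group r)) = 1" by (auto simp: sym_group_card_carrier)
  moreover have "carrier (alt_group r) \<subseteq> carrier (sym_group r)"
    by (auto simp: alt_group_carrier sym_group_carrier)
  ultimately show ?thesis by (metis card_mono card.infinite zero_neq_one)
qed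

lemma alt_group_3_comm: "comm_group (alt_group 3)"
proof (rule group.group_comm_groupI[OF alt_group_is_group])
  have S: "{1..3::nat} = {1, 2, 3}" by auto
  have cases3: "p 1 = 1 \<and> p 2 = 2 \<and> p 3 = 3 \<or> p 1 = 2 \<and> p 2 = 3 \<and> p 3 = 1 \<or> p 1 = 3 \<and> p 2 = 1 \<and> p 3 = 2"
    if "p \<in> carrier (alt_group 3)" for p
  proof -
    have p: "p permutes {1, 2, 3}" "evenperm p" using that S by (auto simp: alt_group_carrier)
    have i: "p 1 \<in> {1, 2, 3}" "p 2 \<in> {1, 2, 3}" "p 3 \<in> {1, 2, 3}" using permutes_in_image[OF p(1)] by auto
    have d: "p 1 \<noteq> p 2" "p 1 \<noteq> p 3" "p 2 \<noteq> p 3" using permutes_inj[OF p(1)] by (auto simp: inj_eq)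
    have n: "\<not> (p 1 = 2 \<and> p 2 = 1 \<and> p 3 = 3)" "\<not> (p 1 = 3 \<and> p 3 = 1 \<and> p 2 = 2)" "\<not> (p 2 = 3 \<and> p 3 = 2 \<and> p 1 = 1)"
      using not_even_transpose[OF p, of 1 2] not_even_transpose[OF p, of 1 3] not_even_transpose[OF p, of 2 3] by auto
    show ?thesis using i d n by (elim insertE emptyE) (simp_all del: One_nat_def)
  qed
  fix p q assume pq: "p \<in> carrier (alt_group 3)" "q \<in> carrier (alt_group 3)"
  have "p \<circ> q = q \<circ> p"
  proof (rule permutes_eqI[of _ "{1..3}"])
    show "p \<circ> q permutes {1..3}" "q \<circ> p permutes {1..3}"
      using pq by (auto simp: alt_group_carrier intro: permutes_compose)
    show "(p \<circ> q) x = (q \<circ> p) x" if "x \<in> {1..3}" for x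
      using that cases3[OF pq(1)] cases3[OF pq(2)] unfolding S by (elim insertE emptyE disjE) (simp_all del: One_nat_def)
  qed
  then show "p \<otimes>\<^bsub>alt_group 3\<^esub> q = q \<otimes>\<^bsub>alt_group 3\<^esub> p" by (simp add: alt_group_mult)
qed

text \<open>The elements \<open>p\<close> with \<open>p \<circ> p = id\<close> form the Klein four-group: an even involution of four points has
no fixed point, so it is determined by the image of \<open>1\<close>.\<close>

lemma alt_group_4_not_simple: "\<not> simple_group (alt_group 4)"
proof
  assume simple: "simple_group (alt_group 4)"
  let ?A = "alt_group 4"
  interpret A: group ?A by (rule alt_group_is_group)
  have S: "{1..4::nat} = {1, 2, 3, 4}" by auto
  define N where "N = {p \<in> carrier ?A. p \<circ> p = id}"
  have invol: "p \<circ> p = id \<and> p permutes {1..4} \<longleftrightarrow> True" if "p \<in> N" for p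
    using that by (auto simp: N_def alt_group_carrier)
  have casesN: "p 1 = 1 \<and> p 2 = 2 \<and> p 3 = 3 \<and> p 4 = 4 \<or> p 1 = 2 \<and> p 2 = 1 \<and> p 3 = 4 \<and> p 4 = 3
     \<or> p 1 = 3 \<and> p 3 = 1 \<and> p 2 = 4 \<and> p 4 = 2 \<or> p 1 = 4 \<and> p 4 = 1 \<and> p 2 = 3 \<and> p 3 = 2"
    if "p \<in> N" for p
  proof -
    have p: "p permutes {1, 2, 3, 4}" "evenperm p" and pp: "p (p x) = x" for x
      using that S by (auto simp: N_def alt_group_carrier fun_eq_iff)
    have i: "p 1 \<in> {1, 2, 3, 4}" "p 2 \<in> {1, 2, 3, 4}" "p 3 \<in> {1, 2, 3, 4}" "p 4 \<in> {1, 2, 3, 4}"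
      using permutes_in_image[OF p(1)] by auto
    have n: "\<not> (p 1 = 2 \<and> p 2 = 1 \<and> p 3 = 3 \<and> p 4 = 4)" "\<not> (p 1 = 3 \<and> p 3 = 1 \<and> p 2 = 2 \<and> p 4 = 4)"
      "\<not> (p 2 = 3 \<and> p 3 = 2 \<and> p 1 = 1 \<and> p 4 = 4)" "\<not> (p 1 = 4 \<and> p 4 = 1 \<and> p 2 = 2 \<and> p 3 = 3)"
      "\<not> (p 2 = 4 \<and> p 4 = 2 \<and> p 1 = 1 \<and> p 3 = 3)" "\<not> (p 3 = 4 \<and> p 4 = 3 \<and> p 1 = 1 \<and> p 2 = 2)"
      using not_even_transpose[OF p, of 1 2] not_even_transpose[OF p, of 1 3] not_even_transpose[OF p, of 2 3]
        not_even_transpose[OF p, of 1 4] not_even_transpose[OF p, of 2 4] not_even_transpose[OF p, of 3 4] by auto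
    have d: "p 1 \<noteq> p 2" "p 1 \<noteq> p 3" "p 2 \<noteq> p 3" "p 1 \<noteq> p 4" "p 2 \<noteq> p 4" "p 3 \<noteq> p 4"
      using permutes_inj[OF p(1)] by (auto simp: inj_eq)
    show ?thesis using i d n pp[of 1] pp[of 2] pp[of 3] pp[of 4]
      by (elim insertE emptyE) (simp_all del: One_nat_def)
  qed
  have memN: "p \<in> N" if "p \<in> carrier ?A" "p \<circ> p = id" for p using that by (simp add: N_def)
  have "subgroup N ?A"
  proof (rule A.subgroupI)
    show "N \<subseteq> carrier ?A" by (auto simp: N_def)
    have "id \<in> N" by (simp add: N_def alt_group_carrier permutes_id evenperm_id)
    then show "N \<noteq> {}" by blast
    show "inv\<^bsub>?A\<^esub> p \<in> N" if "p \<in> N" for p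
    proof -
      have "inv' p = p" using that by (intro inv_unique_comp) (auto simp: N_def)
      then show ?thesis using that alt_group_inv_equality[of p 4] by (simp add: N_def)
    qed
    show "p \<otimes>\<^bsub>?A\<^esub> q \<in> N" if pq: "p \<in> N" "q \<in> N" for p q
    proof (rule memN)
      have pqA: "p \<in> carrier ?A" "q \<in> carrier ?A" using pq by (auto simp: N_def)
      then show A: "p \<otimes>\<^bsub>?A\<^esub> q \<in> carrier ?A" by simp
      have "p \<circ> q \<circ> (p \<circ> q) = id"
      proof (rule permutes_eqI[of _ "{1..4}"])
        show "p \<circ> q \<circ> (p \<circ> q) permutes {1..4}"
          using pqA by (auto simp: alt_group_carrier intro!: permutes_compose)
        show "(p \<circ> q \<circ> (p \<circ> q)) x = id x" if "x \<in> {1..4}" for x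
          using that casesN[OF pq(1)] casesN[OF pq(2)] unfolding S by (elim insertE emptyE disjE) (simp_all del: One_nat_def)
      qed (rule permutes_id)
      then show "p \<otimes>\<^bsub>?A\<^esub> q \<circ> (p \<otimes>\<^bsub>?A\<^esub> q) = id" by (simp add: alt_group_mult)
    qed
  qed
  moreover have "q \<otimes>\<^bsub>?A\<^esub> p \<otimes>\<^bsub>?A\<^esub> inv\<^bsub>?A\<^esub> q \<in> N" if q: "q \<in> carrier ?A" and p: "p \<in> N" for p q
  proof (rule memN)
    show "q \<otimes>\<^bsub>?A\<^esub> p \<otimes>\<^bsub>?A\<^esub> inv\<^bsub>?A\<^esub> q \<in> carrier ?A" using q p by (simp add: N_def)
    have b: "inv' q (q x) = x" "q (inv' q x) = x" "p (p x) = x" for x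
      using q p permutes_inverses[of q "{1..4}"] by (auto simp: alt_group_carrier N_def fun_eq_iff)
    show "q \<otimes>\<^bsub>?A\<^esub> p \<otimes>\<^bsub>?A\<^esub> inv\<^bsub>?A\<^esub> q \<circ> (q \<otimes>\<^bsub>?A\<^esub> p \<otimes>\<^bsub>?A\<^esub> inv\<^bsub>?A\<^esub> q) = id"
      using alt_group_inv_equality[OF q] b by (simp add: alt_group_mult fun_eq_iff)
  qed
  ultimately have "N \<lhd> ?A" by (simp add: A.normal_inv_iff)
  then have "N = carrier ?A \<or> N = {id}"
    using simple_group.no_real_normal_subgroup[OF simple] alt_group_one by metis
  moreover have "Transposition.transpose 1 2 \<circ> Transposition.transpose 3 4 \<in> N"
    by (auto simp: N_def alt_group_carrier evenperm_comp permutation_swap_id evenperm_swap fun_eq_iff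
        Transposition.transpose_def intro!: permutes_compose permutes_swap_id)
  moreover have "Transposition.transpose 1 2 \<circ> Transposition.transpose 3 4 \<noteq> (id :: nat \<Rightarrow> nat)"
    by (auto simp: fun_eq_iff Transposition.transpose_def dest!: spec[of _ 1])
  moreover have "Transposition.transpose 1 2 \<circ> Transposition.transpose 2 3 \<in> carrier ?A"
    by (auto simp: alt_group_carrier evenperm_comp permutation_swap_id evenperm_swap
          intro!: permutes_compose permutes_swap_id)
  moreover have "Transposition.transpose 1 2 \<circ> Transposition.transpose 2 3 \<notin> N"
    using casesN[of "Transposition.transpose 1 2 \<circ> Transposition.transpose 2 3"]
    by (auto simp: Transposition.transpose_def)
  ultimately show False by auto
qed

lemma group_center_normal: assumes "group K" shows "group_center K \<lhd> K"
proof -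
  interpret group K by fact
  have "subgroup (group_center K) K"
  proof (rule subgroupI)
    show "group_center K \<subseteq> carrier K" "group_center K \<noteq> {}" by (auto simp: group_center_def)
    show "inv\<^bsub>K\<^esub> z \<in> group_center K" if "z \<in> group_center K" for z
    proof -
      have z: "z \<in> carrier K" and c: "\<And>g. g \<in> carrier K \<Longrightarrow> z \<otimes>\<^bsub>K\<^esub> g = g \<otimes>\<^bsub>K\<^esub> z"
        using that by (auto simp: group_center_def)
      have "inv\<^bsub>K\<^esub> z \<otimes>\<^bsub>K\<^esub> g = g \<otimes>\<^bsub>K\<^esub> inv\<^bsub>K\<^esub> z" if g: "g \<in> carrier K" for g
      proof -
        have "z \<otimes>\<^bsub>K\<^esub> (g \<otimes>\<^bsub>K\<^esub> inv\<^bsub>K\<^esub> z) = g"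
          using c[OF g] z g by (simp add: m_assoc flip: m_assoc[of z g])
        then show ?thesis using z g by (metis inv_closed inv_solve_left m_closed)
      qed
      then show ?thesis using z by (simp add: group_center_def)
    qed
    show "y \<otimes>\<^bsub>K\<^esub> z \<in> group_center K" if yz: "y \<in> group_center K" "z \<in> group_center K" for y z
    proof -
      have c: "y \<in> carrier K" "z \<in> carrier K" using yz by (auto simp: group_center_def)
      have "y \<otimes>\<^bsub>K\<^esub> z \<otimes>\<^bsub>K\<^esub> g = g \<otimes>\<^bsub>K\<^esub> (y \<otimes>\<^bsub>K\<^esub> z)" if g: "g \<in> carrier K" for g
      proof -
        have "y \<otimes>\<^bsub>K\<^esub> z \<otimes>\<^bsub>K\<^esub> g = y \<otimes>\<^bsub>K\<^esub> (z \<otimes>\<^bsub>K\<^esub> g)" using c g by (simp add: m_assoc)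
        also have "z \<otimes>\<^bsub>K\<^esub> g = g \<otimes>\<^bsub>K\<^esub> z" using yz(2) g by (simp add: group_center_def)
        also have "y \<otimes>\<^bsub>K\<^esub> (g \<otimes>\<^bsub>K\<^esub> z) = y \<otimes>\<^bsub>K\<^esub> g \<otimes>\<^bsub>K\<^esub> z" using c g by (simp add: m_assoc)
        also have "y \<otimes>\<^bsub>K\<^esub> g = g \<otimes>\<^bsub>K\<^esub> y" using yz(1) g by (simp add: group_center_def)
        finally show ?thesis using c g by (simp add: m_assoc)
      qed
      then show ?thesis using c by (simp add: group_center_def)
    qed
  qed
  moreover have "g \<otimes>\<^bsub>K\<^esub> z \<otimes>\<^bsub>K\<^esub> inv\<^bsub>K\<^esub> g \<in> group_center K" if g: "g \<in> carrier K" and z: "z \<in> group_center K" for g z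
  proof -
    have "g \<otimes>\<^bsub>K\<^esub> z = z \<otimes>\<^bsub>K\<^esub> g" "z \<in> carrier K" using g z by (auto simp: group_center_def)
    then have "g \<otimes>\<^bsub>K\<^esub> z \<otimes>\<^bsub>K\<^esub> inv\<^bsub>K\<^esub> g = z" using g by (simp add: m_assoc)
    then show ?thesis using z by simp
  qed
  ultimately show ?thesis unfolding normal_inv_iff by blast
qed

text \<open>Quasisimplicity makes the alternating group both simple and perfect.  In degree at most two it
is trivial, in degree three abelian, and in degree four not simple.\<close>

lemma alternating_degree_ge_5:
  assumes qs: "quasisimple K" and iso: "K Mod group_center K \<cong> alt_group r"
  shows "5 \<le> r"
proof (rule ccontr)
  assume "\<not> 5 \<le> r"
  then have small: "r \<le> 2 \<or> r = 3 \<or> r = 4" by linarith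
  let ?Q = "K Mod group_center K"
  have K: "group K" and perf: "derived K (carrier K) = carrier K" and sQ: "simple_group ?Q"
    using qs by (auto simp: quasisimple_def)
  obtain \<phi> where phi: "\<phi> \<in> iso ?Q (alt_group r)" using iso by (auto simp: is_iso_def)
  interpret K: group K by fact
  interpret Z: normal "group_center K" K by (rule group_center_normal[OF K])
  interpret Q: simple_group ?Q by fact
  interpret A: group "alt_group r" by (rule alt_group_is_group)
  have sA: "simple_group (alt_group r)" by (rule Q.iso_simple[OF A.group_axioms phi])
  interpret q: group_hom K ?Q "\<lambda>a. group_center K #>\<^bsub>K\<^esub> a"
    using Z.r_coset_hom_Mod by unfold_locales
  interpret p: group_hom ?Q "alt_group r" \<phi>
    using phi by unfold_locales (simp add: iso_def)
  have "derived ?Q (carrier ?Q) = carrier ?Q"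
    using q.derived_img[of "carrier K"] perf by (simp add: carrier_FactGroup)
  moreover have sur: "\<phi> ` carrier ?Q = carrier (alt_group r)" using phi by (simp add: iso_def bij_betw_def)
  ultimately have perfA: "derived (alt_group r) (carrier (alt_group r)) = carrier (alt_group r)"
    using p.derived_img[of "carrier ?Q"] by simp
  show False using small
  proof (elim disjE)
    assume "r \<le> 2"
    then show ?thesis using simple_group.order_gt_one[OF sA] card_alt_group_le_2[of r] by (simp add: Coset.order_def)
  next
    assume "r = 3"
    then show ?thesis
      using simple_group.simple_not_triv[OF sA] perfA comm_group.derived_eq_singleton[OF alt_group_3_comm, of "carrier (alt_group 3)"] by simp
  next
    assume "r = 4"
    then show ?thesis using sA alt_group_4_not_simple by simp
  qed
qed

section \<open>Roots and three-cycles\<close>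

text \<open>These vectors are the roots of type \<open>A\<close>.\<close>

definition root_vec :: "nat \<Rightarrow> nat \<Rightarrow> nat \<Rightarrow> 'k::field" where
  "root_vec i j = (\<lambda>k. of_bool (k = i) - of_bool (k = j))"

lemma zero_sum_add: "a \<in> zero_sum_vecs r \<Longrightarrow> b \<in> zero_sum_vecs r \<Longrightarrow> (\<lambda>i. a i + b i) \<in> zero_sum_vecs r"
  unfolding zero_sum_vecs_def by (simp add: sum.distrib)

lemma zero_sum_diff: "a \<in> zero_sum_vecs r \<Longrightarrow> b \<in> zero_sum_vecs r \<Longrightarrow> (\<lambda>i. a i - b i) \<in> zero_sum_vecs r"
  unfolding zero_sum_vecs_def by (simp add: sum_subtractf)

lemma zero_sum_scale: "a \<in> zero_sum_vecs r \<Longrightarrow> (\<lambda>i. c * a i) \<in> zero_sum_vecs r"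
  unfolding zero_sum_vecs_def by (simp flip: sum_distrib_left)

lemma zero_sum_permute:
  assumes "\<sigma> permutes {1..r}" "a \<in> zero_sum_vecs r"
  shows "permute_coords \<sigma> a \<in> zero_sum_vecs r"
proof -
  have p: "inv' \<sigma> permutes {1..r}" using assms(1) by (rule permutes_inv)
  have "(\<Sum>i=1..r. a (inv' \<sigma> i)) = (\<Sum>i=1..r. a i)"
    using sum.permute[OF p, of a] by (simp add: o_def)
  then show ?thesis using assms(2) p
    by (auto simp: zero_sum_vecs_def permute_coords_def permutes_not_in)
qed

lemma zero_sum_root:
  assumes "i \<in> {1..r}" "j \<in> {1..r}" shows "root_vec i j \<in> zero_sum_vecs r"
  using assms by (auto simp: zero_sum_vecs_def root_vec_def sum_subtractf of_bool_def)

lemma permute_root: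
  assumes "bij \<sigma>" shows "permute_coords \<sigma> (root_vec i j) = root_vec (\<sigma> i) (\<sigma> j)"
proof -
  have "inv' \<sigma> k = l \<longleftrightarrow> k = \<sigma> l" for k l
    using assms by (metis bij_inv_eq_iff)
  then show ?thesis by (simp add: permute_coords_def root_vec_def)
qed

lemma permute_coords_compose:
  "bij p \<Longrightarrow> bij q \<Longrightarrow> permute_coords p (permute_coords q a) = permute_coords (p \<circ> q) a"
  by (simp add: permute_coords_def o_inv_distrib)

definition cyc3 :: "nat \<Rightarrow> nat \<Rightarrow> nat \<Rightarrow> nat \<Rightarrow> nat" where
  "cyc3 i j k = Transposition.transpose i j \<circ> Transposition.transpose j k"

lemma cyc3_apply:
  assumes "distinct [i, j, k]"
  shows "cyc3 i j k x = (if x = i then j else if x = j then k else if x = k then i else x)"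
  using assms by (auto simp: cyc3_def Transposition.transpose_def)

lemma inv_cyc3:
  assumes "distinct [i, j, k]" shows "inv' (cyc3 i j k) = cyc3 k j i"
  using assms by (intro inv_unique_comp) (auto simp: fun_eq_iff cyc3_apply)

lemma cyc3_even: "i \<noteq> j \<Longrightarrow> j \<noteq> k \<Longrightarrow> evenperm (cyc3 i j k)"
  by (simp add: cyc3_def evenperm_comp permutation_swap_id evenperm_swap)

lemma cyc3_in_alt:
  assumes "distinct [i, j, k]" "{i, j, k} \<subseteq> {1..r}"
  shows "cyc3 i j k \<in> carrier (alt_group r)"
  using assms unfolding alt_group_carrier
  by (auto simp: cyc3_even) (auto simp: cyc3_def intro!: permutes_compose permutes_swap_id)

text \<open>The function \<open>D\<close> is the projection of zero-sum vectors onto the deleted module, followed by an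
isomorphism with \<open>'k ^ 'n\<close>.  Composing the two removes equivalence classes from all later arguments:
its kernel consists of the constant vectors that have sum zero.\<close>

locale deleted_rep =
  fixes r :: nat and H :: "('k::{field,finite} ^ 'n \<Rightarrow> 'k ^ 'n) set"
    and D :: "(nat \<Rightarrow> 'k) \<Rightarrow> 'k ^ 'n"
  assumes r_ge_5: "5 \<le> r"
    and D_add: "a \<in> zero_sum_vecs r \<Longrightarrow> b \<in> zero_sum_vecs r \<Longrightarrow> D (\<lambda>i. a i + b i) = D a + D b"
    and D_scale: "a \<in> zero_sum_vecs r \<Longrightarrow> D (\<lambda>i. c * a i) = c *s D a"
    and D_surj: "\<exists>a\<in>zero_sum_vecs r. D a = v"
    and D_eq_0_iff: "a \<in> zero_sum_vecs r \<Longrightarrow> D a = 0 \<longleftrightarrow> (\<exists>t. \<forall>i\<in>{1..r}. a i = t)"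
    and H_perm: "h \<in> H \<Longrightarrow> \<exists>\<sigma>\<in>carrier (alt_group r).
                   \<forall>a\<in>zero_sum_vecs r. h (D a) = D (permute_coords \<sigma> a)"
    and perm_H: "\<sigma> \<in> carrier (alt_group r) \<Longrightarrow>
                   \<exists>h\<in>H. \<forall>a\<in>zero_sum_vecs r. h (D a) = D (permute_coords \<sigma> a)"
begin

definition acts_as :: "('k ^ 'n \<Rightarrow> 'k ^ 'n) \<Rightarrow> (nat \<Rightarrow> nat) \<Rightarrow> bool" where
  "acts_as h \<sigma> \<longleftrightarrow> \<sigma> permutes {1..r} \<and> (\<forall>a\<in>zero_sum_vecs r. h (D a) = D (permute_coords \<sigma> a))"

definition E :: "nat \<Rightarrow> nat \<Rightarrow> 'k ^ 'n" where
  "E i j = D (root_vec i j)"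

lemma acts_asD: "acts_as h \<sigma> \<Longrightarrow> a \<in> zero_sum_vecs r \<Longrightarrow> h (D a) = D (permute_coords \<sigma> a)"
  by (simp add: acts_as_def)

lemma acts_as_perm: "acts_as h \<sigma> \<Longrightarrow> \<sigma> permutes {1..r}"
  by (simp add: acts_as_def)

lemma acts_as_zero_sum: "acts_as h \<sigma> \<Longrightarrow> a \<in> zero_sum_vecs r \<Longrightarrow> permute_coords \<sigma> a \<in> zero_sum_vecs r"
  by (rule zero_sum_permute[OF acts_as_perm])

lemma H_acts: assumes "h \<in> H" obtains \<sigma> where "acts_as h \<sigma>" "evenperm \<sigma>"
proof -
  obtain \<sigma> where "\<sigma> \<in> carrier (alt_group r)" "\<forall>a\<in>zero_sum_vecs r. h (D a) = D (permute_coords \<sigma> a)"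
    using H_perm[OF assms] by blast
  then show ?thesis using that[of \<sigma>] unfolding acts_as_def alt_group_carrier by blast
qed

lemma even_acts: assumes "\<sigma> permutes {1..r}" "evenperm \<sigma>" obtains h where "h \<in> H" "acts_as h \<sigma>"
  using perm_H[of \<sigma>] assms that unfolding acts_as_def alt_group_carrier by blast

lemma D_diff: "a \<in> zero_sum_vecs r \<Longrightarrow> b \<in> zero_sum_vecs r \<Longrightarrow> D (\<lambda>i. a i - b i) = D a - D b"
  using D_add[of a "\<lambda>i. -1 * b i"] zero_sum_scale[of b r "-1"] D_scale[of b "-1"]
  by (simp flip: vector_sneg_minus1)

lemma D_eq_iff:
  assumes "a \<in> zero_sum_vecs r" "b \<in> zero_sum_vecs r"
  shows "D a = D b \<longleftrightarrow> (\<exists>t. \<forall>i\<in>{1..r}. a i = b i + t)"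
proof -
  have "D a = D b \<longleftrightarrow> D (\<lambda>i. a i - b i) = 0" by (simp add: D_diff assms)
  also have "\<dots> \<longleftrightarrow> (\<exists>t. \<forall>i\<in>{1..r}. a i - b i = t)"
    using D_eq_0_iff[OF zero_sum_diff[OF assms]] .
  finally show ?thesis by (auto simp: diff_eq_eq add.commute)
qed

lemma acts_as_add: "acts_as h \<sigma> \<Longrightarrow> h (x + y) = h x + h y"
proof -
  assume h: "acts_as h \<sigma>"
  obtain a b where ab: "a \<in> zero_sum_vecs r" "b \<in> zero_sum_vecs r" "x = D a" "y = D b"
    using D_surj by metis
  have "h (D (\<lambda>i. a i + b i)) = D (permute_coords \<sigma> (\<lambda>i. a i + b i))"
    by (rule acts_asD[OF h zero_sum_add[OF ab(1,2)]])
  also have "\<dots> = D (\<lambda>i. permute_coords \<sigma> a i + permute_coords \<sigma> b i)"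
    by (simp add: permute_coords_def)
  also have "\<dots> = h x + h y"
    using D_add[OF acts_as_zero_sum[OF h ab(1)] acts_as_zero_sum[OF h ab(2)]] acts_asD[OF h] ab by simp
  finally show ?thesis using D_add[OF ab(1,2)] ab by simp
qed

lemma acts_as_scale: "acts_as h \<sigma> \<Longrightarrow> h (c *s x) = c *s h x"
proof -
  assume h: "acts_as h \<sigma>"
  obtain a where a: "a \<in> zero_sum_vecs r" "x = D a"
    using D_surj by metis
  have "h (D (\<lambda>i. c * a i)) = D (\<lambda>i. c * permute_coords \<sigma> a i)"
    using acts_asD[OF h zero_sum_scale[OF a(1)]] by (simp add: permute_coords_def)
  also have "\<dots> = c *s h x"
    using D_scale[OF acts_as_zero_sum[OF h a(1)]] acts_asD[OF h] a by simp
  finally show ?thesis using D_scale[OF a(1)] a by simp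
qed

lemma acts_as_compose: "acts_as h \<sigma> \<Longrightarrow> acts_as h' \<tau> \<Longrightarrow> acts_as (h \<circ> h') (\<sigma> \<circ> \<tau>)"
  unfolding acts_as_def
  by (auto simp: permutes_compose zero_sum_permute
        permute_coords_compose[OF permutes_bij permutes_bij, of \<sigma> "{1..r}" \<tau> "{1..r}"] simp del: One_nat_def)

lemma acts_as_id: "acts_as id id"
  by (simp add: acts_as_def permute_coords_def permutes_id)

lemma acts_as_fun_eq: "acts_as h \<sigma> \<Longrightarrow> acts_as h' \<sigma> \<Longrightarrow> h = h'"
proof
  fix x assume "acts_as h \<sigma>" "acts_as h' \<sigma>"
  moreover obtain a where "a \<in> zero_sum_vecs r" "x = D a" using D_surj by metis
  ultimately show "h x = h' x" by (simp add: acts_asD)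
qed

lemma acts_as_E: "acts_as h \<sigma> \<Longrightarrow> i \<in> {1..r} \<Longrightarrow> j \<in> {1..r} \<Longrightarrow> h (E i j) = E (\<sigma> i) (\<sigma> j)"
  unfolding E_def
  by (simp add: acts_asD zero_sum_root permute_root permutes_bij[OF acts_as_perm])

lemma E_eqD:
  assumes "E i j = E k l" "{i, j, k, l} \<subseteq> {1..r}"
  shows "\<exists>t. \<forall>m\<in>{1..r}. root_vec i j m = root_vec k l m + (t::'k)"
  using assms D_eq_iff[OF zero_sum_root zero_sum_root, of i j k l] unfolding E_def by blast

lemma exists_other:
  assumes "finite A" "card A < r" shows "\<exists>k\<in>{1..r}. k \<notin> A"
proof -
  have "\<not> {1..r} \<subseteq> A" using assms card_mono[OF assms(1), of "{1..r}"] by auto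
  then show ?thesis by blast
qed

text \<open>The alternating group acts faithfully: a root has at most two nonzero entries, so with five or
more positions two roots that agree modulo constants have a common zero position and are equal.\<close>

lemma acts_as_eq_id:
  assumes h: "acts_as id \<sigma>" shows "\<sigma> = id"
proof (rule ccontr)
  assume "\<sigma> \<noteq> id"
  then obtain i where i: "\<sigma> i \<noteq> i" by (auto simp: fun_eq_iff)
  have per: "\<sigma> permutes {1..r}" using h by (simp add: acts_as_def)
  have ir: "i \<in> {1..r}" using i per permutes_not_in by metis
  have sir: "\<sigma> i \<in> {1..r}" using per ir permutes_in_image by metis
  have "card {i, \<sigma> i} < r" using r_ge_5 by (simp add: card_insert_if)
  then obtain j where j: "j \<in> {1..r}" "j \<notin> {i, \<sigma> i}" using exists_other[of "{i, \<sigma> i}"] by auto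
  have sj: "\<sigma> j \<in> {1..r}" "\<sigma> j \<noteq> \<sigma> i"
    using per j permutes_in_image[OF per] injD[OF permutes_inj[OF per], of j i] by auto
  have "E i j = E (\<sigma> i) (\<sigma> j)" using acts_as_E[OF h ir j(1)] by simp
  then obtain t where t: "\<And>k. k \<in> {1..r} \<Longrightarrow> root_vec i j k = root_vec (\<sigma> i) (\<sigma> j) k + (t::'k)"
    using E_eqD[of i j "\<sigma> i" "\<sigma> j"] ir sir j(1) sj(1) by blast
  have "card {i, j, \<sigma> i, \<sigma> j} < r" using r_ge_5 by (simp add: card_insert_if)
  then obtain k where k: "k \<in> {1..r}" "k \<notin> {i, j, \<sigma> i, \<sigma> j}" using exists_other[of "{i, j, \<sigma> i, \<sigma> j}"] by auto
  have "t = 0" using t[OF k(1)] k(2) by (auto simp: root_vec_def)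
  with t[OF sir] i j sj show False by (auto simp: root_vec_def split: if_splits)
qed

lemma E_add: "i \<in> {1..r} \<Longrightarrow> j \<in> {1..r} \<Longrightarrow> k \<in> {1..r} \<Longrightarrow> E i j + E j k = E i k"
  using D_add[OF zero_sum_root zero_sum_root, of i j j k] by (simp add: E_def) (simp add: root_vec_def)

lemma E_diff: "i \<in> {1..r} \<Longrightarrow> j \<in> {1..r} \<Longrightarrow> k \<in> {1..r} \<Longrightarrow> E i j - E i k = E k j"
  using E_add[of i k j] by (simp add: diff_eq_eq add.commute)

lemma E_self: "E i i = 0"
  unfolding E_def using D_scale[of "\<lambda>_. 0" 0] by (simp add: root_vec_def zero_sum_vecs_def)

lemma E_minus: "i \<in> {1..r} \<Longrightarrow> j \<in> {1..r} \<Longrightarrow> - E i j = E j i"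
  using E_add[of i j i] by (simp add: E_self minus_unique)

text \<open>In characteristic two a root equals its negative, which the last hypothesis takes into account.\<close>

lemma E_inj:
  assumes "{i, j, k, l} \<subseteq> {1..r}" "i \<noteq> j" "E i j = E k l" 
    and "i \<noteq> l \<or> j \<noteq> k \<or> (2::'k) \<noteq> 0"
  shows "i = k \<and> j = l"
proof -
  obtain t where t: "\<And>m. m \<in> {1..r} \<Longrightarrow> root_vec i j m = root_vec k l m + (t::'k)"
    using E_eqD[OF assms(3,1)] by blast
  have "card {i, j, k, l} < r" using r_ge_5 by (simp add: card_insert_if)
  then obtain m where m: "m \<in> {1..r}" "m \<notin> {i, j, k, l}" using exists_other[of "{i, j, k, l}"] by auto
  have t0: "t = 0" using t[OF m(1)] m(2) by (auto simp: root_vec_def)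
  have two: "(1::'k) = - 1 \<Longrightarrow> (2::'k) = 0" by (metis add.right_inverse one_add_one)
  have ti: "1 = (of_bool (i = k) - of_bool (i = l) :: 'k)" 
    and tj: "- 1 = (of_bool (j = k) - of_bool (j = l) :: 'k)"
    using t[of i] t[of j] assms(1,2) t0 by (auto simp: root_vec_def)
  have "i = k"
  proof (rule ccontr)
    assume "i \<noteq> k"
    then have "i = l" "(2::'k) = 0" using ti two by (auto simp: of_bool_def split: if_splits)
    then show False using tj assms(2,4) by (auto simp: of_bool_def split: if_splits)
  qed
  moreover have "j = l" using tj calculation assms(2) by (auto simp: of_bool_def split: if_splits)
  ultimately show ?thesis by simp
qed

lemma E_nonzero:
  assumes "i \<in> {1..r}" "j \<in> {1..r}" "i \<noteq> j" shows "E i j \<noteq> 0"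
proof 
  assume "E i j = 0"
  then have "E i j = E i i" by (simp add: E_self)
  with E_inj[of i j i i] assms show False by auto
qed

end

lemma cyc3_same_set:
  assumes "distinct [i, j, k]" "distinct [i', j', k']" "{i, j, k} = {i', j', k'}"
  shows "cyc3 i' j' k' = cyc3 i j k \<or> cyc3 i' j' k' \<circ> cyc3 i j k = id"
proof -
  have "i' = i \<or> i' = j \<or> i' = k" "j' = i \<or> j' = j \<or> j' = k" "k' = i \<or> k' = j \<or> k' = k"
    using assms(3) by auto
  then have "i' = i \<and> j' = j \<and> k' = k \<or> i' = j \<and> j' = k \<and> k' = i \<or> i' = k \<and> j' = i \<and> k' = j \<or>
        i' = i \<and> j' = k \<and> k' = j \<or> i' = j \<and> j' = i \<and> k' = k \<or> i' = k \<and> j' = j \<and> k' = i"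
    using assms(2) by auto
  then show ?thesis
    using assms(1) by (elim disjE conjE; hypsubst) (auto simp: fun_eq_iff cyc3_apply)
qed

section \<open>The action of the normaliser on roots\<close>

context deleted_rep begin

text \<open>The map \<open>h - 1\<close> identifies \<open>D z\<close> and \<open>D z'\<close> only if \<open>h\<close> fixes their difference.\<close>

lemma commutator_inj:
  assumes h: "acts_as h \<sigma>" and z: "z \<in> zero_sum_vecs r" "z' \<in> zero_sum_vecs r"
    and eq: "h (D z) - D z = h (D z') - D z'"
  shows "\<exists>t. \<forall>i\<in>{1..r}. z i - z' i = z (\<sigma> i) - z' (\<sigma> i) + t"
proof -
  define w where "w = (\<lambda>i. z i - z' i)"
  have w: "w \<in> zero_sum_vecs r" unfolding w_def by (intro zero_sum_diff z)
  have dw: "D w = D z - D z'" using D_diff[OF z] by (simp add: w_def)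
  have "h (D w) = h (D z) - h (D z')"
    using acts_as_add[OF h, of "D w" "D z'"] by (simp add: dw algebra_simps)
  also have "\<dots> = D z - D z'" using eq by (simp add: algebra_simps)
  finally have "h (D w) = D w" by (simp add: dw)
  then have "D (permute_coords \<sigma> w) = D w" using acts_asD[OF h w] by simp
  then obtain t where t: "\<And>i. i \<in> {1..r} \<Longrightarrow> permute_coords \<sigma> w i = w i + t"
    using D_eq_iff[OF acts_as_zero_sum[OF h w] w] by auto
  have per: "\<sigma> permutes {1..r}" by (rule acts_as_perm[OF h])
  have "w i = w (\<sigma> i) + t" if "i \<in> {1..r}" for i
    using t[of "\<sigma> i"] that permutes_in_image[OF per] permutes_inverses(2)[OF per]
    by (simp add: permute_coords_def)
  then show ?thesis unfolding w_def by blast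
qed

lemma D_comb3:
  assumes "{i, j, k, l, m, n} \<subseteq> {1..r}"
  shows "D (\<lambda>x. a * root_vec i j x + b * root_vec k l x + c * root_vec m n x)
           = a *s E i j + b *s E k l + c *s E m n"
    and "(\<lambda>x. a * root_vec i j x + b * root_vec k l x + c * root_vec m n x) \<in> zero_sum_vecs r"
proof -
  have z: "(\<lambda>x. c * root_vec i j x :: 'k) \<in> zero_sum_vecs r" if "{i, j} \<subseteq> {1..r}" for c i j
    using that by (intro zero_sum_scale zero_sum_root) auto
  have e: "D (\<lambda>x. c * root_vec i j x) = c *s E i j" if "{i, j} \<subseteq> {1..r}" for c i j
    using that unfolding E_def by (intro D_scale zero_sum_root) auto
  have 1: "(\<lambda>x. a * root_vec i j x + b * root_vec k l x) \<in> zero_sum_vecs r"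
    using assms by (intro zero_sum_add z) auto
  show "(\<lambda>x. a * root_vec i j x + b * root_vec k l x + c * root_vec m n x) \<in> zero_sum_vecs r"
    using assms by (intro zero_sum_add[OF 1] z) auto
  have 2: "D (\<lambda>x. a * root_vec i j x + b * root_vec k l x) = a *s E i j + b *s E k l"
    using D_add[OF z z, of i j k l a b] assms e by simp
  have 3: "(\<lambda>x. c * root_vec m n x) \<in> zero_sum_vecs r" using assms by (intro z) auto
  show "D (\<lambda>x. a * root_vec i j x + b * root_vec k l x + c * root_vec m n x)
           = a *s E i j + b *s E k l + c *s E m n"
    using D_add[OF 1 3] e[of m n c] assms by (simp add: 2)
qed

definition displacements :: "('k ^ 'n \<Rightarrow> 'k ^ 'n) \<Rightarrow> ('k ^ 'n) set" where
  "displacements h = range (\<lambda>x. h x - x)"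

lemma cyc3_displacements:
  assumes h: "acts_as h (cyc3 i j k)" and d: "distinct [i, j, k]" "{i, j, k} \<subseteq> {1..r}"
    and x: "x \<in> displacements h"
  shows "\<exists>\<alpha> \<beta>. x = D (\<lambda>m. \<alpha> * root_vec j i m + \<beta> * root_vec k i m)"
proof -
  obtain y where y: "x = h y - y" using x by (auto simp: displacements_def)
  obtain a where a: "a \<in> zero_sum_vecs r" "y = D a" using D_surj by metis
  have "x = D (\<lambda>m. permute_coords (cyc3 i j k) a m - a m)"
    using D_diff[OF acts_as_zero_sum[OF h a(1)] a(1)] acts_asD[OF h a(1)] a y by simp
  also have "(\<lambda>m. permute_coords (cyc3 i j k) a m - a m)
      = (\<lambda>m. (a i - a j) * root_vec j i m + (a j - a k) * root_vec k i m)"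
    using d(1) by (auto simp: fun_eq_iff permute_coords_def inv_cyc3 cyc3_apply root_vec_def)
  finally show ?thesis by blast
qed

lemma card_displacements_cyc3:
  assumes "acts_as h (cyc3 i j k)" "distinct [i, j, k]" "{i, j, k} \<subseteq> {1..r}"
  shows "card (displacements h) \<le> CARD('k) * CARD('k)"
proof -
  have "displacements h \<subseteq> range (\<lambda>(\<alpha>, \<beta>). D (\<lambda>m. \<alpha> * root_vec j i m + \<beta> * root_vec k i m))"
    using cyc3_displacements[OF assms] by fast
  then have "card (displacements h) \<le> card (range (\<lambda>(\<alpha>, \<beta>). D (\<lambda>m. \<alpha> * root_vec j i m + \<beta> * root_vec k i m)))"
    by (intro card_mono) auto
  also have "\<dots> \<le> CARD('k \<times> 'k)" by (intro card_image_le) auto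
  finally show ?thesis by simp
qed

text \<open>A permutation of order three that is not a three-cycle contains two disjoint three-cycles.  These
already give a three-dimensional image of \<open>h - 1\<close>, except that for \<open>q = 3\<close> and \<open>r = 6\<close> one dimension
is lost to the constant vectors.\<close>

lemma cyc3_of_order_3:
  assumes h: "acts_as h \<sigma>" and ord: "\<sigma> \<circ> \<sigma> \<circ> \<sigma> = id" and ne: "\<sigma> \<noteq> id"
    and card: "card (displacements h) \<le> CARD('k) * CARD('k)"
    and exc: "\<not> (r = 6 \<and> (3::'k) = 0)"
  shows "\<exists>i j k. distinct [i, j, k] \<and> {i, j, k} \<subseteq> {1..r} \<and> \<sigma> = cyc3 i j k"
proof -
  have per: "\<sigma> permutes {1..r}" by (rule acts_as_perm[OF h])
  have sss: "\<sigma> (\<sigma> (\<sigma> x)) = x" for x using ord by (simp add: fun_eq_iff)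
  have inr: "\<sigma> x \<in> {1..r} \<longleftrightarrow> x \<in> {1..r}" for x by (rule permutes_in_image[OF per])
  have moved: "x \<in> {1..r}" if "\<sigma> x \<noteq> x" for x using that per permutes_not_in by metis
  obtain i where i: "\<sigma> i \<noteq> i" using ne by (auto simp: fun_eq_iff)
  define j where "j = \<sigma> i"
  define k where "k = \<sigma> j"
  have ki: "\<sigma> k = i" using sss by (simp add: k_def j_def)
  have d: "distinct [i, j, k]" using i sss[of i] by (auto simp: j_def k_def)
  have ijk: "{i, j, k} \<subseteq> {1..r}" using moved[OF i] inr by (auto simp: j_def k_def)
  show ?thesis
  proof (cases "\<forall>x. x \<notin> {i, j, k} \<longrightarrow> \<sigma> x = x")
    case True
    then have "\<sigma> = cyc3 i j k"
      using ki d by (auto simp: fun_eq_iff cyc3_apply j_def[symmetric] k_def[symmetric])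
    then show ?thesis using d ijk by blast
  next
    case False
    then obtain l where l: "l \<notin> {i, j, k}" "\<sigma> l \<noteq> l" by blast
    define m where "m = \<sigma> l"
    define n where "n = \<sigma> m"
    have nl: "\<sigma> n = l" using sss by (simp add: n_def m_def)
    have inj: "\<sigma> x = \<sigma> y \<longleftrightarrow> x = y" for x y using permutes_inj[OF per] by (simp add: inj_eq)
    have lmn: "{l, m, n} \<subseteq> {1..r}" using moved[OF l(2)] inr by (auto simp: m_def n_def)
    have m': "m \<notin> {i, j, k, l}"
      using inj[of l i] inj[of l j] inj[of l k] l ki by (simp add: m_def[symmetric] j_def[symmetric] k_def[symmetric])
    have n': "n \<notin> {i, j, k, l, m}"
      using inj[of m i] inj[of m j] inj[of m k] inj[of m l] inj[of n m] m' ki l nl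
      by (auto simp: n_def[symmetric] m_def[symmetric] j_def[symmetric] k_def[symmetric])
    define S where "S = {i, j, k, l, m, n}"
    have S: "S \<subseteq> {1..r}" "card S = 6" using ijk lmn d l m' n' by (auto simp: S_def)
    define f where "f = (\<lambda>(a, b, c) x. a * root_vec i l x + b * root_vec j l x + c * root_vec i m x :: 'k)"
    have f: "f p \<in> zero_sum_vecs r" for p
      using S D_comb3(2)[of i l j l i m] by (auto simp: f_def S_def split: prod.splits)
    have "inj (\<lambda>p. h (D (f p)) - D (f p))"
    proof (rule injI)
      fix p p' assume "h (D (f p)) - D (f p) = h (D (f p')) - D (f p')"
      then obtain t where t: "\<And>x. x \<in> {1..r} \<Longrightarrow> f p x - f p' x = f p (\<sigma> x) - f p' (\<sigma> x) + t"
        using commutator_inj[OF h f f] by blast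
      obtain a b c where p: "p = (a, b, c)" by (cases p)
      obtain a' b' c' where p': "p' = (a', b', c')" by (cases p')
      define A B C where "A = a - a'" "B = b - b'" "C = c - c'"
      have *: "f p x - f p' x = A * root_vec i l x + B * root_vec j l x + C * root_vec i m x" for x
        by (simp add: f_def p p' A_B_C_def algebra_simps)
      have dd: "i \<noteq> j" "j \<noteq> k" "i \<noteq> k" "l \<noteq> i" "l \<noteq> j" "l \<noteq> k" "m \<noteq> i" "m \<noteq> j" "m \<noteq> k" "m \<noteq> l"
        "n \<noteq> i" "n \<noteq> j" "n \<noteq> k" "n \<noteq> l" "n \<noteq> m" using d l m' n' by auto
      note dd' = dd dd[symmetric]
      have ti: "A + C = B + t" and tj: "B = t" and tk: "0 = A + C + t"
        and tl: "- A - B = - C + t" and tm: "- C = t"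
        using t[of i] t[of j] t[of k] t[of l] t[of m] ijk lmn ki nl dd'
        unfolding * by (auto simp: j_def[symmetric] k_def[symmetric] m_def[symmetric] n_def[symmetric] root_vec_def)
      \<comment> \<open>Adding the equations along one three-cycle gives \<open>3 * t = 0\<close>.  In characteristic three a
        seventh position is needed: there the entries vanish.\<close>
      have t0: "t = 0"
      proof (cases "(3::'k) = 0")
        case False
        have "3 * t = 0" using ti tj tk by (simp add: algebra_simps)
        then show ?thesis using False by simp
      next
        case True
        have "r \<noteq> 6" "6 \<le> r" using exc True S card_mono[OF _ S(1)] by auto
        then obtain x where x: "x \<in> {1..r}" "x \<notin> S"
          using exists_other[of S] S(2) by (auto simp: S_def)
        have sx: "\<sigma> x \<notin> S"
        proof
          assume "\<sigma> x \<in> S"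
          then have "\<sigma> x \<in> \<sigma> ` S" using ki nl by (auto simp: S_def j_def k_def m_def n_def)
          then show False using x inj by auto
        qed
        show ?thesis using t[OF x(1)] x(2) sx unfolding * by (auto simp: S_def root_vec_def)
      qed
      have "B = 0" "C = 0" "A = 0" using t0 ti tj tk tl tm by auto
      then show "p = p'" by (simp add: A_B_C_def p p')
    qed
    then have "CARD('k \<times> 'k \<times> 'k) = card (range (\<lambda>p. h (D (f p)) - D (f p)))"
      by (simp add: card_image)
    also have "\<dots> \<le> card (displacements h)"
      by (intro card_mono) (auto simp: displacements_def)
    also note card
    finally have "CARD('k) * (CARD('k) * CARD('k)) \<le> 1 * (CARD('k) * CARD('k))" by simp
    moreover have "card {0, 1::'k} \<le> CARD('k)" by (intro card_mono) auto
    then have "2 \<le> CARD('k)" by simp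
    ultimately show ?thesis unfolding mult_le_cancel2 by simp
  qed
qed

text \<open>Two vectors supported on three positions each represent the same element of the module only if they differ
by a constant.  Outside the excluded cases this constant is zero, so both are supported on the at
most two common positions.\<close>

lemma plane_inter:
  assumes d: "distinct [i, j, k]" "{i, j, k} \<subseteq> {1..r}"
    and d': "distinct [i', j', k']" "{i', j', k'} \<subseteq> {1..r}"
    and ne: "{i, j, k} \<noteq> {i', j', k'}"
    and exc: "\<not> (r = 6 \<and> (3::'k) = 0)" "\<not> (r = 5 \<and> (5::'k) = 0)"
    and x: "x = D (\<lambda>m. \<alpha> * root_vec j i m + \<beta> * root_vec k i m)"
    and x': "x = D (\<lambda>m. \<alpha>' * root_vec j' i' m + \<beta>' * root_vec k' i' m)"
  shows "\<exists>c u v. u \<in> {1..r} \<and> v \<in> {1..r} \<and> u \<noteq> v \<and> x = c *s E u v"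
proof -
  define a where "a = (\<lambda>m. \<alpha> * root_vec j i m + \<beta> * root_vec k i m)"
  define b where "b = (\<lambda>m. \<alpha>' * root_vec j' i' m + \<beta>' * root_vec k' i' m)"
  have az: "a \<in> zero_sum_vecs r" using d unfolding a_def by (intro zero_sum_add zero_sum_scale zero_sum_root) auto
  have bz: "b \<in> zero_sum_vecs r" using d' unfolding b_def by (intro zero_sum_add zero_sum_scale zero_sum_root) auto
  obtain t where t: "\<And>m. m \<in> {1..r} \<Longrightarrow> a m = b m + t"
    using D_eq_iff[OF az bz] x x' unfolding a_def b_def by auto
  define s s' where "s = {i, j, k}" "s' = {i', j', k'}"
  have fin: "finite s" "finite s'" and c3: "card s = 3" "card s' = 3" using d d' by (auto simp: s_s'_def)
  have a0: "a m = 0" if "m \<notin> s" for m using that by (auto simp: a_def root_vec_def s_s'_def)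
  have b0: "b m = 0" if "m \<notin> s'" for m using that by (auto simp: b_def root_vec_def s_s'_def)
  have asum: "a i + a j + a k = 0" using d by (auto simp: a_def root_vec_def)
  \<comment> \<open>At a position outside both triples both vectors vanish.  Otherwise \<open>r \<le> 6\<close>, and
    either the sum of all entries or the sum over one triple shows that a multiple of \<open>t\<close> vanishes.\<close>
  have t0: "t = 0"
  proof (cases "{1..r} \<subseteq> s \<union> s'")
    case False
    then obtain m where "m \<in> {1..r}" "m \<notin> s" "m \<notin> s'" by blast
    then show ?thesis using t[of m] a0[of m] b0[of m] by simp
  next
    case True
    then have "r \<le> card (s \<union> s')" using card_mono[OF _ True] fin by auto
    moreover have un: "card (s \<union> s') + card (s \<inter> s') = 6" using card_Un_Int[OF fin] c3 by simp
    ultimately consider "r = 5" | "r = 6" "s \<inter> s' = {}" 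
    proof (cases "r = 5")
      case False
      then have "card (s \<inter> s') = 0" "r = 6"
        using \<open>r \<le> card (s \<union> s')\<close> un r_ge_5 by linarith+
      then show ?thesis using that(2) fin by simp
    qed (use that in auto)
    then show ?thesis
    proof cases
      case 1
      have "0 = (\<Sum>i=1..r. a i)" using az by (simp add: zero_sum_vecs_def)
      also have "\<dots> = (\<Sum>i=1..r. b i + t)" using t by (intro sum.cong) auto
      also have "\<dots> = of_nat r * t" using bz by (simp add: zero_sum_vecs_def sum.distrib)
      finally show ?thesis using 1 exc by simp
    next
      case 2
      have "a m = t" if "m \<in> s" for m
        using t[of m] b0[of m] that 2 d by (auto simp: s_s'_def)
      then have "3 * t = 0" using asum by (simp add: s_s'_def)
      then show ?thesis using 2 exc by simp
    qed
  qed
  have "\<not> s \<subseteq> s'"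
    using card_subset_eq[OF fin(2), of s] c3 ne by (auto simp: s_s'_def)
  then obtain m where m: "m \<in> s" "m \<notin> s'" by blast
  have "m \<in> {1..r}" using m d by (auto simp: s_s'_def)
  then have am: "a m = 0" using t[of m] b0[of m] m t0 by simp
  obtain u v where uv: "s = {u, v, m}" "distinct [u, v, m]" "a u + a v + a m = 0"
    using m(1) d asum by (auto simp: s_s'_def) (metis insert_commute add.commute add.left_commute)+
  have "a = (\<lambda>m. a u * root_vec u v m)"
  proof
    fix w show "a w = a u * root_vec u v w"
      using a0[of w] uv am by (cases "w \<in> s") (auto simp: root_vec_def eq_neg_iff_add_eq_0 add.commute)
  qed
  moreover have uvr: "u \<in> {1..r}" "v \<in> {1..r}" using uv d by (auto simp: s_s'_def)
  moreover have "D (\<lambda>m. a u * root_vec u v m) = a u *s E u v"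
    unfolding E_def using uvr by (intro D_scale zero_sum_root)
  ultimately show ?thesis using x uv(2) unfolding a_def[symmetric] by (metis distinct_length_2_or_more)
qed

end

text \<open>The group \<open>G0\<close> is any group of linear maps that contains \<open>H\<close> as a normal subgroup.\<close>

locale deleted_affine = deleted_rep r H D for r and H :: "('k::{field,finite} ^ 'n \<Rightarrow> 'k ^ 'n) set" and D +
  fixes G0 :: "('k ^ 'n \<Rightarrow> 'k ^ 'n) set"
  assumes G0_compose: "f \<in> G0 \<Longrightarrow> g \<in> G0 \<Longrightarrow> f \<circ> g \<in> G0"
    and G0_bij: "g \<in> G0 \<Longrightarrow> bij g"
    and G0_inv: "g \<in> G0 \<Longrightarrow> inv' g \<in> G0"
    and G0_add: "g \<in> G0 \<Longrightarrow> g (x + y) = g x + g y"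
    and G0_scale: "g \<in> G0 \<Longrightarrow> g (c *s x) = c *s g x"
    and H_G0: "H \<subseteq> G0"
    and H_normal: "g \<in> G0 \<Longrightarrow> h \<in> H \<Longrightarrow> g \<circ> h \<circ> inv' g \<in> H"
begin

lemma G0_diff: "g \<in> G0 \<Longrightarrow> g (x - y) = g x - g y"
  using G0_add[of g "x - y" y] by (simp add: algebra_simps)

lemma G0_0: "g \<in> G0 \<Longrightarrow> g 0 = 0"
  using G0_diff[of g 0 0] by simp

lemma G0_minus: "g \<in> G0 \<Longrightarrow> g (- x) = - g x"
  using G0_diff[of g 0 x] by (simp add: G0_0)

lemma G0_eq_0: "g \<in> G0 \<Longrightarrow> g x = 0 \<longleftrightarrow> x = 0"
  using G0_bij[of g] G0_0[of g] by (metis bij_is_inj injD)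

lemma G0_inv_apply: "g \<in> G0 \<Longrightarrow> inv' g (g x) = x" "g \<in> G0 \<Longrightarrow> g (inv' g x) = x"
  by (simp_all add: G0_bij bij_is_inj bij_is_surj surj_f_inv_f)

lemma displacements_conj:
  assumes g: "g \<in> G0" shows "displacements (g \<circ> h \<circ> inv' g) = g ` displacements h"
proof -
  have "(\<lambda>x. (g \<circ> h \<circ> inv' g) x - x) = g \<circ> (\<lambda>x. h x - x) \<circ> inv' g"
    using g by (simp add: fun_eq_iff G0_diff G0_inv_apply)
  then have "displacements (g \<circ> h \<circ> inv' g) = (g \<circ> (\<lambda>x. h x - x)) ` range (inv' g)"
    unfolding displacements_def by (simp only: image_comp)
  also have "range (inv' g) = UNIV" using G0_bij[OF G0_inv[OF g]] by (simp add: bij_is_surj)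
  finally show ?thesis by (simp only: displacements_def image_comp)
qed

text \<open>Conjugation preserves the order of an element and the size of the image of \<open>h - 1\<close>, and these
characterise three-cycles.\<close>

lemma conj_cyc3:
  assumes exc: "\<not> (r = 6 \<and> (3::'k) = 0)" and g: "g \<in> G0"
    and h: "h \<in> H" "acts_as h (cyc3 i j k)" and d: "distinct [i, j, k]" "{i, j, k} \<subseteq> {1..r}"
  shows "\<exists>i' j' k'. distinct [i', j', k'] \<and> {i', j', k'} \<subseteq> {1..r} \<and>
           acts_as (g \<circ> h \<circ> inv' g) (cyc3 i' j' k')"
proof -
  let ?h = "g \<circ> h \<circ> inv' g"
  obtain \<sigma> where s: "acts_as ?h \<sigma>" using H_acts[OF H_normal[OF g h(1)]] by metis
  have c3: "cyc3 i j k \<circ> cyc3 i j k \<circ> cyc3 i j k = id"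
    using d by (auto simp: fun_eq_iff cyc3_apply)
  have "h \<circ> h \<circ> h = id"
    using acts_as_fun_eq[OF acts_as_compose[OF acts_as_compose[OF h(2) h(2)] h(2), unfolded c3] acts_as_id] .
  then have "?h \<circ> ?h \<circ> ?h = id"
    using g by (simp add: fun_eq_iff G0_inv_apply)
  then have "acts_as id (\<sigma> \<circ> \<sigma> \<circ> \<sigma>)"
    using acts_as_compose[OF acts_as_compose[OF s s] s] by simp
  then have 1: "\<sigma> \<circ> \<sigma> \<circ> \<sigma> = id" by (rule acts_as_eq_id)
  have 2: "\<sigma> \<noteq> id"
  proof
    assume "\<sigma> = id"
    then have "?h = id" using acts_as_fun_eq[OF s] acts_as_id by simp
    then have "h = id" using g by (simp add: fun_eq_iff) (metis G0_inv_apply)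
    then have "cyc3 i j k = id" using h(2) acts_as_eq_id by simp
    then have "cyc3 i j k i = i" by simp
    then show False using d by (auto simp: cyc3_apply)
  qed
  have "card (displacements ?h) \<le> card (displacements h)" unfolding displacements_conj[OF g] by (intro card_image_le) auto
  also have "\<dots> \<le> CARD('k) * CARD('k)" by (rule card_displacements_cyc3[OF h(2) d])
  finally show ?thesis using cyc3_of_order_3[OF s 1 2 _ exc] s by blast
qed

text \<open>The root at positions \<open>1\<close> and \<open>2\<close> is in the planes of the three-cycles \<open>(1 2 3)\<close> and \<open>(1 2 4)\<close>.  Its
image under \<open>g\<close> is in the planes of two distinct three-cycles, and such planes meet at most in a line
spanned by a root.\<close>

lemma G0_root:
  assumes exc: "\<not> (r = 6 \<and> (3::'k) = 0)" "\<not> (r = 5 \<and> (5::'k) = 0)" and g: "g \<in> G0"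
  shows "\<exists>c u v. u \<in> {1..r} \<and> v \<in> {1..r} \<and> u \<noteq> v \<and> g (E 1 2) = c *s E u v"
proof -
  have r: "1 \<in> {1..r}" "2 \<in> {1..r}" "3 \<in> {1..r}" "4 \<in> {1..r}" "5 \<in> {1..r}" using r_ge_5 by auto
  have d1: "distinct [1, 2, 3::nat]" "{1, 2, 3} \<subseteq> {1..r}" using r by auto
  have d2: "distinct [1, 2, 4::nat]" "{1, 2, 4} \<subseteq> {1..r}" using r by auto
  obtain h1 where h1: "h1 \<in> H" "acts_as h1 (cyc3 1 2 3)"
    using even_acts cyc3_in_alt[OF d1] unfolding alt_group_carrier by metis
  obtain h2 where h2: "h2 \<in> H" "acts_as h2 (cyc3 1 2 4)"
    using even_acts cyc3_in_alt[OF d2] unfolding alt_group_carrier by metis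
  have "h1 (E 4 1) - E 4 1 = E 1 2"
    using acts_as_E[OF h1(2), of 4 1] r E_diff[of 4 2 1] by (simp add: cyc3_apply)
  then have m1: "E 1 2 \<in> displacements h1" 
    using rangeI[of "\<lambda>x. h1 x - x" "E 4 1"] by (simp add: displacements_def)
  have "h2 (E 3 1) - E 3 1 = E 1 2"
    using acts_as_E[OF h2(2), of 3 1] r E_diff[of 3 2 1] by (simp add: cyc3_apply)
  then have m2: "E 1 2 \<in> displacements h2" 
    using rangeI[of "\<lambda>x. h2 x - x" "E 3 1"] by (simp add: displacements_def)
  obtain i j k where c1: "distinct [i, j, k]" "{i, j, k} \<subseteq> {1..r}"
      "acts_as (g \<circ> h1 \<circ> inv' g) (cyc3 i j k)" (is "acts_as ?k1 _")
    using conj_cyc3[OF exc(1) g h1 d1] by blast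
  obtain i' j' k' where c2: "distinct [i', j', k']" "{i', j', k'} \<subseteq> {1..r}"
      "acts_as (g \<circ> h2 \<circ> inv' g) (cyc3 i' j' k')" (is "acts_as ?k2 _")
    using conj_cyc3[OF exc(1) g h2 d2] by blast
  have "g (E 1 2) \<in> displacements ?k1" "g (E 1 2) \<in> displacements ?k2" using m1 m2 by (auto simp: displacements_conj[OF g])
  then obtain \<alpha> \<beta> \<alpha>' \<beta>' where x:
     "g (E 1 2) = D (\<lambda>m. \<alpha> * root_vec j i m + \<beta> * root_vec k i m)"
     "g (E 1 2) = D (\<lambda>m. \<alpha>' * root_vec j' i' m + \<beta>' * root_vec k' i' m)"
    using cyc3_displacements[OF c1(3,1,2)] cyc3_displacements[OF c2(3,1,2)] by metis
  have "{i, j, k} \<noteq> {i', j', k'}"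
  proof
    assume eq: "{i, j, k} = {i', j', k'}"
    from cyc3_same_set[OF c1(1) c2(1) eq] show False
    proof (elim disjE)
      assume "cyc3 i' j' k' = cyc3 i j k"
      then have "?k1 = ?k2" using c1(3) c2(3) acts_as_fun_eq by metis
      then have "h1 x = h2 x" for x using g by (metis G0_inv_apply comp_apply)
      then have "E 2 1 = E 2 3" using acts_as_E[OF h1(2), of 1 3] acts_as_E[OF h2(2), of 1 3] r
        by (simp add: cyc3_apply)
      then show False using E_inj[of 2 1 2 3] r by auto
    next
      assume "cyc3 i' j' k' \<circ> cyc3 i j k = id"
      then have "acts_as (?k2 \<circ> ?k1) id" using acts_as_compose[OF c2(3) c1(3)] by simp
      then have "?k2 \<circ> ?k1 = id" using acts_as_fun_eq acts_as_id by metis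
      then have inv: "h2 (h1 x) = x" for x using g by (simp add: fun_eq_iff G0_inv_apply) (metis G0_inv_apply)
      have "E 2 5 = E 3 5"
        using inv[of "E 3 5"] acts_as_E[OF h1(2), of 3 5] acts_as_E[OF h2(2), of 1 5] r
        by (simp add: cyc3_apply)
      then show False using E_inj[of 2 5 3 5] r by auto
    qed
  qed
  from plane_inter[OF c1(1,2) c2(1,2) this exc x] show ?thesis .
qed

end

section \<open>The field of definition\<close>

lemma prime_subfield_is_subfield: "subfield (range of_nat :: 'k::{field,finite} set) ring_of_type_algebra"
proof -
  let ?R = "ring_of_type_algebra :: 'k ring" and ?K = "range of_nat :: 'k set"
  interpret R: field ?R by (rule field_from_type_algebra)
  have R: "carrier ?R = UNIV" "x \<otimes>\<^bsub>?R\<^esub> y = x * y" "x \<oplus>\<^bsub>?R\<^esub> y = x + y" "\<one>\<^bsub>?R\<^esub> = 1" "\<zero>\<^bsub>?R\<^esub> = 0" for x y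
    by (simp_all add: ring_of_type_algebra_def)
  have mult: "x * y \<in> ?K" if "x \<in> ?K" "y \<in> ?K" for x y
    using that by (auto simp flip: of_nat_mult)
  show ?thesis
  proof (rule R.subfieldI'[OF R.subringI])
    show "\<one>\<^bsub>?R\<^esub> \<in> ?K" by (auto simp: R intro: range_eqI[of _ _ 1])
    show "\<ominus>\<^bsub>?R\<^esub> h \<in> ?K" if h: "h \<in> ?K" for h
    proof -
      obtain m where m: "h = of_nat m" using h by blast
      have "of_nat ((CHAR('k) - 1) * m) + h = of_nat (CHAR('k) * m)"
        using finite_imp_CHAR_pos[where ?'a = 'k, OF finite_class.finite_UNIV] by (cases "CHAR('k)") (simp_all add: m)
      then have "of_nat ((CHAR('k) - 1) * m) + h = 0" by simp
      then have "\<ominus>\<^bsub>?R\<^esub> h = of_nat ((CHAR('k) - 1) * m)"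
        by (intro R.minus_equality) (simp_all add: R)
      then show ?thesis by (simp only: rangeI)
    qed
    show "h1 \<otimes>\<^bsub>?R\<^esub> h2 \<in> ?K" if "h1 \<in> ?K" "h2 \<in> ?K" for h1 h2 using mult that by (simp add: R)
    show "h1 \<oplus>\<^bsub>?R\<^esub> h2 \<in> ?K" if "h1 \<in> ?K" "h2 \<in> ?K" for h1 h2
      using that by (auto simp: R simp flip: of_nat_add)
    show "inv\<^bsub>?R\<^esub> k \<in> ?K" if "k \<in> ?K - {\<zero>\<^bsub>?R\<^esub>}" for k
    proof -
      have k: "k \<in> ?K" "k \<noteq> 0" using that by (auto simp: R)
      have "(\<lambda>y. k * y) ` ?K = ?K"
        using k mult by (intro endo_inj_surj) (auto simp: inj_on_def)
      moreover have "1 \<in> ?K" by (auto intro: range_eqI[of _ _ 1])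
      ultimately obtain y where y: "y \<in> ?K" "k * y = 1" by (metis imageE)
      have "inv\<^bsub>?R\<^esub> k = y" using y by (intro R.comm_inv_char) (simp_all add: R)
      then show ?thesis using y by simp
    qed
  qed (simp add: R)
qed

context deleted_rep begin

lemma D_sum:
  assumes "finite A" "A \<subseteq> {1..r}"
  shows "D (\<lambda>x. \<Sum>i\<in>A. c i * root_vec i r x) = (\<Sum>i\<in>A. c i *s E i r) \<and>
         (\<lambda>x. \<Sum>i\<in>A. c i * root_vec i r x) \<in> zero_sum_vecs r"
  using assms
proof (induction A rule: finite_induct)
  case empty
  then show ?case using D_scale[of "\<lambda>_. 0" 0] by (simp add: zero_sum_vecs_def)
next
  case (insert i A)
  have z: "(\<lambda>x. c i * root_vec i r x) \<in> zero_sum_vecs r"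
    using insert r_ge_5 by (intro zero_sum_scale zero_sum_root) auto
  have "D (\<lambda>x. c i * root_vec i r x) = c i *s E i r"
    unfolding E_def using insert r_ge_5 by (intro D_scale zero_sum_root) auto
  then show ?case using insert D_add[OF z, of "\<lambda>x. \<Sum>i\<in>A. c i * root_vec i r x"]
      zero_sum_add[OF z, of "\<lambda>x. \<Sum>i\<in>A. c i * root_vec i r x"] by simp
qed

lemma root_sum_apply:
  assumes "A \<subseteq> {1..<r}" "x \<in> {1..<r}"
  shows "(\<Sum>i\<in>A. c i * root_vec i r x) = (if x \<in> A then c x else (0::'k))"
proof -
  have fin: "finite A" using assms finite_subset by blast
  have "(\<Sum>i\<in>A. c i * root_vec i r x) = (\<Sum>i\<in>A. if i = x then c x else 0)"
    using assms by (intro sum.cong) (auto simp: root_vec_def)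
  then show ?thesis using fin by simp
qed

text \<open>The roots \<open>E i r\<close> with \<open>i < r\<close> span the module.  If \<open>r\<close> is zero in the field, they satisfy one
linear relation, and omitting the last one leaves a basis.\<close>

definition basis_index :: "nat set" where
  "basis_index = (if of_nat r = (0::'k) then {1..<r - 1} else {1..<r})"

lemma basis_index_subset: "basis_index \<subseteq> {1..<r}" "finite basis_index"
  by (auto simp: basis_index_def)

text \<open>A combination of roots \<open>E i r\<close> that vanishes in the module has all entries equal to some \<open>t\<close>.  Then
\<open>t = 0\<close>, either because position \<open>r - 1\<close> does not occur or because the entries have sum zero.\<close>

lemma basis_relation:
  assumes "(\<Sum>i\<in>basis_index. c i *s E i r) = 0" "i \<in> basis_index"
  shows "c i = 0"
proof -
  let ?a = "\<lambda>x. \<Sum>i\<in>basis_index. c i * root_vec i r x"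
  have "basis_index \<subseteq> {1..r}" using basis_index_subset by auto
  note a = D_sum[OF basis_index_subset(2) this, of c]
  then obtain t where t: "\<And>x. x \<in> {1..r} \<Longrightarrow> ?a x = t" using D_eq_0_iff assms(1) by auto
  have ci: "c x = t" if "x \<in> basis_index" for x
    using t[of x] root_sum_apply[OF basis_index_subset(1), of x c] that basis_index_subset(1) by auto
  have "t = 0"
  proof (cases "of_nat r = (0::'k)")
    case True
    then have "r - 1 \<notin> basis_index" by (simp add: basis_index_def)
    then show ?thesis using t[of "r - 1"] root_sum_apply[OF basis_index_subset(1), of "r - 1" c] r_ge_5 by simp
  next
    case False
    have "0 = (\<Sum>x=1..r. ?a x)" using a by (simp add: zero_sum_vecs_def)
    also have "\<dots> = of_nat r * t" using t by simp
    finally show ?thesis using False by simp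
  qed
  then show ?thesis using ci assms(2) by simp
qed

lemma E_r_expansion: "D a = (\<Sum>i\<in>{1..<r}. a i *s E i r)" if a: "a \<in> zero_sum_vecs r"
proof -
  have "a = (\<lambda>x. \<Sum>i\<in>{1..<r}. a i * root_vec i r x)"
  proof
    fix x
    consider "x \<in> {1..<r}" | "x = r" | "x \<notin> {1..r}" by fastforce
    then show "a x = (\<Sum>i\<in>{1..<r}. a i * root_vec i r x)"
    proof cases
      case 1 then show ?thesis using root_sum_apply[of "{1..<r}" x a] by simp
    next
      case 2
      have "{1..r} = insert r {1..<r}" using r_ge_5 by auto
      then have "a r + (\<Sum>i\<in>{1..<r}. a i) = 0" using a by (simp add: zero_sum_vecs_def)
      moreover have "(\<Sum>i\<in>{1..<r}. a i * root_vec i r r) = (\<Sum>i\<in>{1..<r}. - a i)"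
        by (intro sum.cong) (auto simp: root_vec_def)
      ultimately show ?thesis using 2 by (simp add: sum_negf eq_neg_iff_add_eq_0[symmetric])
    next
      case 3
      then have "a x = 0" using a by (simp add: zero_sum_vecs_def)
      moreover have "(\<Sum>i\<in>{1..<r}. a i * root_vec i r x) = 0"
        using 3 by (intro sum.neutral) (auto simp: root_vec_def)
      ultimately show ?thesis by simp
    qed
  qed
  moreover have "{1..<r} \<subseteq> {1..r}" by auto
  ultimately show ?thesis using D_sum[of "{1..<r}" a] by simp
qed

text \<open>The sum of all \<open>E i r\<close> with \<open>i < r\<close> is represented by the constant vector \<open>1\<close>.\<close>

lemma last_basis_vector:
  assumes "of_nat r = (0::'k)"
  shows "E (r - 1) r = (\<Sum>i\<in>basis_index. (- 1) *s E i r)"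
proof -
  let ?a = "\<lambda>x. \<Sum>i\<in>{1..<r}. 1 * root_vec i r x :: 'k"
  have sub: "{1..<r} \<subseteq> {1..r}" by auto
  have a: "D ?a = (\<Sum>i\<in>{1..<r}. 1 *s E i r)" "?a \<in> zero_sum_vecs r"
    using D_sum[OF _ sub, of "\<lambda>_. 1"] by blast+
  have a1: "?a x = 1" if x: "x \<in> {1..<r}" for x using root_sum_apply[OF order_refl x, of "\<lambda>_. 1"] x by simp
  have ar: "?a r = 1"
  proof -
    have "{1..r} = insert r {1..<r}" using r_ge_5 by auto
    then have "?a r + (\<Sum>x\<in>{1..<r}. ?a x) = 0" using a(2) by (simp add: zero_sum_vecs_def)
    moreover have "(\<Sum>x\<in>{1..<r}. ?a x) = (\<Sum>x\<in>{1..<r}. 1)" by (rule sum.cong[OF refl a1])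
    ultimately have "?a r + of_nat (r - 1) = 0" by simp
    moreover have "of_nat (r - 1) = (-1 :: 'k)" using assms r_ge_5 by (simp add: of_nat_diff)
    ultimately show ?thesis by simp
  qed
  have "\<forall>x\<in>{1..r}. ?a x = 1" using a1 ar by (metis atLeastAtMost_iff atLeastLessThan_iff le_neq_implies_less)
  then have "D ?a = 0" using D_eq_0_iff[OF a(2)] by blast
  then have "0 = (\<Sum>i\<in>{1..<r}. E i r)" using a(1) by (simp add: vector_smult_lid)
  also have "{1..<r} = insert (r - 1) basis_index" using r_ge_5 assms by (auto simp: basis_index_def)
  also have "(\<Sum>i\<in>insert (r - 1) basis_index. E i r) = E (r - 1) r + (\<Sum>i\<in>basis_index. E i r)"
    using assms basis_index_subset(2) by (subst sum.insert) (auto simp: basis_index_def)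
  finally show ?thesis by (simp add: sum_negf eq_neg_iff_add_eq_0)
qed

text \<open>With respect to a basis of roots the matrices of \<open>H\<close> have entries in the prime field, because \<open>H\<close>
permutes the roots and every root is an integral combination of the basis.\<close>

lemma field_is_prime:
  assumes nr: "\<not> realisable_over_proper_subfield H"
  shows "range of_nat = (UNIV :: 'k set)"
proof (rule ccontr)
  let ?K = "range of_nat :: 'k set"
  assume proper: "?K \<noteq> UNIV"
  have K: "0 \<in> ?K" "1 \<in> ?K" by (auto intro: range_eqI[of _ _ 0] range_eqI[of _ _ 1])
  have Kneg: "x - y \<in> ?K" if xy: "x \<in> ?K" "y \<in> ?K" for x y
  proof -
    obtain m n where "x = of_nat m" "y = of_nat n" using xy by blast
    moreover have "of_nat (m + (CHAR('k) - 1) * n) + of_nat n = (of_nat m + of_nat (CHAR('k) * n) :: 'k)"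
      using finite_imp_CHAR_pos[where ?'a = 'k, OF finite_class.finite_UNIV] by (cases "CHAR('k)") simp_all
    ultimately have "x - y = of_nat (m + (CHAR('k) - 1) * n)" by (simp add: diff_eq_eq)
    then show ?thesis by blast
  qed
  let ?e = "\<lambda>i. E i r"
  let ?B = "?e ` basis_index"
  have inj: "inj_on ?e basis_index"
  proof (rule inj_onI)
    fix i j assume ij: "i \<in> basis_index" "j \<in> basis_index" and eq: "E i r = E j r"
    have "i \<in> {1..<r}" "j \<in> {1..<r}" using ij basis_index_subset(1) by blast+
    then show "i = j" using E_inj[of i r j r] eq by auto
  qed
  have indep: "vec.independent ?B"
  proof -
    have "u v = 0" if "(\<Sum>v\<in>?B. u v *s v) = 0" "v \<in> ?B" for u v
      using that basis_relation[of "u \<circ> ?e"] by (auto simp: sum.reindex[OF inj] o_def)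
    then show ?thesis using basis_index_subset(2) by (subst vec.dependent_finite) auto
  qed
  have er: "E i r \<in> vec.span ?B" if i: "i \<in> {1..<r}" for i
  proof (cases "i \<in> basis_index")
    case True then show ?thesis by (simp add: vec.span_base)
  next
    case False
    then have "of_nat r = (0::'k)" "i = r - 1" using i by (auto simp: basis_index_def split: if_splits)
    then show ?thesis using last_basis_vector
      by (simp only:) (intro vec.span_sum vec.span_scale vec.span_base imageI)
  qed
  have span: "vec.span ?B = UNIV"
  proof -
    have "v \<in> vec.span ?B" for v
    proof -
      obtain a where "a \<in> zero_sum_vecs r" "v = D a" using D_surj by metis
      then show ?thesis using er by (auto simp: E_r_expansion intro!: vec.span_sum vec.span_scale)
    qed
    then show ?thesis by blast
  qed
  have "card ?B = CARD('n)"
    using vec.dim_eq_card_independent[OF indep] vec.dim_span[of ?B] span vec_dim_card[where ?'a='k and ?'n='n] by simp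
  then have "CARD('n) = card basis_index" by (simp add: card_image inj)
  then obtain \<beta> :: "'n \<Rightarrow> nat" where \<beta>: "bij_betw \<beta> UNIV basis_index"
    using finite_same_card_bij[of "UNIV :: 'n set" basis_index] basis_index_subset(2) by auto
  define P :: "'k ^ 'n ^ 'n" where "P = (\<chi> i j. E (\<beta> j) r $ i)"
  have colP: "column j P = E (\<beta> j) r" for j by (simp add: P_def column_def vec_eq_iff)
  have "columns P = range (\<lambda>j. E (\<beta> j) r)" by (auto simp: columns_def colP)
  also have "\<dots> = ?e ` range \<beta>" by (simp add: image_image)
  finally have "columns P = ?B" using \<beta> by (simp add: bij_betw_def)
  then have "\<exists>Q. P ** Q = mat 1" using span by (simp add: matrix_right_invertible_span_columns)
  then have invP: "invertible P" by (simp add: invertible_right_inverse)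
  \<comment> \<open>The combinations of the basis with coefficients in the prime field: they contain all roots.\<close>
  define L where "L = {P *v k |k. \<forall>j. k $ j \<in> ?K}"
  have Ldiff: "x - y \<in> L" if xy: "x \<in> L" "y \<in> L" for x y
  proof -
    obtain k l :: "'k ^ 'n" where kl: "x = P *v k" "y = P *v l" "\<forall>j. k $ j \<in> ?K" "\<forall>j. l $ j \<in> ?K"
      using xy by (auto simp: L_def)
    then have "x - y = P *v (k - l)" by (simp add: matrix_vector_mult_diff_distrib)
    moreover have "(k - l) $ j \<in> ?K" for j using kl Kneg by simp
    ultimately show ?thesis unfolding L_def by blast
  qed
  have Pk: "P *v k = (\<Sum>j\<in>UNIV. k $ j *s E (\<beta> j) r)" for k
    by (simp add: matrix_mult_sum colP)
  have axis: "A *v axis j 1 = column j A" for A :: "'k ^ 'n ^ 'n" and j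
    by (simp add: matrix_vector_mult_def axis_def column_def vec_eq_iff if_distrib cong: if_cong)
  have Lbase: "E i r \<in> L" if i: "i \<in> {1..r}" for i
  proof -
    consider "i = r" | "i \<in> basis_index" | "i = r - 1" "of_nat r = (0::'k)"
      using i by (fastforce simp: basis_index_def split: if_splits)
    then show ?thesis
    proof cases
      case 1
      have "P *v 0 \<in> L" unfolding L_def using K by fastforce
      then show ?thesis using 1 by (simp add: E_self)
    next
      case 2
      then obtain j where j: "i = \<beta> j" using \<beta> by (auto simp: bij_betw_def)
      have "P *v axis j 1 \<in> L" unfolding L_def using K by (auto simp: axis_def)
      then show ?thesis unfolding axis colP j .
    next
      case 3
      have "E i r = (\<Sum>j\<in>UNIV. (- 1) *s E (\<beta> j) r)"
        using last_basis_vector[OF 3(2)] 3(1) sum.reindex_bij_betw[OF \<beta>, of "\<lambda>i. (- 1) *s E i r"] by simp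
      also have "\<dots> = P *v (\<chi> j. - 1)" by (simp add: Pk)
      finally show ?thesis unfolding L_def using Kneg[OF K] by auto
    qed
  qed
  have "(matrix_inv P ** matrix h ** P) $ i $ j \<in> ?K" if h: "h \<in> H" for h i j
  proof -
    obtain \<sigma> where s: "acts_as h \<sigma>" using H_acts[OF h] by metis
    have lin: "Vector_Spaces.linear (*s) (*s) h"
      by unfold_locales (simp_all add: acts_as_add[OF s] acts_as_scale[OF s])
    have "\<beta> j \<in> basis_index" using \<beta> unfolding bij_betw_def by blast
    then have "\<beta> j \<in> {1..<r}" using basis_index_subset(1) by blast
    then have bj: "\<beta> j \<in> {1..r}" by simp
    have r: "r \<in> {1..r}" using r_ge_5 by simp
    have sr: "\<sigma> (\<beta> j) \<in> {1..r}" "\<sigma> r \<in> {1..r}"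
      using permutes_in_image[OF acts_as_perm[OF s]] bj r by blast+
    have "h (E (\<beta> j) r) = E (\<sigma> (\<beta> j)) r - E (\<sigma> r) r"
      using acts_as_E[OF s bj r] E_add[OF sr r] by (simp add: eq_diff_eq)
    then have "h (E (\<beta> j) r) \<in> L" using Ldiff Lbase sr by simp
    then obtain k :: "'k ^ 'n" where k: "h (E (\<beta> j) r) = P *v k" "\<forall>j. k $ j \<in> ?K" by (auto simp: L_def)
    have "column j (matrix_inv P ** matrix h ** P) = (matrix_inv P ** matrix h ** P) *v axis j 1"
      by (simp only: axis)
    also have "\<dots> = matrix_inv P *v (matrix h *v (P *v axis j 1))"
      by (simp add: matrix_vector_mul_assoc matrix_mul_assoc)
    also have "\<dots> = matrix_inv P *v (P *v k)"
      by (simp only: axis colP matrix_works[OF lin] k(1))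
    also have "\<dots> = k"
      using someI_ex[OF invP[unfolded invertible_def]]
      by (simp add: matrix_vector_mul_assoc matrix_inv_def)
    finally show ?thesis using k(2) by (simp add: column_def vec_eq_iff)
  qed
  then have "realisable_over_proper_subfield H"
    unfolding realisable_over_proper_subfield_def
    using prime_subfield_is_subfield proper invP by blast
  then show False using nr by contradiction
qed

end

lemma prime_field_CARD:
  assumes "range of_nat = (UNIV :: 'k::{field,finite} set)"
  shows "CHAR('k) = CARD('k)"
proof -
  have "(UNIV :: 'k set) = of_nat ` {..<CHAR('k)}"
  proof
    show "UNIV \<subseteq> (of_nat ` {..<CHAR('k)} :: 'k set)"
    proof
      fix x :: 'k
      have "x \<in> range of_nat" using assms by simp
      then obtain m where "x = of_nat m" by blast
      also have "\<dots> = of_nat (CHAR('k) * (m div CHAR('k)) + m mod CHAR('k))" by simp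
      also have "\<dots> = of_nat (m mod CHAR('k))" by (simp only: of_nat_add of_nat_mult of_nat_CHAR) simp
      finally show "x \<in> of_nat ` {..<CHAR('k)}"
        using finite_imp_CHAR_pos[where ?'a = 'k, OF finite_class.finite_UNIV] by simp
    qed
  qed simp
  moreover have "inj_on (of_nat :: nat \<Rightarrow> 'k) {..<CHAR('k)}"
  proof (rule inj_onI)
    have *: "m = n" if "m \<le> n" "n < CHAR('k)" "of_nat m = (of_nat n :: 'k)" for m n
    proof -
      have "of_nat (n - m) = (0 :: 'k)" using that by (simp add: of_nat_diff)
      then have "CHAR('k) dvd n - m" by (simp add: of_nat_eq_0_iff_char_dvd)
      then show ?thesis using that by (auto dest: dvd_imp_le)
    qed
    fix m n assume "m \<in> {..<CHAR('k)}" "n \<in> {..<CHAR('k)}" "of_nat m = (of_nat n :: 'k)"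
    then show "m = n" using *[of m n] *[of n m] by (cases "m \<le> n") auto
  qed
  ultimately show ?thesis by (metis card_image card_lessThan)
qed

text \<open>An automorphism fixes \<open>1\<close>, hence all multiples of \<open>1\<close>.\<close>

lemma prime_field_aut:
  assumes "range of_nat = (UNIV :: 'k::{field,finite} set)" "field_aut (s :: 'k \<Rightarrow> 'k)"
  shows "s c = c"
proof -
  have add: "s (a + b) = s a + s b" and mult: "s (a * b) = s a * s b" and "bij s" for a b
    using assms(2) by (auto simp: field_aut_def)
  have s0: "s 0 = 0" using add[of 0 0] by (metis add_0 add_cancel_right_right)
  have "s 1 \<noteq> 0" using s0 \<open>bij s\<close> by (metis bij_is_inj injD zero_neq_one)
  then have s1: "s 1 = 1" using mult[of 1 1] by simp
  have "s (of_nat m) = of_nat m" for m by (induction m) (simp_all add: s0 s1 add)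
  moreover obtain m where "c = of_nat m" using assms(1) by blast
  ultimately show ?thesis by simp
qed

text \<open>The isomorphism of \<open>H / Z(H)\<close> with the alternating group is used only through the two facts that every
element of \<open>H\<close> acts as some even permutation and that every even permutation arises.\<close>

lemma deleted_rep_exists:
  fixes H :: "('k::{field,finite} ^ 'n \<Rightarrow> 'k ^ 'n) set"
  assumes fd: "fully_deleted_perm_module r H" and r: "5 \<le> r"
  shows "\<exists>D. deleted_rep r H D"
proof -
  let ?HG = "perm_grp UNIV H"
  let ?Z = "group_center ?HG"
  obtain \<psi> \<Phi> where psi: "\<psi> \<in> iso (?HG Mod ?Z) (alt_group r)"
    and bij: "bij_betw \<Phi> (deleted_module r) (UNIV :: ('k ^ 'n) set)"
    and add: "\<And>a b. a \<in> zero_sum_vecs r \<Longrightarrow> b \<in> zero_sum_vecs r \<Longrightarrow>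
         \<Phi> (deleted_class r (\<lambda>i. a i + b i)) = \<Phi> (deleted_class r a) + \<Phi> (deleted_class r b)"
    and scale: "\<And>c a. a \<in> zero_sum_vecs r \<Longrightarrow> \<Phi> (deleted_class r (\<lambda>i. c * a i)) = c *s \<Phi> (deleted_class r a)"
    and act: "\<And>h a. h \<in> H \<Longrightarrow> a \<in> zero_sum_vecs r \<Longrightarrow>
         \<Phi> (deleted_class r (permute_coords (\<psi> (?Z #>\<^bsub>?HG\<^esub> h)) a)) = h (\<Phi> (deleted_class r a))"
    using fd unfolding fully_deleted_perm_module_def Let_def by blast
  define D where "D = (\<lambda>a. \<Phi> (deleted_class r a))"
  have z: "(\<lambda>_. 0 :: 'k) \<in> zero_sum_vecs r" by (simp add: zero_sum_vecs_def)
  have D0: "D (\<lambda>_. 0) = 0" using scale[OF z, of 0] by (simp add: D_def)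
  have const: "a \<in> constant_vecs r \<longleftrightarrow> (\<exists>t. \<forall>i\<in>{1..r}. a i = t)" if "a \<in> zero_sum_vecs r" for a :: "nat \<Rightarrow> 'k"
    using that by (auto simp: constant_vecs_def zero_sum_vecs_def fun_eq_iff)
  have cls: "deleted_class r a \<in> deleted_module r" if "a \<in> zero_sum_vecs r" for a :: "nat \<Rightarrow> 'k"
    using that by (simp add: deleted_class_def deleted_module_def quotientI)
  have clsD: "deleted_class r a = {b \<in> zero_sum_vecs r. (\<lambda>i. a i - b i) \<in> constant_vecs r}"
    if "a \<in> zero_sum_vecs r" for a :: "nat \<Rightarrow> 'k"
    using that by (auto simp: deleted_class_def deleted_rel_def zero_sum_diff)
  have D_eq_0: "D a = 0 \<longleftrightarrow> (\<exists>t. \<forall>i\<in>{1..r}. a i = t)" if a: "a \<in> zero_sum_vecs r" for a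
  proof -
    have "D a = 0 \<longleftrightarrow> deleted_class r a = deleted_class r (\<lambda>_. 0)"
      unfolding D0[symmetric] D_def using bij cls[OF a] cls[OF z] by (auto simp: bij_betw_def inj_on_eq_iff)
    also have "\<dots> \<longleftrightarrow> (\<exists>t. \<forall>i\<in>{1..r}. a i = t)"
    proof
      assume eq: "deleted_class r a = deleted_class r (\<lambda>_. 0)"
      have "a \<in> deleted_class r a" using a by (auto simp: clsD constant_vecs_def intro: exI[of _ 0])
      then have "(\<lambda>i. 0 - a i) \<in> constant_vecs r" unfolding eq clsD[OF z] by simp
      then obtain c where "\<And>i. i \<in> {1..r} \<Longrightarrow> 0 - a i = c" by (auto simp: constant_vecs_def fun_eq_iff)
      then have "\<forall>i\<in>{1..r}. a i = - c" by (metis diff_0 minus_minus)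
      then show "\<exists>t. \<forall>i\<in>{1..r}. a i = t" by blast
    next
      assume "\<exists>t. \<forall>i\<in>{1..r}. a i = t"
      then obtain t where t: "\<forall>i\<in>{1..r}. a i = t" by blast
      have "(\<lambda>i. a i - b i) \<in> constant_vecs r \<longleftrightarrow> (\<lambda>i. 0 - b i) \<in> constant_vecs r"
        if b: "b \<in> zero_sum_vecs r" for b
      proof -
        have "(\<exists>s. \<forall>i\<in>{1..r}. a i - b i = s) \<longleftrightarrow> (\<exists>s. \<forall>i\<in>{1..r}. 0 - b i = s)"
        proof
          assume "\<exists>s. \<forall>i\<in>{1..r}. a i - b i = s"
          then obtain s where "\<forall>i\<in>{1..r}. a i - b i = s" by blast
          then have "\<forall>i\<in>{1..r}. 0 - b i = s - t" using t by (auto simp: algebra_simps)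
          then show "\<exists>s. \<forall>i\<in>{1..r}. 0 - b i = s" by blast
        next
          assume "\<exists>s. \<forall>i\<in>{1..r}. 0 - b i = s"
          then obtain s where "\<forall>i\<in>{1..r}. 0 - b i = s" by blast
          then have "\<forall>i\<in>{1..r}. a i - b i = s + t" using t by (auto simp: algebra_simps)
          then show "\<exists>s. \<forall>i\<in>{1..r}. a i - b i = s" by blast
        qed
        then show ?thesis using const[OF zero_sum_diff[OF a b]] const[OF zero_sum_diff[OF z b]] by blast
      qed
      then show "deleted_class r a = deleted_class r (\<lambda>_. 0)" unfolding clsD[OF a] clsD[OF z] by blast
    qed
    finally show ?thesis .
  qed
  have coset: "carrier (?HG Mod ?Z) = (\<lambda>h. ?Z #>\<^bsub>?HG\<^esub> h) ` H"
    by (simp add: carrier_FactGroup perm_grp_simps)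
  have im: "\<psi> ` carrier (?HG Mod ?Z) = carrier (alt_group r)" using psi by (simp add: iso_def bij_betw_def)
  have "deleted_rep r H D"
  proof
    show "\<exists>a\<in>zero_sum_vecs r. D a = v" for v
    proof -
      obtain C where C: "C \<in> deleted_module r" "\<Phi> C = v" using bij unfolding bij_betw_def by (metis UNIV_I imageE)
      then obtain a where "a \<in> zero_sum_vecs r" "C = deleted_class r a"
        by (auto simp: deleted_module_def deleted_class_def elim: quotientE)
      then show ?thesis using C by (auto simp: D_def)
    qed
    show "\<exists>\<sigma>\<in>carrier (alt_group r). \<forall>a\<in>zero_sum_vecs r. h (D a) = D (permute_coords \<sigma> a)" if h: "h \<in> H" for h
    proof -
      have "\<psi> (?Z #>\<^bsub>?HG\<^esub> h) \<in> carrier (alt_group r)" unfolding im[symmetric] coset using h by blast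
      moreover have "\<forall>a\<in>zero_sum_vecs r. h (D a) = D (permute_coords (\<psi> (?Z #>\<^bsub>?HG\<^esub> h)) a)"
        using act[OF h] by (simp add: D_def)
      ultimately show ?thesis by blast
    qed
    show "\<exists>h\<in>H. \<forall>a\<in>zero_sum_vecs r. h (D a) = D (permute_coords \<sigma> a)" if s: "\<sigma> \<in> carrier (alt_group r)" for \<sigma>
    proof -
      obtain h where "h \<in> H" "\<sigma> = \<psi> (?Z #>\<^bsub>?HG\<^esub> h)" using s unfolding im[symmetric] coset by blast
      then show ?thesis by (auto simp: D_def act intro!: bexI[of _ h])
    qed
  qed (use r add scale D_eq_0 in \<open>auto simp: D_def\<close>)
  then show ?thesis by blast
qed

section \<open>Vectors as lists of entries\<close>

context deleted_rep begin

definition entries :: "(nat \<Rightarrow> 'k) \<Rightarrow> 'k multiset" where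
  "entries a = image_mset a (mset_set {1..r})"

text \<open>A permutation matching the entries exists because the multisets agree.  If it is odd, composing it with the
transposition of two positions with equal entries makes it even.\<close>

lemma H_conj_entries:
  assumes a: "a \<in> zero_sum_vecs r" and b: "b \<in> zero_sum_vecs r" and eq: "entries a = entries b"
    and rep: "i \<in> {1..r}" "j \<in> {1..r}" "i \<noteq> j" "a i = a j"
  shows "\<exists>h\<in>H. h (D a) = D b"
proof -
  obtain p where p: "p permutes {1..r}" "\<forall>x\<in>{1..r}. a x = b (p x)"
    using image_mset_eq_implies_permutes[of "{1..r}" a b] eq by (auto simp: entries_def)
  have "\<exists>q. q permutes {1..r} \<and> evenperm q \<and> (\<forall>x\<in>{1..r}. a x = b (q x))"
  proof (cases "evenperm p")
    case True then show ?thesis using p by blast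
  next
    case False
    let ?t = "Transposition.transpose i j"
    have t: "?t permutes {1..r}" using rep by (intro permutes_swap_id) auto
    have "permutation p" using p(1) permutation_permutes by blast
    then have "evenperm (p \<circ> ?t)"
      using False rep(3) by (simp add: evenperm_comp permutation_swap_id evenperm_swap)
    moreover have "a x = b ((p \<circ> ?t) x)" if x: "x \<in> {1..r}" for x
    proof -
      have "?t x \<in> {1..r}" using permutes_in_image[OF t] x by blast
      then have "b (p (?t x)) = a (?t x)" using p(2) by simp
      also have "\<dots> = a x" using rep(4) by (simp add: Transposition.transpose_def)
      finally show ?thesis by simp
    qed
    ultimately show ?thesis using permutes_compose[OF t p(1)] by blast
  qed
  then obtain q where q: "q permutes {1..r}" "evenperm q" "\<forall>x\<in>{1..r}. a x = b (q x)" by blast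
  obtain h where h: "h \<in> H" "acts_as h q" using even_acts[OF q(1,2)] by blast
  have "permute_coords q a = b"
  proof
    fix x
    show "permute_coords q a x = b x"
    proof (cases "x \<in> {1..r}")
      case True
      have "inv' q x \<in> {1..r}" using permutes_in_image[OF permutes_inv[OF q(1)]] True by blast
      then have "a (inv' q x) = b (q (inv' q x))" using q(3) by blast
      then show ?thesis using permutes_inverses(1)[OF q(1)] by (simp add: permute_coords_def)
    next
      case False
      then have "inv' q x = x" using permutes_not_in[OF permutes_inv[OF q(1)]] by blast
      then show ?thesis using False a b by (simp add: permute_coords_def zero_sum_vecs_def)
    qed
  qed
  then show ?thesis using acts_asD[OF h(2) a] h(1) by auto
qed

lemma H_transitive_roots:
  assumes "i \<in> {1..r}" "j \<in> {1..r}" "i \<noteq> j" "k \<in> {1..r}" "l \<in> {1..r}" "k \<noteq> l"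
  shows "\<exists>h\<in>H. h (E i j) = E k l"
proof -
  have val: "entries (root_vec i j) = add_mset 1 (add_mset (-1) (replicate_mset (r - 2) 0))"
    if ij: "i \<in> {1..r}" "j \<in> {1..r}" "i \<noteq> j" for i j
  proof -
    have "mset_set {1..r} = add_mset i (add_mset j (mset_set ({1..r} - {i, j})))"
      using ij mset_set.remove[of "{1..r}" i] mset_set.remove[of "{1..r} - {i}" j]
      by (simp add: Diff_insert2[symmetric])
    moreover have "image_mset (root_vec i j) (mset_set ({1..r} - {i, j})) = image_mset (\<lambda>_. 0) (mset_set ({1..r} - {i, j}))"
      by (intro image_mset_cong) (auto simp: root_vec_def)
    moreover have "card ({1..r} - {i, j}) = r - 2" using ij by (simp add: card_Diff_subset)
    ultimately show ?thesis using ij by (simp add: entries_def root_vec_def image_mset_const_eq)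
  qed
  have "card {i, j} < r" using r_ge_5 by (simp add: card_insert_if)
  then obtain m where m: "m \<in> {1..r}" "m \<notin> {i, j}" using exists_other[of "{i, j}"] by auto
  have "card {i, j, m} < r" using r_ge_5 by (simp add: card_insert_if)
  then obtain n where n: "n \<in> {1..r}" "n \<notin> {i, j, m}" using exists_other[of "{i, j, m}"] by auto
  show ?thesis unfolding E_def
  proof (rule H_conj_entries[of _ _ m n])
    show "root_vec i j \<in> zero_sum_vecs r" "root_vec k l \<in> zero_sum_vecs r" using assms by (intro zero_sum_root; simp)+
    show "entries (root_vec i j) = entries (root_vec k l)" using assms val by simp
    show "root_vec i j m = root_vec i j n" using m n by (simp add: root_vec_def)
  qed (use m n in auto)
qed

definition lvec :: "'k list \<Rightarrow> nat \<Rightarrow> 'k" where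
  "lvec xs = (\<lambda>i. if i \<in> {1..r} then xs ! (i - 1) else 0)"

text \<open>Representing module elements by lists makes sums, scalar multiples and multisets of entries of explicit
vectors computable by rewriting.\<close>

definition of_list :: "'k list \<Rightarrow> 'k ^ 'n" where
  "of_list xs = D (lvec xs)"

definition admissible :: "'k list \<Rightarrow> bool" where
  "admissible xs \<longleftrightarrow> length xs = r \<and> sum_list xs = 0"

lemma map_lvec: "length xs = r \<Longrightarrow> map (lvec xs) [1..<Suc r] = xs"
  by (rule nth_equalityI) (auto simp: lvec_def nth_append simp del: upt_Suc)

lemma entries_lvec: "length xs = r \<Longrightarrow> entries (lvec xs) = mset xs"
proof -
  assume "length xs = r"
  have "{1..r} = set [1..<Suc r]" by auto
  then have "entries (lvec xs) = image_mset (lvec xs) (mset [1..<Suc r])"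
    unfolding entries_def by (metis distinct_upt mset_set_set)
  also have "\<dots> = mset (map (lvec xs) [1..<Suc r])" by (rule mset_map[symmetric])
  also have "\<dots> = mset xs" using map_lvec[OF \<open>length xs = r\<close>] by (rule arg_cong)
  finally show ?thesis .
qed

lemma sum_lvec: "length xs = r \<Longrightarrow> (\<Sum>i=1..r. lvec xs i) = sum_list xs"
proof -
  assume l: "length xs = r"
  have "(\<Sum>i=1..r. lvec xs i) = sum_mset (entries (lvec xs))" by (simp add: entries_def sum_unfold_sum_mset)
  then show ?thesis using entries_lvec[OF l] by (simp add: sum_mset_sum_list)
qed

lemma lvec_zero_sum: "admissible xs \<Longrightarrow> lvec xs \<in> zero_sum_vecs r"
  using sum_lvec[of xs] unfolding admissible_def zero_sum_vecs_def by (simp add: lvec_def)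

lemma of_list_surj: "\<exists>xs. admissible xs \<and> v = of_list xs"
proof -
  obtain a where a: "a \<in> zero_sum_vecs r" "v = D a" using D_surj by metis
  let ?xs = "map a [1..<Suc r]"
  have l: "length ?xs = r" by simp
  have eq: "lvec ?xs = a"
    using a(1) by (auto simp: fun_eq_iff lvec_def zero_sum_vecs_def nth_append simp del: upt_Suc)
  have "sum_list ?xs = 0" using sum_lvec[OF l] a(1) unfolding eq by (simp add: zero_sum_vecs_def)
  then show ?thesis using a(2) l eq by (intro exI[of _ ?xs]) (simp add: admissible_def of_list_def)
qed

lemma of_list_eq_iff:
  assumes "admissible xs" "admissible ys"
  shows "of_list xs = of_list ys \<longleftrightarrow> (\<exists>t. xs = map (\<lambda>x. x + t) ys)"
proof -
  have l: "length xs = r" "length ys = r" using assms by (auto simp: admissible_def)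
  have "of_list xs = of_list ys \<longleftrightarrow> (\<exists>t. \<forall>i\<in>{1..r}. lvec xs i = lvec ys i + t)"
    unfolding of_list_def by (rule D_eq_iff[OF lvec_zero_sum lvec_zero_sum]) fact+
  also have "\<dots> \<longleftrightarrow> (\<exists>t. \<forall>i<r. xs ! i = ys ! i + t)"
  proof (intro ex_cong1)
    fix t
    show "(\<forall>i\<in>{1..r}. lvec xs i = lvec ys i + t) \<longleftrightarrow> (\<forall>i<r. xs ! i = ys ! i + t)"
    proof
      assume *: "\<forall>i\<in>{1..r}. lvec xs i = lvec ys i + t"
      show "\<forall>i<r. xs ! i = ys ! i + t"
      proof (intro allI impI)
        fix i assume "i < r" then show "xs ! i = ys ! i + t" using bspec[OF *, of "Suc i"] by (simp add: lvec_def)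
      qed
    qed (auto simp: lvec_def)
  qed
  also have "\<dots> \<longleftrightarrow> (\<exists>t. xs = map (\<lambda>x. x + t) ys)"
    using l by (auto simp: list_eq_iff_nth_eq)
  finally show ?thesis .
qed

lemma of_list_add:
  assumes "admissible xs" "admissible ys"
  shows "of_list (map2 (+) xs ys) = of_list xs + of_list ys" "admissible (map2 (+) xs ys)"
proof -
  have l: "length xs = r" "length ys = r" using assms by (auto simp: admissible_def)
  have eq: "lvec (map2 (+) xs ys) = (\<lambda>i. lvec xs i + lvec ys i)"
    using l by (auto simp: fun_eq_iff lvec_def)
  show "of_list (map2 (+) xs ys) = of_list xs + of_list ys"
    unfolding of_list_def eq by (rule D_add[OF lvec_zero_sum lvec_zero_sum]) fact+
  have "sum_list (map2 (+) xs ys) = 0"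
    using sum_lvec[of "map2 (+) xs ys"] sum_lvec[OF l(1)] sum_lvec[OF l(2)] l assms
    by (simp add: eq sum.distrib admissible_def)
  then show "admissible (map2 (+) xs ys)" using l by (simp add: admissible_def)
qed

lemma of_list_scale:
  assumes "admissible xs"
  shows "of_list (map ((*) c) xs) = c *s of_list xs" "admissible (map ((*) c) xs)"
proof -
  have l: "length xs = r" using assms by (auto simp: admissible_def)
  have eq: "lvec (map ((*) c) xs) = (\<lambda>i. c * lvec xs i)"
    using l by (auto simp: fun_eq_iff lvec_def)
  show "of_list (map ((*) c) xs) = c *s of_list xs"
    unfolding of_list_def eq by (rule D_scale[OF lvec_zero_sum]) fact
  show "admissible (map ((*) c) xs)" using assms by (simp add: admissible_def sum_list_const_mult)
qed

lemma H_conj_of_list: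
  assumes x: "admissible xs" and y: "admissible ys" and eq: "mset xs = mset ys" and nd: "\<not> distinct xs"
  shows "\<exists>h\<in>H. h (of_list xs) = of_list ys"
proof -
  have l: "length xs = r" "length ys = r" using x y by (auto simp: admissible_def)
  obtain i j where ij: "i < r" "j < r" "i \<noteq> j" "xs ! i = xs ! j"
    using nd l by (auto simp: distinct_conv_nth)
  show ?thesis unfolding of_list_def
  proof (rule H_conj_entries[of _ _ "Suc i" "Suc j"])
    show "entries (lvec xs) = entries (lvec ys)" using l eq by (simp add: entries_lvec)
    show "lvec xs (Suc i) = lvec xs (Suc j)" using ij by (simp add: lvec_def)
  qed (use ij x y in \<open>simp_all add: lvec_zero_sum\<close>)
qed

end

section \<open>Covering the module by sums of two vectors\<close>

locale prime_deleted_affine = deleted_affine r H D G0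
  for r and H :: "('k::{field,finite} ^ 'n \<Rightarrow> 'k ^ 'n) set" and D G0 +
  assumes prime_field: "range of_nat = (UNIV :: 'k set)"
begin

definition same_orbit :: "'k ^ 'n \<Rightarrow> 'k ^ 'n \<Rightarrow> bool" where
  "same_orbit v w \<longleftrightarrow> (\<exists>g\<in>G0. g v = w)"

lemma same_orbit_H: "h \<in> H \<Longrightarrow> same_orbit v (h v)"
  using H_G0 by (auto simp: same_orbit_def)

lemma same_orbit_sym: "same_orbit v w \<Longrightarrow> same_orbit w v"
  unfolding same_orbit_def using G0_inv G0_inv_apply by metis

lemma same_orbit_trans: "same_orbit u v \<Longrightarrow> same_orbit v w \<Longrightarrow> same_orbit u w"
  unfolding same_orbit_def using G0_compose by (metis comp_apply)

lemma sphere_iff: "w \<in> sphere G0 v \<longleftrightarrow> same_orbit v w \<or> same_orbit v (- w)"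
  by (auto simp: sphere_def same_orbit_def) (metis minus_minus)+

lemma same_orbit_minus: "same_orbit v w \<Longrightarrow> same_orbit (- v) (- w)"
  unfolding same_orbit_def using G0_minus by metis

lemma sphere_same_orbit: "same_orbit v v' \<Longrightarrow> same_orbit w w' \<Longrightarrow> w' \<in> sphere G0 v' \<Longrightarrow> w \<in> sphere G0 v"
  unfolding sphere_iff using same_orbit_trans same_orbit_sym same_orbit_minus by (metis minus_minus)

text \<open>Covering depends only on the orbits of both vectors, so it suffices to check representatives.\<close>

lemma cover_same_orbit:
  assumes v: "same_orbit v v'" and w: "same_orbit w w'"
  shows "cover1 G0 v' w' \<Longrightarrow> cover1 G0 v w" "cover2 G0 v' w' \<Longrightarrow> cover2 G0 v w"
proof -
  have w0: "w' = 0 \<Longrightarrow> w = 0" using w G0_eq_0 by (auto simp: same_orbit_def)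
  show c1: "cover1 G0 v' w' \<Longrightarrow> cover1 G0 v w"
    using w0 sphere_same_orbit[OF v w] by (auto simp: cover1_def)
  show "cover2 G0 v w" if c: "cover2 G0 v' w'"
  proof (cases "cover1 G0 v' w'")
    case True then show ?thesis using c1 by (simp add: cover2_def)
  next
    case False
    then obtain x y where xy: "x \<in> sphere G0 v'" "y \<in> sphere G0 v'" "w' = x + y"
      using c by (auto simp: cover2_def)
    obtain g where g: "g \<in> G0" "g w' = w" using same_orbit_sym[OF w] by (auto simp: same_orbit_def)
    have "g z \<in> sphere G0 v" if "z \<in> sphere G0 v'" for z
      using sphere_same_orbit[OF v _ that, of "g z"] same_orbit_sym g(1) by (auto simp: same_orbit_def)
    then show ?thesis using xy g G0_add unfolding cover2_def by blast
  qed
qed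

lemma same_orbit_of_list:
  assumes "admissible xs" "admissible ys" "mset (map (\<lambda>x. x + t) xs) = mset ys" "\<not> distinct ys"
  shows "same_orbit (of_list xs) (of_list ys)"
proof -
  have "sum_list (map (\<lambda>x. x + t) xs) = sum_list ys"
    using assms(3) by (metis sum_mset_sum_list)
  then have a: "admissible (map (\<lambda>x. x + t) xs)" using assms(1,2) by (simp add: admissible_def)
  have "\<not> distinct (map (\<lambda>x. x + t) xs)"
    using assms(3,4) mset_eq_imp_distinct_iff by blast
  then obtain h where "h \<in> H" "h (of_list (map (\<lambda>x. x + t) xs)) = of_list ys"
    using H_conj_of_list[OF a assms(2,3)] by blast
  moreover have "of_list (map (\<lambda>x. x + t) xs) = of_list xs" using of_list_eq_iff[OF a assms(1)] by blast
  ultimately show ?thesis using same_orbit_H by metis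
qed

lemma sphere_of_list:
  assumes "admissible xs" "admissible ys" "mset (map (\<lambda>x. x + t) xs) = mset ys" "\<not> distinct ys"
  shows "of_list xs \<in> sphere G0 (of_list ys)"
  using same_orbit_sym[OF same_orbit_of_list[OF assms]] by (simp add: sphere_iff)

lemma cover2_sum:
  assumes "admissible xs" "admissible ys" "of_list xs \<in> sphere G0 v" "of_list ys \<in> sphere G0 v"
  shows "cover2 G0 v (of_list (map2 (+) xs ys))"
  using of_list_add[OF assms(1,2)] assms(3,4) by (auto simp: cover2_def)

lemma cover2_refl: "cover2 G0 v v"
proof -
  have "id \<in> G0"
  proof -
    obtain h where "h \<in> H" "acts_as h id" using even_acts[of id] permutes_id evenperm_id by blast
    then show ?thesis using acts_as_fun_eq acts_as_id H_G0 by blast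
  qed
  then show ?thesis unfolding cover2_def cover1_def sphere_def by (auto intro!: bexI[of _ id])
qed

lemma of_nat_0_iff: "of_nat m = (0::'k) \<longleftrightarrow> CARD('k) dvd m"
  using prime_field_CARD[OF prime_field] of_nat_eq_0_iff_char_dvd[of m, where ?'a = 'k] by simp

section \<open>Lower bounds from vectors far from constant\<close>

definition keeps_roots :: bool where
  "keeps_roots \<longleftrightarrow> (\<forall>g\<in>G0. \<exists>c u v. u \<in> {1..r} \<and> v \<in> {1..r} \<and> u \<noteq> v \<and> g (E 1 2) = c *s E u v)"

lemma sphere_root:
  assumes "keeps_roots" "x \<in> sphere G0 (E 1 2)"
  shows "\<exists>c u v. u \<in> {1..r} \<and> v \<in> {1..r} \<and> x = D (\<lambda>i. c * root_vec u v i)"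
proof -
  obtain g where g: "g \<in> G0" "x = g (E 1 2) \<or> x = - g (E 1 2)" using assms(2) by (auto simp: sphere_def)
  obtain c u v where c: "u \<in> {1..r}" "v \<in> {1..r}" "g (E 1 2) = c *s E u v"
    using assms(1) g(1) unfolding keeps_roots_def by blast
  then have "x = c *s E u v \<or> x = (- c) *s E u v" using g(2) by auto
  then show ?thesis using c(1,2) D_scale[OF zero_sum_root[OF c(1,2)]] unfolding E_def by metis
qed

text \<open>If \<open>f\<close> represents the same element as \<open>xs\<close>, then \<open>xs\<close> is \<open>f\<close> plus a constant \<open>t\<close>; summing all entries
shows \<open>of_nat r * t = 0\<close>.  So \<open>xs\<close> has the entry \<open>t\<close> wherever \<open>f\<close> vanishes.\<close>

lemma of_list_support:
  assumes a: "admissible xs" and f: "f \<in> zero_sum_vecs r" "of_list xs = D f"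
    and S: "finite S" "\<And>i. i \<notin> S \<Longrightarrow> f i = 0"
  shows "\<exists>t. of_nat r * t = 0 \<and> length (filter (\<lambda>x. x \<noteq> t) xs) \<le> card S"
proof -
  have l: "length xs = r" using a by (simp add: admissible_def)
  obtain t where t: "\<And>i. i \<in> {1..r} \<Longrightarrow> lvec xs i = f i + t"
    using f(2) D_eq_iff[OF lvec_zero_sum[OF a] f(1)] unfolding of_list_def by blast
  have "0 = (\<Sum>i=1..r. lvec xs i)" using sum_lvec[OF l] a by (simp add: admissible_def)
  also have "\<dots> = (\<Sum>i=1..r. f i + t)" using t by (intro sum.cong) auto
  also have "\<dots> = of_nat r * t" using f(1) by (simp add: sum.distrib zero_sum_vecs_def)
  finally have "of_nat r * t = 0" by simp
  moreover have "length (filter (\<lambda>x. x \<noteq> t) xs) \<le> card S"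
  proof -
    have "Suc ` {i. i < length xs \<and> xs ! i \<noteq> t} \<subseteq> S"
    proof
      fix j assume "j \<in> Suc ` {i. i < length xs \<and> xs ! i \<noteq> t}"
      then obtain i where i: "j = Suc i" "i < r" "xs ! i \<noteq> t" using l by auto
      then have "f j \<noteq> 0" using t[of j] by (auto simp: lvec_def)
      then show "j \<in> S" using S(2) by blast
    qed
    then have "card (Suc ` {i. i < length xs \<and> xs ! i \<noteq> t}) \<le> card S" by (rule card_mono[OF S(1)])
    then show ?thesis by (simp add: length_filter_conv_card card_image)
  qed
  ultimately show ?thesis by blast
qed

text \<open>A multiple of a root has at most two nonzero entries.\<close>

lemma not_cover1_if_far:
  assumes kr: "keeps_roots" and a: "admissible xs"
    and far: "\<And>t. of_nat r * t = 0 \<Longrightarrow> 3 \<le> length (filter (\<lambda>x. x \<noteq> t) xs)"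
  shows "\<not> cover1 G0 (E 1 2) (of_list xs)"
proof
  assume c: "cover1 G0 (E 1 2) (of_list xs)"
  have "\<exists>f S. f \<in> zero_sum_vecs r \<and> of_list xs = D f \<and> finite S \<and> card S \<le> 2 \<and> (\<forall>i. i \<notin> S \<longrightarrow> f i = 0)"
  proof (cases "of_list xs = 0")
    case True
    have z: "(\<lambda>_. 0) \<in> zero_sum_vecs r" by (simp add: zero_sum_vecs_def)
    then have "D (\<lambda>_. 0) = 0" using D_eq_0_iff[of "\<lambda>_. 0"] by blast
    then show ?thesis using z True by (intro exI[of _ "\<lambda>_. 0"] exI[of _ "{}"]) simp
  next
    case False
    then obtain c u v where u: "u \<in> {1..r}" "v \<in> {1..r}" "of_list xs = D (\<lambda>i. c * root_vec u v i)"
      using c sphere_root[OF kr] unfolding cover1_def by blast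
    then show ?thesis
      using zero_sum_scale[OF zero_sum_root[OF u(1,2)], of c]
      by (intro exI[of _ "\<lambda>i. c * root_vec u v i"] exI[of _ "{u, v}"])
         (simp add: card_insert_if, simp add: root_vec_def)
  qed
  then obtain f S where f: "f \<in> zero_sum_vecs r" "of_list xs = D f" "finite S" "card S \<le> 2" "\<And>i. i \<notin> S \<Longrightarrow> f i = 0"
    by blast
  obtain t where "of_nat r * t = 0" "length (filter (\<lambda>x. x \<noteq> t) xs) \<le> card S"
    using of_list_support[OF a f(1,2,3,5)] by blast
  then show False using far[of t] f(4) by linarith
qed

text \<open>A sum of two multiples of roots has at most four nonzero entries.\<close>

lemma not_cover2_if_far:
  assumes kr: "keeps_roots" and a: "admissible xs"
    and far: "\<And>t. of_nat r * t = 0 \<Longrightarrow> 5 \<le> length (filter (\<lambda>x. x \<noteq> t) xs)"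
  shows "\<not> cover2 G0 (E 1 2) (of_list xs)"
proof
  assume c: "cover2 G0 (E 1 2) (of_list xs)"
  have "\<not> cover1 G0 (E 1 2) (of_list xs)"
  proof (rule not_cover1_if_far[OF kr a])
    show "3 \<le> length (filter (\<lambda>x. x \<noteq> t) xs)" if "of_nat r * t = 0" for t using far[OF that] by linarith
  qed
  then obtain x y where xy: "x \<in> sphere G0 (E 1 2)" "y \<in> sphere G0 (E 1 2)" "of_list xs = x + y"
    using c by (auto simp: cover2_def)
  obtain b i j where x: "i \<in> {1..r}" "j \<in> {1..r}" "x = D (\<lambda>m. b * root_vec i j m)"
    using sphere_root[OF kr xy(1)] by blast
  obtain c k l where y: "k \<in> {1..r}" "l \<in> {1..r}" "y = D (\<lambda>m. c * root_vec k l m)"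
    using sphere_root[OF kr xy(2)] by blast
  let ?f = "\<lambda>m. b * root_vec i j m + c * root_vec k l m"
  have z: "(\<lambda>m. b * root_vec i j m) \<in> zero_sum_vecs r" "(\<lambda>m. c * root_vec k l m) \<in> zero_sum_vecs r"
    using x y by (auto intro!: zero_sum_scale zero_sum_root)
  have f: "?f \<in> zero_sum_vecs r" "of_list xs = D ?f"
    using zero_sum_add[OF z] D_add[OF z] xy(3) x(3) y(3) by simp_all
  have "card {i, j, k, l} \<le> 4" by (simp add: card_insert_if)
  moreover have "?f m = 0" if "m \<notin> {i, j, k, l}" for m using that by (simp add: root_vec_def)
  then obtain t where "of_nat r * t = 0" "length (filter (\<lambda>x. x \<noteq> t) xs) \<le> card {i, j, k, l}"
    using of_list_support[OF a f, of "{i, j, k, l}"] by blast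
  ultimately show False using far[of t] by linarith
qed

lemma not_covering:
  assumes "keeps_roots" "admissible xs"
  shows "(\<And>t. of_nat r * t = 0 \<Longrightarrow> 3 \<le> length (filter (\<lambda>x. x \<noteq> t) xs)) \<Longrightarrow> \<not> (\<forall>v w. v \<noteq> 0 \<longrightarrow> cover1 G0 v w)"
    "(\<And>t. of_nat r * t = 0 \<Longrightarrow> 5 \<le> length (filter (\<lambda>x. x \<noteq> t) xs)) \<Longrightarrow> \<not> (\<forall>v w. v \<noteq> 0 \<longrightarrow> cover2 G0 v w)"
proof -
  have "E 1 2 \<noteq> 0" using r_ge_5 by (intro E_nonzero) auto
  then show "(\<And>t. of_nat r * t = 0 \<Longrightarrow> 3 \<le> length (filter (\<lambda>x. x \<noteq> t) xs)) \<Longrightarrow> \<not> (\<forall>v w. v \<noteq> 0 \<longrightarrow> cover1 G0 v w)"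
    "(\<And>t. of_nat r * t = 0 \<Longrightarrow> 5 \<le> length (filter (\<lambda>x. x \<noteq> t) xs)) \<Longrightarrow> \<not> (\<forall>v w. v \<noteq> 0 \<longrightarrow> cover2 G0 v w)"
    using not_cover1_if_far[OF assms] not_cover2_if_far[OF assms] by blast+
qed

lemma cover_reps:
  assumes reps: "\<And>v. v \<noteq> 0 \<Longrightarrow> \<exists>\<rho>\<in>R. same_orbit v \<rho>"
  shows "(\<And>\<rho> \<sigma>. \<rho> \<in> R \<Longrightarrow> \<sigma> \<in> R \<Longrightarrow> cover1 G0 \<rho> \<sigma>) \<Longrightarrow> v \<noteq> 0 \<Longrightarrow> cover1 G0 v w"
    "(\<And>\<rho> \<sigma>. \<rho> \<in> R \<Longrightarrow> \<sigma> \<in> R \<Longrightarrow> cover2 G0 \<rho> \<sigma>) \<Longrightarrow> v \<noteq> 0 \<Longrightarrow> cover2 G0 v w"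
proof -
  show "cover1 G0 v w" if "\<And>\<rho> \<sigma>. \<rho> \<in> R \<Longrightarrow> \<sigma> \<in> R \<Longrightarrow> cover1 G0 \<rho> \<sigma>" "v \<noteq> 0"
  proof (cases "w = 0")
    case False
    then show ?thesis using that reps[of v] reps[of w] cover_same_orbit(1) by blast
  qed (simp add: cover1_def)
  show "cover2 G0 v w" if "\<And>\<rho> \<sigma>. \<rho> \<in> R \<Longrightarrow> \<sigma> \<in> R \<Longrightarrow> cover2 G0 \<rho> \<sigma>" "v \<noteq> 0"
  proof (cases "w = 0")
    case False
    then show ?thesis using that reps[of v] reps[of w] cover_same_orbit(2) by blast
  qed (simp add: cover2_def cover1_def)
qed

section \<open>Characteristic two\<close>

definition ones :: "nat \<Rightarrow> 'k list" where
  "ones k = replicate k 1 @ replicate (r - k) 0"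

lemma ones_admissible: "CARD('k) dvd k \<Longrightarrow> k \<le> r \<Longrightarrow> admissible (ones k)"
  by (simp add: admissible_def ones_def sum_list_replicate of_nat_0_iff)

lemma ones_not_distinct: "k \<le> r \<Longrightarrow> \<not> distinct (ones k)"
proof
  assume k: "k \<le> r" and "distinct (ones k)"
  then have "card (set (ones k)) = r" by (simp add: distinct_card) (simp add: ones_def)
  moreover have "card (set (ones k)) \<le> card {0, 1 :: 'k}" by (intro card_mono) (auto simp: ones_def)
  ultimately show False using r_ge_5 by simp
qed

lemma binary_field:
  assumes "CARD('k) = 2" shows "(x::'k) = 0 \<or> x = 1" "(2::'k) = 0"
proof -
  show two: "(2::'k) = 0" using of_nat_0_iff[of 2] assms by simp
  have "x \<in> range of_nat" using prime_field by simp
  then obtain m where m: "x = of_nat m" by blast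
  show "x = 0 \<or> x = 1"
    using two by (cases "even m") (auto simp: m elim!: evenE oddE)
qed

text \<open>Over the field with two elements a vector is the indicator of an even subset, and \<open>H\<close> is transitive
on the subsets of each size.\<close>

lemma even_subset_orbits:
  assumes card: "CARD('k) = 2"
  shows "\<exists>k. even k \<and> k \<le> r \<and> same_orbit v (of_list (ones k))"
proof -
  obtain xs where xs: "admissible xs" "v = of_list xs" using of_list_surj by blast
  have "mset xs = replicate_mset (count_list xs 1) 1 + replicate_mset (count_list xs 0) 0 \<and>
      sum_list xs = of_nat (count_list xs 1) \<and> length xs = count_list xs 1 + count_list xs 0" for xs :: "'k list"
  proof (induction xs)
    case (Cons x xs)
    then show ?case using binary_field(1)[OF card, of x] by auto
  qed simp
  note * = this[of xs]
  define k where "k = count_list xs 1"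
  have k: "k \<le> r" "count_list xs 0 = r - k" using * xs(1) by (auto simp: admissible_def k_def)
  have "of_nat k = (0 :: 'k)" using * xs(1) by (simp add: admissible_def k_def)
  then have e: "even k" using of_nat_0_iff[of k] card by simp
  have "mset (map (\<lambda>x. x + 0) xs) = mset (ones k)" using * k(2) by (simp add: ones_def k_def)
  then have "same_orbit v (of_list (ones k))"
    unfolding xs(2) using e k card by (intro same_orbit_of_list[OF xs(1), where t = 0] ones_admissible ones_not_distinct) auto
  then show ?thesis using e k by blast
qed

text \<open>Adding the constant \<open>1\<close> passes to the complement; this constant has sum zero if \<open>r\<close> is even.\<close>

lemma binary_complement:
  assumes card: "CARD('k) = 2" and "even k" "k \<le> r" "even r"
  shows "same_orbit (of_list (ones k)) (of_list (ones (r - k)))"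
proof (rule same_orbit_of_list[where t = 1])
  have "(1::'k) + 1 = 0" using binary_field(2)[OF card] by simp
  then show "mset (map (\<lambda>x. x + 1) (ones k)) = mset (ones (r - k))"
    using assms by (simp add: ones_def map_replicate_const)
qed (use assms in \<open>auto intro!: ones_admissible ones_not_distinct\<close>)

lemma same_orbit_0: "same_orbit v 0 \<Longrightarrow> v = 0"
  using G0_eq_0 by (auto simp: same_orbit_def)

lemma of_list_zero: "of_list (replicate r 0) = 0"
proof -
  have "lvec (replicate r 0) = (\<lambda>_. 0)" by (auto simp: fun_eq_iff lvec_def)
  then show ?thesis using D_eq_0_iff[of "\<lambda>_. 0"] by (simp add: of_list_def zero_sum_vecs_def)
qed

lemma binary_orbit_representatives:
  assumes card: "CARD('k) = 2" and v: "v \<noteq> 0" and r: "r \<in> {5, 6, 8, 10}"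
  shows "same_orbit v (of_list (ones 2)) \<or> r \<noteq> 6 \<and> same_orbit v (of_list (ones 4))"
proof -
  obtain k where k: "even k" "k \<le> r" "same_orbit v (of_list (ones k))" using even_subset_orbits[OF card] by blast
  have c: "same_orbit v (of_list (ones (r - k)))" if "even r"
    using same_orbit_trans[OF k(3) binary_complement[OF card k(1,2) that]] .
  have z: "of_list (ones 0) = 0" using of_list_zero by (simp add: ones_def)
  have "k \<noteq> 0" using k(3) v same_orbit_0 z by metis
  moreover have "\<not> (even r \<and> k = r)" using c v same_orbit_0 z by auto
  ultimately have "k = 2 \<or> k = 4 \<and> r \<noteq> 6 \<or> even r \<and> r - k = 2 \<or> even r \<and> r - k = 4 \<and> r \<noteq> 6"
    using r k(1,2) by (elim insertE emptyE) (auto elim!: evenE, presburger+)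
  then show ?thesis using k(3) c by auto
qed

lemma binary_6_cover1:
  assumes "CARD('k) = 2" "r = 6" "v \<noteq> 0" shows "cover1 G0 v w"
proof (rule cover_reps(1)[of "{of_list (ones 2)}"])
  show "\<exists>\<rho>\<in>{of_list (ones 2)}. same_orbit v \<rho>" if "v \<noteq> 0" for v
    using binary_orbit_representatives[OF assms(1) that] assms(2) by simp
  show "cover1 G0 \<rho> \<sigma>" if "\<rho> \<in> {of_list (ones 2)}" "\<sigma> \<in> {of_list (ones 2)}" for \<rho> \<sigma>
  proof -
    have "admissible (ones 2)" using assms(1) r_ge_5 by (intro ones_admissible) auto
    then have "of_list (ones 2) \<in> sphere G0 (of_list (ones 2))"
      using ones_not_distinct[of 2] r_ge_5 by (intro sphere_of_list[where t = 0]) auto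
    then show ?thesis using that by (simp add: cover1_def)
  qed
qed fact

text \<open>Two disjoint pairs have a union of size four, and two sets of size four meeting in three points have a
symmetric difference of size two.\<close>

lemma binary_5_8_10_cover2:
  assumes card: "CARD('k) = 2" and r: "r \<in> {5, 8, 10}" and v: "v \<noteq> 0" shows "cover2 G0 v w"
proof (rule cover_reps(2)[of "{of_list (ones 2), of_list (ones 4)}"])
  show "\<exists>\<rho>\<in>{of_list (ones 2), of_list (ones 4)}. same_orbit v \<rho>" if "v \<noteq> 0" for v
    using binary_orbit_representatives[OF card that] r by auto
  have two: "(1::'k) + 1 = 0" using binary_field(2)[OF card] by simp
  have a: "admissible (ones 2)" "admissible (ones 4)" using card r_ge_5 by (auto intro!: ones_admissible)
  have nd: "\<not> distinct (ones 2)" "\<not> distinct (ones 4)" using r_ge_5 by (auto intro!: ones_not_distinct)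
  have 1: "cover2 G0 (of_list (ones 2)) (of_list (ones 4))"
  proof -
    let ?y = "[0, 0, 1, 1] @ replicate (r - 4) 0 :: 'k list"
    have e: "ones 4 = map2 (+) (ones 2) ?y"
      using r by (auto simp: ones_def eval_nat_numeral)
    have m: "mset ?y = mset (ones 2)"
      using r by (auto simp: ones_def eval_nat_numeral)
    have ay: "admissible ?y" using two r_ge_5 by (simp add: admissible_def sum_list_replicate)
    show ?thesis unfolding e
      using m by (intro cover2_sum a ay sphere_of_list[where t = 0] nd) auto
  qed
  have 2: "cover2 G0 (of_list (ones 4)) (of_list (ones 2))"
  proof -
    \<comment> \<open>\<open>{1, 3, 4, 5}\<close> and \<open>{2, 3, 4, 5}\<close> have symmetric difference \<open>{1, 2}\<close>.\<close>
    let ?x = "[1, 0, 1, 1, 1] @ replicate (r - 5) 0 :: 'k list"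
    let ?y = "[0, 1, 1, 1, 1] @ replicate (r - 5) 0 :: 'k list"
    have e: "ones 2 = map2 (+) ?x ?y"
      using r two by (auto simp: ones_def eval_nat_numeral)
    have m: "mset ?x = mset (ones 4)" "mset ?y = mset (ones 4)"
      using r by (auto simp: ones_def eval_nat_numeral)
    have ay: "admissible ?x" "admissible ?y" using two r_ge_5
      by (simp_all add: admissible_def sum_list_replicate)
    show ?thesis unfolding e
      using m by (intro cover2_sum a ay sphere_of_list[where t = 0] nd) auto
  qed
  show "cover2 G0 \<rho> \<sigma>" if "\<rho> \<in> {of_list (ones 2), of_list (ones 4)}" "\<sigma> \<in> {of_list (ones 2), of_list (ones 4)}" for \<rho> \<sigma>
    using that 1 2 cover2_refl by auto
qed fact

end

section \<open>Characteristic three and degree six\<close>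

context prime_deleted_affine begin

lemma ternary_field:
  assumes "CARD('k) = 3" shows "(x::'k) = 0 \<or> x = 1 \<or> x = - 1" "(2::'k) = - 1" "(3::'k) = 0" "(1::'k) \<noteq> - 1"
proof -
  show three: "(3::'k) = 0" using of_nat_0_iff[of 3] assms by simp
  then have "(2::'k) + 1 = 0" by simp
  then show two: "(2::'k) = - 1" by (simp add: eq_neg_iff_add_eq_0)
  show "(1::'k) \<noteq> - 1"
  proof
    assume "(1::'k) = - 1"
    then have "(of_nat 2 :: 'k) = 0" using two by simp
    then show False using of_nat_0_iff[of 2] assms by simp
  qed
  have "x \<in> range of_nat" using prime_field by simp
  then obtain m where m: "x = of_nat m" by blast
  have "m = 3 * (m div 3) + m mod 3" by simp
  then have "x = of_nat 3 * of_nat (m div 3) + of_nat (m mod 3)" unfolding m by (metis of_nat_add of_nat_mult)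
  then have "x = of_nat (m mod 3)" using three by simp
  moreover have "m mod 3 = 0 \<or> m mod 3 = 1 \<or> m mod 3 = 2" by linarith
  ultimately show "x = 0 \<or> x = 1 \<or> x = - 1" using two by auto
qed

text \<open>If the entries \<open>0\<close>, \<open>1\<close>, \<open>-1\<close> occur \<open>a\<close>, \<open>b\<close> and \<open>c\<close> times, then \<open>a + b + c = 6\<close> and \<open>b - c\<close> is divisible by
three.  This leaves ten triples, and adding constants permutes the three counts cyclically.\<close>

lemma ternary_6_orbits:
  assumes card: "CARD('k) = 3" and r: "r = 6" and v: "v \<noteq> 0"
  shows "same_orbit v (of_list [1, 1, 1, 0, 0, 0]) \<or> same_orbit v (of_list [1, - 1, 0, 0, 0, 0]) \<or> same_orbit v (of_list [1, 1, - 1, - 1, 0, 0])"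
proof -
  note tern = ternary_field[OF card]
  obtain xs where xs: "admissible xs" "v = of_list xs" using of_list_surj by blast
  have "mset xs = replicate_mset (count_list xs 0) 0 + replicate_mset (count_list xs 1) 1 + replicate_mset (count_list xs (-1)) (-1) \<and>
      sum_list xs + of_nat (count_list xs (-1)) = of_nat (count_list xs 1) \<and>
      length xs = count_list xs 0 + count_list xs 1 + count_list xs (-1)" for xs :: "'k list"
  proof (induction xs)
    case (Cons x xs)
    then show ?case using tern(1)[of x] tern(4) by (auto simp: algebra_simps)
  qed simp
  note * = this[of xs]
  define a b c where "a = count_list xs 0" "b = count_list xs 1" "c = count_list xs (-1)"
  have abc: "a + b + c = 6" and m: "mset xs = replicate_mset a 0 + replicate_mset b 1 + replicate_mset c (-1)"
    and bc: "of_nat c = (of_nat b :: 'k)"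
    using * xs(1) r unfolding admissible_def a_b_c_def by simp_all
  have d3: "c \<le> b \<Longrightarrow> 3 dvd b - c" "b \<le> c \<Longrightarrow> 3 dvd c - b"
    using bc of_nat_0_iff[of "b - c"] of_nat_0_iff[of "c - b"] card by (simp_all add: of_nat_diff)
  have cases: "(a, b, c) \<in> {(6,0,0),(0,6,0),(0,0,6),(3,3,0),(0,3,3),(3,0,3),(4,1,1),(1,4,1),(1,1,4),(2,2,2)}"
  proof -
    have "b \<in> {0,1,2,3,4,5,6}" "c \<in> {0,1,2,3,4,5,6}" using abc by auto
    then show ?thesis using abc d3 by (elim insertE emptyE) simp_all
  qed
  have e: "same_orbit v (of_list ys)" if "\<exists>t. mset (map (\<lambda>x. x + t) xs) = mset ys" "length ys = 6" "sum_list ys = 0" "\<not> distinct ys" for ys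
    using that same_orbit_of_list[OF xs(1), of ys] xs(2) r unfolding admissible_def by auto
  have adm: "sum_list [1, 1, 1, 0, 0, 0::'k] = 0" "sum_list [1, - 1, 0, 0, 0, 0::'k] = 0" "sum_list [1, 1, - 1, - 1, 0, 0::'k] = 0"
    using tern(2,3) by simp_all
  have sums: "(1::'k) + 1 = - 1" "- 1 + - 1 = (1::'k)" "- 1 - 1 = (1::'k)" using tern(2) by simp_all
  have map: "mset (map (\<lambda>x. x + t) xs) = replicate_mset a t + replicate_mset b (1 + t) + replicate_mset c (-1 + t)" for t
    using m by simp
  have nz: "\<not> same_orbit v 0" using v same_orbit_0 by blast
  have z: "of_list [0, 0, 0, 0, 0, 0] = 0" using of_list_zero r by (simp add: eval_nat_numeral)
  have "(\<exists>t. mset (map (\<lambda>x. x + t) xs) = mset [0, 0, 0, 0, 0, 0]) \<or>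
        (\<exists>t. mset (map (\<lambda>x. x + t) xs) = mset [1, 1, 1, 0, 0, 0]) \<or>
        (\<exists>t. mset (map (\<lambda>x. x + t) xs) = mset [1, - 1, 0, 0, 0, 0]) \<or>
        (\<exists>t. mset (map (\<lambda>x. x + t) xs) = mset [1, 1, - 1, - 1, 0, 0])"
  proof -
    have ex: "P (0::'k) \<or> P 1 \<or> P (- 1) \<Longrightarrow> \<exists>t. P t" for P by blast
    show ?thesis unfolding map
      using cases by (elim insertE emptyE Pair_inject; hypsubst_thin)
        ((rule disjI1, rule ex, simp add: eval_nat_numeral tern(2) add_mset_commute; fail) |
         (rule disjI2, rule disjI1, rule ex, simp add: eval_nat_numeral tern(2) add_mset_commute; fail) |
         (rule disjI2, rule disjI2, rule disjI1, rule ex, simp add: eval_nat_numeral tern(2) add_mset_commute; fail) |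
         (rule disjI2, rule disjI2, rule disjI2, rule ex, simp add: eval_nat_numeral tern(2) add_mset_commute; fail))+
  qed
  then show ?thesis
  proof (elim disjE)
    assume "\<exists>t. mset (map (\<lambda>x. x + t) xs) = mset [0, 0, 0, 0, 0, 0]"
    then have "same_orbit v 0" using e[of "[0, 0, 0, 0, 0, 0]"] z by simp
    then show ?thesis using nz by blast
  qed (use e adm in \<open>auto simp del: mset.simps\<close>)
qed

lemma ternary_6_cover2:
  assumes card: "CARD('k) = 3" and r: "r = 6" and v: "v \<noteq> 0" shows "cover2 G0 v w"
proof -
  note tern = ternary_field[OF card]
  have sums: "(1::'k) + 1 = - 1" "- 1 + - 1 = (1::'k)" "- 1 - 1 = (1::'k)" using tern(2) by simp_all
  let ?A = "[1, 1, 1, 0, 0, 0] :: 'k list" and ?B = "[1, - 1, 0, 0, 0, 0] :: 'k list"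
    and ?C = "[1, 1, - 1, - 1, 0, 0] :: 'k list"
  have adm: "admissible xs \<longleftrightarrow> length xs = 6 \<and> sum_list xs = 0" for xs unfolding admissible_def using r by simp
  have cov: "cover2 G0 (of_list zs) (of_list (map2 (+) xs ys))"
    if "length xs = 6" "length ys = 6" "length zs = 6" "sum_list xs = 0" "sum_list ys = 0" "sum_list zs = 0"
      "\<exists>t. mset (map (\<lambda>x. x + t) xs) = mset zs" "\<exists>t. mset (map (\<lambda>x. x + t) ys) = mset zs" "\<not> distinct zs" for xs ys zs
    using that sphere_of_list[of xs zs] sphere_of_list[of ys zs] by (intro cover2_sum) (auto simp: adm)
  have "cover2 G0 (of_list ?B) (of_list ?A)" "cover2 G0 (of_list ?C) (of_list ?A)" "cover2 G0 (of_list ?A) (of_list ?B)"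
       "cover2 G0 (of_list ?C) (of_list ?B)" "cover2 G0 (of_list ?A) (of_list ?C)" "cover2 G0 (of_list ?B) (of_list ?C)"
  proof -
    have ex: "P (0::'k) \<or> P 1 \<Longrightarrow> \<exists>t. P t" for P by blast
    show "cover2 G0 (of_list ?B) (of_list ?A)"
      using cov[OF _ _ _ _ _ _ ex ex, of "[- 1, 1, 0, 0, 0, 0]" "[- 1, 0, 1, 0, 0, 0]" ?B] by (simp add: tern(2,4) add_mset_commute)
    show "cover2 G0 (of_list ?C) (of_list ?A)"
      using cov[OF _ _ _ _ _ _ ex ex, of "[1, - 1, 0, 1, - 1, 0]" "[0, - 1, 1, - 1, 1, 0]" ?C] by (simp add: tern(2,4) add_mset_commute)
    show "cover2 G0 (of_list ?A) (of_list ?B)"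
      using cov[OF _ _ _ _ _ _ ex ex, of "[1, 0, 1, 1, 0, 0]" "[0, - 1, - 1, - 1, 0, 0]" ?A] by (simp add: tern(2,4) add_mset_commute)
    show "cover2 G0 (of_list ?C) (of_list ?B)"
      using cov[OF _ _ _ _ _ _ ex ex, of "[- 1, 1, 1, - 1, 0, 0]" "[- 1, 1, - 1, 1, 0, 0]" ?C] by (simp add: tern(2,4) add_mset_commute)
    show "cover2 G0 (of_list ?A) (of_list ?C)"
      using cov[OF _ _ _ _ _ _ ex ex, of "[1, 1, 0, 0, 1, 0]" "[0, 0, - 1, - 1, - 1, 0]" ?A] by (simp add: tern(2,4) add_mset_commute)
    show "cover2 G0 (of_list ?B) (of_list ?C)"
      using cov[OF _ _ _ _ _ _ ex ex, of "[1, 0, - 1, 0, 0, 0]" "[0, 1, 0, - 1, 0, 0]" ?B] by (simp add: tern(2,4) add_mset_commute)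
  qed
  note pairs = this
  show ?thesis
  proof (rule cover_reps(2)[of "{of_list ?A, of_list ?B, of_list ?C}"])
    show "\<exists>\<rho>\<in>{of_list ?A, of_list ?B, of_list ?C}. same_orbit v \<rho>" if "v \<noteq> 0" for v
      using ternary_6_orbits[OF card r that] by auto
    show "cover2 G0 \<rho> \<sigma>" if "\<rho> \<in> {of_list ?A, of_list ?B, of_list ?C}" "\<sigma> \<in> {of_list ?A, of_list ?B, of_list ?C}" for \<rho> \<sigma>
      using that pairs cover2_refl by (elim insertE emptyE) simp_all
  qed fact
qed

text \<open>The element represented by the indicator of \<open>{1, 2, 3}\<close> has an orbit of size at most 20 under \<open>H\<close>, while
there are 30 roots.  As \<open>H\<close> is normal in \<open>G0\<close>, an element of \<open>G0\<close> mapping a root to this vector or its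
negative would map the 30 roots injectively into a set of at most 20 elements.\<close>

lemma ternary_6_not_cover1:
  assumes card: "CARD('k) = 3" and r: "r = 6"
  shows "\<not> (\<forall>v w. v \<noteq> 0 \<longrightarrow> cover1 G0 v w)"
proof
  assume c: "\<forall>v w. v \<noteq> 0 \<longrightarrow> cover1 G0 v w"
  note tern = ternary_field[OF card]
  define ind where "ind = (\<lambda>(S :: nat set) i. of_bool (i \<in> S) :: 'k)"
  define w where "w = D (ind {1, 2, 3})"
  have ind: "ind S \<in> zero_sum_vecs r" if "S \<subseteq> {1..6}" "card S = 3" for S
  proof -
    have "(\<Sum>i\<in>{1..6}. ind S i) = of_nat (card ({1..6} \<inter> S))" by (simp add: ind_def of_bool_def sum.If_cases)
    also have "{1..6} \<inter> S = S" using that by blast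
    finally show ?thesis using that tern(3) r by (auto simp: zero_sum_vecs_def ind_def)
  qed
  have E: "E 1 2 \<noteq> 0" using r by (intro E_nonzero) auto
  have "w \<noteq> 0"
  proof
    assume "w = 0"
    then obtain t where t: "\<And>i. i \<in> {1..r} \<Longrightarrow> ind {1, 2, 3} i = t"
      using D_eq_0_iff[OF ind[of "{1, 2, 3}"]] unfolding w_def by auto
    show False using t[of 1] t[of 4] r by (simp add: ind_def)
  qed
  then obtain g where g: "g \<in> G0" "w = g (E 1 2) \<or> w = - g (E 1 2)"
    using c E unfolding cover1_def sphere_def by blast
  let ?O = "(\<lambda>S. D (ind S)) ` {S. S \<subseteq> {1..6} \<and> card S = 3}"
  let ?P = "(\<lambda>(i, j). E i j) ` (SIGMA i:{1..6}. {1..6} - {i})"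
  have Hw: "h w \<in> ?O" if h: "h \<in> H" for h
  proof -
    obtain \<sigma> where s: "acts_as h \<sigma>" using H_acts[OF h] by metis
    have per: "\<sigma> permutes {1..6}" using acts_as_perm[OF s] r by simp
    have "h w = D (permute_coords \<sigma> (ind {1, 2, 3}))"
      unfolding w_def by (rule acts_asD[OF s ind]) auto
    also have "permute_coords \<sigma> (ind {1, 2, 3}) = ind (\<sigma> ` {1, 2, 3})"
    proof
      fix i
      have "inv' \<sigma> i \<in> {1, 2, 3} \<longleftrightarrow> \<sigma> (inv' \<sigma> i) \<in> \<sigma> ` {1, 2, 3}"
        by (rule inj_image_mem_iff[OF permutes_inj[OF per], symmetric])
      then have "inv' \<sigma> i \<in> {1, 2, 3} \<longleftrightarrow> i \<in> \<sigma> ` {1, 2, 3}"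
        by (simp only: permutes_inverses(1)[OF per])
      then show "permute_coords \<sigma> (ind {1, 2, 3}) i = ind (\<sigma> ` {1, 2, 3}) i"
        by (simp only: permute_coords_def ind_def)
    qed
    finally have "h w = D (ind (\<sigma> ` {1, 2, 3}))" .
    moreover have "\<sigma> ` {1, 2, 3} \<subseteq> {1..6}" using permutes_image[OF per] by auto
    moreover have "card (\<sigma> ` {1, 2, 3}) = 3"
      using card_image[OF inj_on_subset[OF permutes_inj[OF per] subset_UNIV], of "{1, 2, 3}"] by simp
    ultimately show ?thesis by blast
  qed
  obtain e :: 'k where e: "g (E 1 2) = e *s w"
    using g(2) by (metis minus_minus vector_smult_lid vector_sneg_minus1)
  have "g ` ?P \<subseteq> (\<lambda>x. e *s x) ` ?O"
  proof -
    have "g (E i j) \<in> (\<lambda>x. e *s x) ` ?O" if ij: "i \<in> {1..6}" "j \<in> {1..6}" "i \<noteq> j" for i j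
    proof -
      obtain h where h: "h \<in> H" "h (E 1 2) = E i j"
        using H_transitive_roots[of 1 2 i j] ij r by auto
      have h': "g \<circ> h \<circ> inv' g \<in> H" by (rule H_normal[OF g(1) h(1)])
      then have "g \<circ> h \<circ> inv' g \<in> G0" using H_G0 by blast
      then have "(g \<circ> h \<circ> inv' g) (e *s w) = e *s (g \<circ> h \<circ> inv' g) w" by (rule G0_scale)
      moreover have "g (E i j) = (g \<circ> h \<circ> inv' g) (g (E 1 2))" using g(1) h(2) by (simp add: G0_inv_apply)
      ultimately have "g (E i j) = e *s (g \<circ> h \<circ> inv' g) w" using e by simp
      then show ?thesis using Hw[OF h'] by blast
    qed
    note step = this
    show ?thesis
    proof
      fix y assume "y \<in> g ` ?P"
      then obtain p where p: "p \<in> (SIGMA i:{1..6}. {1..6} - {i})" "y = g ((\<lambda>(i, j). E i j) p)" by blast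
      obtain i j where ij: "p = (i, j)" by (cases p)
      show "y \<in> (\<lambda>x. e *s x) ` ?O" using p step[of i j] unfolding ij by simp
    qed
  qed
  then have "card (g ` ?P) \<le> card ((\<lambda>x. e *s x) ` ?O)" by (intro card_mono) auto
  also have "\<dots> \<le> card ?O" by (intro card_image_le) auto
  also have "\<dots> \<le> card {S. S \<subseteq> {1..6::nat} \<and> card S = 3}" by (intro card_image_le) auto
  also have "\<dots> = 20" by (simp add: n_subsets) (simp add: eval_nat_numeral)
  finally have "card (g ` ?P) \<le> 20" .
  moreover have "card (g ` ?P) = card ?P"
    by (intro card_image inj_on_subset[OF bij_is_inj[OF G0_bij[OF g(1)]]]) auto
  moreover have "card ?P = card (SIGMA i:{1..6::nat}. {1..6} - {i})"
  proof (intro card_image inj_onI)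
    fix p p' :: "nat \<times> nat"
    assume p: "p \<in> (SIGMA i:{1..6}. {1..6} - {i})" "p' \<in> (SIGMA i:{1..6}. {1..6} - {i})"
      and eq: "(\<lambda>(i, j). E i j) p = (\<lambda>(i, j). E i j) p'"
    obtain i j k l where ij: "p = (i, j)" "p' = (k, l)" by (cases p, cases p') auto
    have "(2::'k) \<noteq> 0" unfolding tern(2) by simp
    then show "p = p'" using E_inj[of i j k l] p eq r unfolding ij by simp
  qed
  moreover have "card (SIGMA i:{1..6::nat}. {1..6} - {i}) = 30"
    by simp
  ultimately show False by linarith
qed

end

section \<open>Lifting permutations to the module\<close>

context deleted_rep begin

text \<open>Odd permutations act on the module as well, but need not belong to \<open>H\<close> or \<open>G0\<close>.\<close>

lemma acts_exists:
  assumes p: "\<sigma> permutes {1..r}" shows "\<exists>f. acts_as f \<sigma>"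
proof -
  define rep where "rep = (\<lambda>x. SOME a. a \<in> zero_sum_vecs r \<and> D a = x)"
  have rep: "rep x \<in> zero_sum_vecs r" "D (rep x) = x" for x
    using someI_ex[of "\<lambda>a. a \<in> zero_sum_vecs r \<and> D a = x"] D_surj unfolding rep_def by blast+
  have "D (permute_coords \<sigma> (rep (D a))) = D (permute_coords \<sigma> a)" if a: "a \<in> zero_sum_vecs r" for a
  proof -
    obtain t where t: "\<And>i. i \<in> {1..r} \<Longrightarrow> rep (D a) i = a i + t"
      using D_eq_iff[OF rep(1) a, of "D a"] rep(2) by blast
    have "permute_coords \<sigma> (rep (D a)) i = permute_coords \<sigma> a i + t" if "i \<in> {1..r}" for i
      using t[of "inv' \<sigma> i"] that permutes_in_image[OF permutes_inv[OF p], of i] unfolding permute_coords_def by blast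
    then show ?thesis using D_eq_iff[OF zero_sum_permute[OF p rep(1)] zero_sum_permute[OF p a]] by blast
  qed
  then have "acts_as (\<lambda>x. D (permute_coords \<sigma> (rep x))) \<sigma>" using p by (simp add: acts_as_def)
  then show ?thesis by blast
qed

lemma acts_as_unique:
  assumes "acts_as h \<sigma>" "acts_as h \<tau>" shows "\<sigma> = \<tau>"
proof -
  obtain f where f: "acts_as f (inv' \<sigma>)" using acts_exists[OF permutes_inv[OF acts_as_perm[OF assms(1)]]] by blast
  have s: "inv' \<sigma> \<circ> \<sigma> = id" "\<sigma> \<circ> inv' \<sigma> = id" using permutes_inv_o[OF acts_as_perm[OF assms(1)]] by auto
  have "f \<circ> h = id" using acts_as_compose[OF f assms(1)] s(1) acts_as_fun_eq acts_as_id by metis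
  then have "acts_as id (inv' \<sigma> \<circ> \<tau>)" using acts_as_compose[OF f assms(2)] by simp
  then have "inv' \<sigma> \<circ> \<tau> = id" by (rule acts_as_eq_id)
  then have "\<sigma> \<circ> (inv' \<sigma> \<circ> \<tau>) = \<sigma>" by simp
  then show ?thesis using s(2) by (metis fun.map_comp id_comp)
qed

lemma H_I: "acts_as h \<sigma> \<Longrightarrow> evenperm \<sigma> \<Longrightarrow> h \<in> H"
  using even_acts[OF acts_as_perm] acts_as_fun_eq by metis

lemma H_compose: assumes "f \<in> H" "h \<in> H" shows "f \<circ> h \<in> H"
proof -
  obtain \<sigma> \<tau> where s: "acts_as f \<sigma>" "evenperm \<sigma>" "acts_as h \<tau>" "evenperm \<tau>"
    using H_acts[OF assms(1)] H_acts[OF assms(2)] by metis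
  then have "permutation \<sigma>" "permutation \<tau>"
    using acts_as_perm permutation_permutes by (metis finite_atLeastAtMost)+
  then have "evenperm (\<sigma> \<circ> \<tau>)" using s by (simp add: evenperm_comp)
  then show ?thesis using H_I[OF acts_as_compose[OF s(1,3)]] by blast
qed

lemma H_inverse: assumes "h \<in> H" shows "\<exists>k\<in>H. k \<circ> h = id \<and> h \<circ> k = id"
proof -
  obtain \<sigma> where s: "acts_as h \<sigma>" "evenperm \<sigma>" using H_acts[OF assms] by blast
  note p = acts_as_perm[OF s(1)]
  have "permutation \<sigma>" using p permutation_permutes by (metis finite_atLeastAtMost)
  then have "evenperm (inv' \<sigma>)" using s(2) by (simp add: evenperm_inv)
  then obtain k where k: "k \<in> H" "acts_as k (inv' \<sigma>)" using even_acts[OF permutes_inv[OF p]] by blast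
  have "k \<circ> h = id" "h \<circ> k = id"
    using acts_as_compose[OF k(2) s(1)] acts_as_compose[OF s(1) k(2)] permutes_inv_o[OF p] acts_as_fun_eq acts_as_id by metis+
  then show ?thesis using k(1) by blast
qed

lemma H_id: "id \<in> H" using H_I[OF acts_as_id] evenperm_id by simp

lemma scaled_root:
  assumes eq: "c *s E i j = E k l" and ijkl: "{i, j, k, l} \<subseteq> {1..r}" "i \<noteq> j" "k \<noteq> l"
  shows "{k, l} = {i, j}"
proof -
  have "D (\<lambda>m. c * root_vec i j m) = D (root_vec k l)"
    using eq D_scale[OF zero_sum_root, of i j c] ijkl by (simp add: E_def)
  moreover have "(\<lambda>m. c * root_vec i j m) \<in> zero_sum_vecs r" "root_vec k l \<in> zero_sum_vecs r"
    using ijkl by (auto intro!: zero_sum_scale zero_sum_root)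
  ultimately obtain t where t: "\<And>m. m \<in> {1..r} \<Longrightarrow> c * root_vec i j m = root_vec k l m + (t::'k)"
    using D_eq_iff by meson
  have "card {i, j, k, l} < r" using r_ge_5 by (simp add: card_insert_if)
  then obtain m where m: "m \<in> {1..r}" "m \<notin> {i, j, k, l}" using exists_other[of "{i, j, k, l}"] by auto
  have t0: "t = 0" using t[OF m(1)] m(2) by (auto simp: root_vec_def)
  have zero: "root_vec i j m = (0::'k)" if "m \<notin> {i, j}" for m using that by (simp add: root_vec_def)
  have "root_vec k l k = (1::'k)" "root_vec k l l = (- 1::'k)" using ijkl by (simp_all add: root_vec_def)
  then have "c * root_vec i j k \<noteq> 0" "c * root_vec i j l \<noteq> 0" using t[of k] t[of l] ijkl t0 by auto
  then have "k \<in> {i, j}" "l \<in> {i, j}" using zero[of k] zero[of l] mult_zero_right by metis+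
  then show ?thesis using ijkl by auto
qed

text \<open>A permutation acting as a scalar preserves the line of every root, so it fixes \<open>{1, 2}\<close> and
\<open>{1, 3}\<close>, hence \<open>1\<close> and \<open>2\<close>, and the scalar is \<open>1\<close>.\<close>

lemma H_scalar:
  assumes h: "h \<in> H" and c: "\<And>x. h x = c *s x" shows "c = 1"
proof -
  obtain \<sigma> where s: "acts_as h \<sigma>" using H_acts[OF h] by blast
  note p = acts_as_perm[OF s]
  have r: "1 \<in> {1..r}" "2 \<in> {1..r}" "3 \<in> {1..r}" using r_ge_5 by auto
  have sr: "\<sigma> 1 \<in> {1..r}" "\<sigma> 2 \<in> {1..r}" "\<sigma> 3 \<in> {1..r}" using permutes_in_image[OF p] r by blast+
  have ne: "\<sigma> 1 \<noteq> \<sigma> 2" "\<sigma> 1 \<noteq> \<sigma> 3" using permutes_inj[OF p] by (auto simp: inj_eq)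
  have e: "c *s E 1 2 = E (\<sigma> 1) (\<sigma> 2)" "c *s E 1 3 = E (\<sigma> 1) (\<sigma> 3)"
    using acts_as_E[OF s r(1,2)] acts_as_E[OF s r(1,3)] c by auto
  have "{\<sigma> 1, \<sigma> 2} = {1, 2}" "{\<sigma> 1, \<sigma> 3} = {1, 3}"
    using scaled_root[OF e(1)] scaled_root[OF e(2)] r sr ne by auto
  then have "\<sigma> 1 \<in> {1, 2}" "\<sigma> 2 \<in> {1, 2}" "\<sigma> 1 \<in> {1, 3}" by blast+
  then have "\<sigma> 1 = 1" "\<sigma> 2 = 2" using ne(1) by fastforce+
  then have "(c - 1) *s E 1 2 = 0" using e(1) by (simp add: vector_sub_rdistrib)
  then show ?thesis using E_nonzero[OF r(1,2)] by (simp add: vector_mul_eq_0)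
qed

end

section \<open>Characteristic five and degree five\<close>

context prime_deleted_affine begin

lemma keeps_roots_all:
  assumes kr: "keeps_roots" and g: "g \<in> G0" and ij: "i \<in> {1..r}" "j \<in> {1..r}" "i \<noteq> j"
  shows "\<exists>c u v. u \<in> {1..r} \<and> v \<in> {1..r} \<and> u \<noteq> v \<and> c \<noteq> 0 \<and> g (E i j) = c *s E u v"
proof -
  have r: "1 \<in> {1..r}" "2 \<in> {1..r}" using r_ge_5 by auto
  obtain h where h: "h \<in> H" "h (E 1 2) = E i j" using H_transitive_roots[OF r _ ij] by auto
  then have "g \<circ> h \<in> G0" using g H_G0 G0_compose by blast
  then obtain c u v where c: "u \<in> {1..r}" "v \<in> {1..r}" "u \<noteq> v" "(g \<circ> h) (E 1 2) = c *s E u v"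
    using kr unfolding keeps_roots_def by blast
  have "g (E i j) \<noteq> 0" using G0_eq_0[OF g] E_nonzero[OF ij] by simp
  then show ?thesis using c h(2) by (intro exI[of _ c] exI[of _ u] exI[of _ v]) auto
qed

end

locale quinary = prime_deleted_affine r H D G0
  for r and H :: "('k::{field,finite} ^ 'n \<Rightarrow> 'k ^ 'n) set" and D G0 +
  assumes card5: "CARD('k) = 5" and r5: "r = 5"
begin

lemma five_eq_0: "(5::'k) = 0" using of_nat_0_iff[of 5] card5 by simp

text \<open>Rewrite rules that reduce the numerals arising below modulo five.\<close>

lemma numerals_mod_5:
  "(5::'k) = 0" "(6::'k) = 1" "(7::'k) = 2" "(8::'k) = 3" "(9::'k) = 4" "(10::'k) = 0" "(11::'k) = 1"
  "(12::'k) = 2" "(13::'k) = 3" "(14::'k) = 4" "(15::'k) = 0" "(16::'k) = 1" "(27::'k) = 2"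
proof -
  have "(of_nat (m + 5 * n) :: 'k) = of_nat m" for m n using five_eq_0 by simp
  from this[of 0 1] this[of 1 1] this[of 2 1] this[of 3 1] this[of 4 1] this[of 0 2] this[of 1 2] this[of 2 2]
    this[of 3 2] this[of 4 2] this[of 0 3] this[of 1 3] this[of 2 5]
  show "(5::'k) = 0" "(6::'k) = 1" "(7::'k) = 2" "(8::'k) = 3" "(9::'k) = 4" "(10::'k) = 0" "(11::'k) = 1"
  "(12::'k) = 2" "(13::'k) = 3" "(14::'k) = 4" "(15::'k) = 0" "(16::'k) = 1" "(27::'k) = 2"
    by simp_all
qed

lemma minus_numerals_mod_5: "(-1::'k) = 4" "(-2::'k) = 3" "(-3::'k) = 2" "(-4::'k) = 1"
proof -
  have neg: "x + y = 0 \<Longrightarrow> - x = (y::'k)" for x y by (rule minus_unique)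
  show "(-1::'k) = 4" "(-2::'k) = 3" "(-3::'k) = 2" "(-4::'k) = 1"
    using five_eq_0 by (intro neg; simp)+
qed

lemma nonzero_numerals_mod_5: "(2::'k) \<noteq> 0" "(3::'k) \<noteq> 0" "(4::'k) \<noteq> 0"
  using of_nat_0_iff[of 2] of_nat_0_iff[of 3] of_nat_0_iff[of 4] card5 by simp_all

lemma distinct_numerals_mod_5:
  "(1::'k) \<noteq> 2" "(1::'k) \<noteq> 3" "(1::'k) \<noteq> 4" "(2::'k) \<noteq> 3" "(2::'k) \<noteq> 4" "(3::'k) \<noteq> 4"
  "(2::'k) \<noteq> 1" "(3::'k) \<noteq> 1" "(4::'k) \<noteq> 1" "(3::'k) \<noteq> 2" "(4::'k) \<noteq> 2" "(4::'k) \<noteq> 3"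
proof -
  have *: "of_nat m \<noteq> (of_nat n :: 'k)" if "m < n" "n < 5" for m n
  proof
    assume "of_nat m = (of_nat n :: 'k)"
    then have "of_nat (n - m) = (0 :: 'k)" using that by (simp add: of_nat_diff)
    then show False using of_nat_0_iff[of "n - m"] card5 that by (auto dest: dvd_imp_le)
  qed
  from *[of 1 2] *[of 1 3] *[of 1 4] *[of 2 3] *[of 2 4] *[of 3 4]
  show "(1::'k) \<noteq> 2" "(1::'k) \<noteq> 3" "(1::'k) \<noteq> 4" "(2::'k) \<noteq> 3" "(2::'k) \<noteq> 4" "(3::'k) \<noteq> 4"
    "(2::'k) \<noteq> 1" "(3::'k) \<noteq> 1" "(4::'k) \<noteq> 1" "(3::'k) \<noteq> 2" "(4::'k) \<noteq> 2" "(4::'k) \<noteq> 3" by auto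
qed

lemma elements_mod_5: "(x::'k) = 0 \<or> x = 1 \<or> x = 2 \<or> x = 3 \<or> x = 4"
proof -
  have "x \<in> range of_nat" using prime_field by simp
  then obtain m where m: "x = of_nat m" by blast
  have "m = 5 * (m div 5) + m mod 5" by simp
  then have "x = of_nat 5 * of_nat (m div 5) + of_nat (m mod 5)" unfolding m by (metis of_nat_add of_nat_mult)
  then have "x = of_nat (m mod 5)" using five_eq_0 by simp
  moreover have "m mod 5 = 0 \<or> m mod 5 = 1 \<or> m mod 5 = 2 \<or> m mod 5 = 3 \<or> m mod 5 = 4" by linarith
  ultimately show ?thesis by auto
qed

text \<open>A fixed vector is constant on the three positions moved.  Subtracting this constant, which has
sum zero since there are five positions, leaves a vector supported on two positions.\<close>

lemma fix_cyc3:
  assumes h: "acts_as h (cyc3 i j k)" and d: "distinct [i, j, k]" "{i, j, k} \<subseteq> {1..5}" and fx: "h x = x"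
  shows "\<exists>c u v. u \<in> {1..5} \<and> v \<in> {1..5} \<and> u \<noteq> v \<and> x = c *s E u v"
proof -
  obtain a where a: "a \<in> zero_sum_vecs r" "x = D a" using D_surj by metis
  have "D (permute_coords (cyc3 i j k) a) = D a" using acts_asD[OF h a(1)] fx a(2) by simp
  then obtain t where t: "\<And>m. m \<in> {1..5} \<Longrightarrow> permute_coords (cyc3 i j k) a m = a m + t"
    using D_eq_iff[OF acts_as_zero_sum[OF h a(1)] a(1)] r5 by auto
  have "card ({1..5} - {i, j, k}) = 2" using d by (subst card_Diff_subset) auto
  then obtain u v where uv: "{1..5} - {i, j, k} = {u, v}" "u \<noteq> v" by (meson card_2_iff)
  have u: "u \<in> {1..5}" "v \<in> {1..5}" "u \<notin> {i, j, k}" "v \<notin> {i, j, k}" using uv by blast+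
  have per: "permute_coords (cyc3 i j k) a m = a (cyc3 k j i m)" for m
    using inv_cyc3[OF d(1)] by (simp add: permute_coords_def)
  have d': "distinct [k, j, i]" using d by auto
  have "t = 0" using t[OF u(1)] u(3) unfolding per cyc3_apply[OF d'] by auto
  then have eq: "a i = a j" "a j = a k"
    using t[of j] t[of k] d unfolding per cyc3_apply[OF d'] by auto
  define f where "f = (\<lambda>m. if m \<in> {1..5} then a m - a i else 0)"
  have "(\<Sum>m=1..5. f m) = (\<Sum>m=1..5. a m) - 5 * a i" by (simp add: f_def sum_subtractf)
  then have f: "f \<in> zero_sum_vecs r" using a(1) r5 five_eq_0 by (simp add: zero_sum_vecs_def) (simp add: f_def)
  have x: "x = D f" unfolding a(2) using D_eq_iff[OF a(1) f] r5 by (auto simp: f_def intro!: exI[of _ "a i"])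
  have f0: "f m = 0" if "m \<notin> {u, v}" for m
  proof (cases "m \<in> {1..5}")
    case True
    then have "m = i \<or> m = j \<or> m = k" using that uv(1) by blast
    then have "a m = a i" by (elim disjE) (simp_all add: eq)
    then show ?thesis by (simp add: f_def)
  qed (auto simp: f_def)
  have "(\<Sum>m=1..5. f m) = (\<Sum>m\<in>{u, v}. f m)" using u f0 by (intro sum.mono_neutral_right) auto
  then have "f u + f v = 0" using f r5 uv(2) by (simp add: zero_sum_vecs_def)
  then have "f = (\<lambda>m. f u * root_vec u v m)"
    using f0 uv(2) by (auto simp: fun_eq_iff root_vec_def add_eq_0_iff)
  then have "x = D (\<lambda>m. f u * root_vec u v m)" using x by simp
  also have "\<dots> = f u *s E u v" unfolding E_def using u r5 by (intro D_scale zero_sum_root) auto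
  finally show ?thesis using u uv(2) by blast
qed

text \<open>Planes of three-cycles do not determine roots here: those of \<open>(1 2 3)\<close> and \<open>(1 4 5)\<close> meet in a
line not spanned by a root.  Instead a root is fixed by a three-cycle on the remaining positions, and so is its
image by a conjugate, which is again a three-cycle.\<close>

lemma quinary_keeps_roots: "keeps_roots"
  unfolding keeps_roots_def
proof
  fix g assume g: "g \<in> G0"
  have d: "distinct [3, 4, 5::nat]" "{3, 4, 5} \<subseteq> {1..r}" using r5 by auto
  obtain s where s: "s \<in> H" "acts_as s (cyc3 3 4 5)"
    using even_acts cyc3_in_alt[OF d] unfolding alt_group_carrier by metis
  have "\<not> (r = 6 \<and> (3::'k) = 0)" using r5 by simp
  then obtain i j k where c: "distinct [i, j, k]" "{i, j, k} \<subseteq> {1..r}" "acts_as (g \<circ> s \<circ> inv' g) (cyc3 i j k)"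
    using conj_cyc3[OF _ g s d] by blast
  have "s (E 1 2) = E 1 2" using acts_as_E[OF s(2), of 1 2] r5 by (simp add: cyc3_apply)
  then have "(g \<circ> s \<circ> inv' g) (g (E 1 2)) = g (E 1 2)" using g by (simp add: G0_inv_apply)
  from fix_cyc3[OF c(3,1) _ this] c(2) r5
  show "\<exists>c u v. u \<in> {1..r} \<and> v \<in> {1..r} \<and> u \<noteq> v \<and> g (E 1 2) = c *s E u v" by simp
qed

lemma five_positions: "i \<in> {1..r} \<longleftrightarrow> i = 1 \<or> i = 2 \<or> i = 3 \<or> i = 4 \<or> i = 5"
  using r5 by auto

text \<open>The two sides differ by the constant vector \<open>3\<close>.\<close>

lemma E13_relation: "E 1 3 = 3 *s E 1 2 + 1 *s E 3 4 + 3 *s E 4 5"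
proof -
  let ?f = "\<lambda>x. 3 * root_vec 1 2 x + 1 * root_vec 3 4 x + 3 * root_vec 4 5 x :: 'k"
  have f: "?f \<in> zero_sum_vecs r" "D ?f = 3 *s E 1 2 + 1 *s E 3 4 + 3 *s E 4 5"
    using D_comb3[of 1 2 3 4 4 5 3 1 3] r5 by auto
  have "root_vec 1 3 i = ?f i + 3" if "i \<in> {1..r}" for i
    using that unfolding five_positions by (elim disjE) (simp_all add: root_vec_def minus_numerals_mod_5 numerals_mod_5)
  then have "E 1 3 = D ?f" unfolding E_def using D_eq_iff[OF zero_sum_root f(1), of 1 3] r5 by auto
  then show ?thesis using f(2) by simp
qed

text \<open>The module has dimension three and is spanned by these roots.\<close>

lemma linear_agree:
  assumes p: "\<And>x y. p (x + y) = p x + p y" "\<And>c x. p (c *s x) = c *s p x"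
    and q: "\<And>x y. q (x + y) = q x + (q y :: 'k ^ 'n)" "\<And>c x. q (c *s x) = c *s q x"
    and agree: "p (E 1 2) = q (E 1 2)" "p (E 3 4) = q (E 3 4)" "p (E 4 5) = q (E 4 5)"
  shows "p x = q x"
proof -
  have 13: "p (E 1 3) = q (E 1 3)" unfolding E13_relation by (simp only: p q agree)
  have e: "E 3 4 + E 4 5 = E 3 5" "E 1 3 + E 3 5 = E 1 5" "E 2 1 + E 1 5 = E 2 5" "E 2 1 = (-1) *s E 1 2"
    using E_add[of 3 4 5] E_add[of 1 3 5] E_add[of 2 1 5] E_minus[of 1 2] r5 by auto
  have 35: "p (E 3 5) = q (E 3 5)" unfolding e(1)[symmetric] by (simp only: p q agree)
  have 15: "p (E 1 5) = q (E 1 5)" unfolding e(2)[symmetric] by (simp only: p q 13 35)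
  have 25: "p (E 2 5) = q (E 2 5)" unfolding e(3)[symmetric] e(4) by (simp only: p q agree 15)
  obtain a where a: "a \<in> zero_sum_vecs r" "x = D a" using D_surj by metis
  have "{1..<r} = {1, 2, 3, 4}" using r5 by auto
  then have "x = a 1 *s E 1 5 + a 2 *s E 2 5 + a 3 *s E 3 5 + a 4 *s E 4 5"
    using E_r_expansion[OF a(1)] a(2) r5 by (simp add: add.assoc)
  then show ?thesis by (simp only: p q agree 15 25 35)
qed

end

section \<open>The normaliser modulo the alternating group of degree five\<close>

context quinary begin

lemma minus_one_neq: "(- 1::'k) \<noteq> 1" "(1::'k) \<noteq> - 1"
  unfolding minus_numerals_mod_5 using distinct_numerals_mod_5 by simp_all

text \<open>If the three images of a root under the powers of \<open>(3 4 5)\<close> add up to zero, then comparing the entries at the fixed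
positions \<open>1\<close> and \<open>2\<close> shows that the root involves neither of them.\<close>

lemma cyc345_orbit:
  assumes s: "acts_as s (cyc3 3 4 5)" and ij: "i \<in> {1..r}" "j \<in> {1..r}" "i \<noteq> j"
    and sum: "E i j + s (E i j) + s (s (E i j)) = 0"
  shows "\<exists>h\<in>{id, s, s \<circ> s}. \<exists>e. e \<noteq> 0 \<and> h (E i j) = e *s E 3 4"
proof -
  let ?c = "cyc3 3 4 5"
  have c: "?c 1 = 1" "?c 2 = 2" "?c 3 = 4" "?c 4 = 5" "?c 5 = 3" by (simp_all add: cyc3_apply)
  have cr: "?c k \<in> {1..r}" if "k \<in> {1..r}" for k using that c unfolding five_positions by auto
  have sE: "s (E k l) = E (?c k) (?c l)" if "k \<in> {1..r}" "l \<in> {1..r}" for k l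
    by (rule acts_as_E[OF s that])
  let ?f = "\<lambda>x. 1 * root_vec i j x + 1 * root_vec (?c i) (?c j) x + 1 * root_vec (?c (?c i)) (?c (?c j)) x :: 'k"
  have "{i, j, ?c i, ?c j, ?c (?c i), ?c (?c j)} \<subseteq> {1..r}" using cr ij by simp
  from D_comb3[OF this, of 1 1 1] have f: "D ?f = 0" "?f \<in> zero_sum_vecs r"
    using sum sE ij cr by (simp_all add: sE)
  then obtain t where t: "\<And>k. k \<in> {1..r} \<Longrightarrow> ?f k = t" using D_eq_0_iff by blast
  have inj: "?c k = 1 \<longleftrightarrow> k = 1" "?c k = 2 \<longleftrightarrow> k = 2" for k by (auto simp: cyc3_apply)
  have "?f 1 = 3 * root_vec i j 1" "?f 2 = 3 * root_vec i j 2"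
    using inj by (simp_all add: root_vec_def eq_commute[of 1] eq_commute[of 2] eq_commute[of "Suc 0"])
  moreover have "?f 1 = ?f 2" using t[of 1] t[of 2] r5 by simp
  ultimately have "root_vec i j 1 = (root_vec i j 2 :: 'k)" using nonzero_numerals_mod_5(2) by (metis mult_cancel_left)
  then have ij': "i \<noteq> 1" "i \<noteq> 2" "j \<noteq> 1" "j \<noteq> 2"
    using ij(3) minus_one_neq by (auto simp: root_vec_def of_bool_def split: if_splits)
  have m: "E 4 3 = (-1) *s E 3 4" using E_minus[of 3 4] r5 by simp
  note sE' = sE[unfolded five_positions]
  have "(i, j) \<in> {(3, 4), (4, 5), (5, 3), (4, 3), (5, 4), (3, 5)}" using ij ij' unfolding five_positions by auto
  then show ?thesis
  proof (elim insertE emptyE Pair_inject; hypsubst)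
    show "\<exists>h\<in>{id, s, s \<circ> s}. \<exists>e. e \<noteq> 0 \<and> h (E 3 4) = e *s E 3 4" by (intro bexI[of _ id] exI[of _ 1]) auto
    show "\<exists>h\<in>{id, s, s \<circ> s}. \<exists>e. e \<noteq> 0 \<and> h (E 4 5) = e *s E 3 4"
      by (intro bexI[of _ "s \<circ> s"] exI[of _ 1]) (auto simp: sE' c)
    show "\<exists>h\<in>{id, s, s \<circ> s}. \<exists>e. e \<noteq> 0 \<and> h (E 5 3) = e *s E 3 4"
      by (intro bexI[of _ "s"] exI[of _ 1]) (auto simp: sE' c)
    show "\<exists>h\<in>{id, s, s \<circ> s}. \<exists>e. e \<noteq> 0 \<and> h (E 4 3) = e *s E 3 4"
      by (intro bexI[of _ id] exI[of _ "-1"]) (auto simp: m)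
    show "\<exists>h\<in>{id, s, s \<circ> s}. \<exists>e. e \<noteq> 0 \<and> h (E 5 4) = e *s E 3 4"
      by (intro bexI[of _ "s \<circ> s"] exI[of _ "-1"]) (auto simp: sE' c m)
    show "\<exists>h\<in>{id, s, s \<circ> s}. \<exists>e. e \<noteq> 0 \<and> h (E 3 5) = e *s E 3 4"
      by (intro bexI[of _ "s"] exI[of _ "-1"]) (auto simp: sE' c m)
  qed
qed

text \<open>The entries of the left hand side are \<open>3c, 2c, d, 2d, 2d\<close>, and on the right hand side at least three
entries coincide.\<close>

lemma coefficient_ratio:
  assumes c: "c \<noteq> 0" "d \<noteq> (0::'k)" and u: "u \<in> {1..r}" "v \<in> {1..r}"
    and eq: "(3 * c) *s E 1 2 + d *s E 3 4 + (3 * d) *s E 4 5 = e *s E u v"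
  shows "d = c \<or> d = - c"
proof -
  let ?f = "\<lambda>x. (3 * c) * root_vec 1 2 x + d * root_vec 3 4 x + (3 * d) * root_vec 4 5 x"
  let ?g = "\<lambda>x. e * root_vec u v x"
  have f: "?f \<in> zero_sum_vecs r" "D ?f = e *s E u v"
    using D_comb3[of 1 2 3 4 4 5 "3 * c" d "3 * d"] r5 eq by auto
  have g: "?g \<in> zero_sum_vecs r" "D ?g = e *s E u v"
    using zero_sum_scale[OF zero_sum_root[OF u]] D_scale[OF zero_sum_root[OF u]] by (simp_all add: E_def)
  obtain t where t: "\<And>i. i \<in> {1..r} \<Longrightarrow> ?f i = ?g i + t"
    using D_eq_iff[OF f(1) g(1)] f(2) g(2) by auto
  have t': "?f i = t" if "i \<in> {1..r}" "i \<noteq> u" "i \<noteq> v" for i using t[OF that(1)] that(2,3) by (simp add: root_vec_def)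
  have m3: "- (3 * x) = 2 * x" for x :: 'k by (metis minus_numerals_mod_5(3) mult_minus_left)
  have v1: "?f 1 = 3 * c" and v2: "?f 2 = 2 * c" and v3: "?f 3 = d" and v4: "?f 4 = 2 * d" and v5: "?f 5 = 2 * d"
    using m3 by (simp_all add: root_vec_def)
  have n12: "3 * c \<noteq> 2 * c" using c distinct_numerals_mod_5 by simp
  have n34: "d \<noteq> 2 * d" using c distinct_numerals_mod_5 by (metis mult_cancel_right mult_1)
  have s: "2 * d = 3 * c \<Longrightarrow> d = - c" "2 * d = 2 * c \<Longrightarrow> d = c"
  proof -
    assume "2 * d = 3 * c"
    then have "3 * (2 * d) = 3 * (3 * c)" by simp
    then have "6 * d = 9 * c" by simp
    then show "d = - c" using numerals_mod_5 minus_numerals_mod_5(1) by (metis mult_1 mult_minus1)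
  next
    assume "2 * d = 2 * c" then show "d = c" using nonzero_numerals_mod_5 by simp
  qed
  have T: "u \<noteq> 1 \<Longrightarrow> v \<noteq> 1 \<Longrightarrow> 3 * c = t" "u \<noteq> 2 \<Longrightarrow> v \<noteq> 2 \<Longrightarrow> 2 * c = t" "u \<noteq> 3 \<Longrightarrow> v \<noteq> 3 \<Longrightarrow> d = t"
    "u \<noteq> 4 \<Longrightarrow> v \<noteq> 4 \<Longrightarrow> 2 * d = t" "u \<noteq> 5 \<Longrightarrow> v \<noteq> 5 \<Longrightarrow> 2 * d = t"
    using t'[of 1] t'[of 2] t'[of 3] t'[of 4] t'[of 5] r5 unfolding v1 v2 v3 v4 v5 by auto
  show ?thesis using u T s n12 n34 unfolding five_positions by (elim disjE) auto
qed

text \<open>After multiplication by elements of \<open>H\<close>, the map fixes the line of \<open>E 1 2\<close>, commutes with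
the three-cycle \<open>(3 4 5)\<close>, and fixes the line of \<open>E 3 4\<close>.  Then it acts by one scalar \<open>c\<close> on \<open>E 1 2\<close> and by one
scalar \<open>d\<close> on the plane spanned by \<open>E 3 4\<close> and \<open>E 4 5\<close>.  The image of \<open>E 1 3\<close> must be a multiple
of a root, which forces \<open>d = c\<close> or \<open>d = - c\<close>.\<close>

lemma G0_mod_H:
  assumes g: "g \<in> G0" and tau: "acts_as \<tau> (Transposition.transpose 1 2)"
  shows "\<exists>h\<in>H. \<exists>c. c \<noteq> 0 \<and> ((\<forall>x. h (g x) = c *s x) \<or> (\<forall>x. h (g x) = c *s \<tau> x))"
proof -
  note kr = keeps_roots_all[OF quinary_keeps_roots]
  have r: "1 \<in> {1..r}" "2 \<in> {1..r}" "3 \<in> {1..r}" "4 \<in> {1..r}" "5 \<in> {1..r}" using r5 by auto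
  have inG: "h \<circ> f \<in> G0" if "h \<in> H" "f \<in> G0" for h f using that H_G0 G0_compose by blast
  have d: "distinct [3, 4, 5::nat]" "{3, 4, 5} \<subseteq> {1..r}" using r5 by auto
  obtain s where s: "s \<in> H" "acts_as s (cyc3 3 4 5)"
    using even_acts cyc3_in_alt[OF d] unfolding alt_group_carrier by metis
  have sE: "s (E 1 2) = E 1 2" "s (E 3 4) = E 4 5" "s (E 4 5) = E 5 3"
    using acts_as_E[OF s(2)] r by (simp_all add: cyc3_apply)
  obtain c u v where c: "u \<in> {1..r}" "v \<in> {1..r}" "u \<noteq> v" "c \<noteq> 0" "g (E 1 2) = c *s E u v"
    using kr[OF g r(1,2)] by auto
  obtain h1 where h1: "h1 \<in> H" "h1 (E u v) = E 1 2" using H_transitive_roots[OF c(1-3) r(1,2)] by auto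
  define f1 where "f1 = h1 \<circ> g"
  have f1: "f1 \<in> G0" unfolding f1_def by (rule inG[OF h1(1) g])
  have f1E: "f1 (E 1 2) = c *s E 1 2"
    using c(5) h1(2) G0_scale[of h1] h1(1) H_G0 by (auto simp: f1_def)
  have "\<exists>h\<in>H. \<exists>c. c \<noteq> 0 \<and> (h \<circ> f1) (E 1 2) = c *s E 1 2 \<and> (h \<circ> f1) \<circ> s = s \<circ> (h \<circ> f1)"
  proof -
    have "\<not> (r = 6 \<and> (3::'k) = 0)" using r5 by simp
    then obtain i j k where ijk: "distinct [i, j, k]" "{i, j, k} \<subseteq> {1..r}" and
      s1: "acts_as (f1 \<circ> s \<circ> inv' f1) (cyc3 i j k)" (is "acts_as ?s1 _")
      using conj_cyc3[OF _ f1 s d] by blast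
    have s1f: "?s1 \<circ> f1 = f1 \<circ> s" using f1 by (simp add: fun_eq_iff G0_inv_apply)
    have "?s1 (c *s E 1 2) = c *s E 1 2" using f1 f1E sE by (metis comp_apply s1f)
    then have "c *s ?s1 (E 1 2) = c *s E 1 2" using acts_as_scale[OF s1] by simp
    then have fx: "?s1 (E 1 2) = E 1 2" using c(4) by (simp add: vec_eq_iff)
    let ?c = "cyc3 i j k"
    have p: "?c permutes {1..r}" by (rule acts_as_perm[OF s1])
    have "?c 1 \<in> {1..r}" "?c 2 \<in> {1..r}" using permutes_in_image[OF p] r by blast+
    moreover have "E 1 2 = E (?c 1) (?c 2)" using fx acts_as_E[OF s1 r(1,2)] by simp
    ultimately have "?c 1 = 1" "?c 2 = 2" using E_inj[of 1 2 "?c 1" "?c 2"] r nonzero_numerals_mod_5(1) by auto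
    then have "1 \<notin> {i, j, k}" "2 \<notin> {i, j, k}" using ijk(1) by (auto simp: cyc3_apply split: if_splits)
    then have sub: "{i, j, k} \<subseteq> {3, 4, 5}" using ijk(2) unfolding subset_iff five_positions by auto
    have "{i, j, k} = {3, 4, 5}" using ijk(1) by (intro card_subset_eq sub) auto
    from cyc3_same_set[OF d(1) ijk(1) this[symmetric]] show ?thesis
    proof
      assume "?c = cyc3 3 4 5"
      then have "?s1 = s" using s1 s(2) acts_as_fun_eq by metis
      then have "f1 \<circ> s = s \<circ> f1" using s1f by simp
      then show ?thesis using f1E c(4) H_id by (intro bexI[of _ id] exI[of _ c]) auto
    next
      \<comment> \<open>Conjugation by \<open>(1 2)(3 4)\<close> inverts \<open>(3 4 5)\<close> and negates \<open>E 1 2\<close>.\<close>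
      assume inv: "?c \<circ> cyc3 3 4 5 = id"
      let ?p = "Transposition.transpose 1 2 \<circ> Transposition.transpose 3 4 :: nat \<Rightarrow> nat"
      have "?p permutes {1..r}" using r by (intro permutes_compose permutes_swap_id) auto
      moreover have "evenperm ?p" by (simp add: evenperm_comp permutation_swap_id evenperm_swap)
      ultimately obtain q where q: "q \<in> H" "acts_as q ?p" using even_acts by metis
      have "cyc3 3 4 5 \<circ> ?p \<circ> cyc3 3 4 5 = ?p"
        by (auto simp: fun_eq_iff cyc3_apply Transposition.transpose_def)
      then have "s \<circ> q \<circ> s = q"
        using acts_as_compose[OF acts_as_compose[OF s(2) q(2)] s(2)] q(2) acts_as_fun_eq by metis
      moreover have "?s1 \<circ> s = id" using acts_as_compose[OF s1 s(2)] inv acts_as_id acts_as_fun_eq by metis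
      ultimately have qs: "q (?s1 y) = s (q y)" for y
      proof -
        obtain z where z: "y = s z" using H_inverse[OF s(1)] by (metis comp_apply id_apply)
        have "?s1 y = z" using \<open>?s1 \<circ> s = id\<close> unfolding z by (metis comp_apply id_apply)
        then show ?thesis using \<open>s \<circ> q \<circ> s = q\<close> unfolding z by (metis comp_apply)
      qed
      have "(q \<circ> f1) \<circ> s = s \<circ> (q \<circ> f1)"
      proof
        fix x show "((q \<circ> f1) \<circ> s) x = (s \<circ> (q \<circ> f1)) x"
          using qs[of "f1 x"] s1f by (metis comp_apply)
      qed
      moreover have "q (E 1 2) = E 2 1" using acts_as_E[OF q(2) r(1,2)] by (simp add: Transposition.transpose_def)
      then have "(q \<circ> f1) (E 1 2) = (- c) *s E 1 2"
        using f1E acts_as_scale[OF q(2), of c "E 1 2"] E_minus[OF r(1,2)] by (metis comp_apply vector_smult_lneg vector_smult_rneg)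
      ultimately show ?thesis using c(4) q(1) by (intro bexI[of _ q] exI[of _ "- c"]) auto
    qed
  qed
  then obtain h2 c2 where h2: "h2 \<in> H" "c2 \<noteq> 0" "(h2 \<circ> f1) (E 1 2) = c2 *s E 1 2" "(h2 \<circ> f1) \<circ> s = s \<circ> (h2 \<circ> f1)"
    by blast
  \<comment> \<open>\<open>E 3 4\<close> and its images under \<open>(3 4 5)\<close> add up to zero; \<open>f2\<close> transports this relation.\<close>
  define f2 where "f2 = h2 \<circ> f1"
  have f2: "f2 \<in> G0" unfolding f2_def by (rule inG[OF h2(1) f1])
  have f2s: "f2 (s x) = s (f2 x)" for x using h2(4) by (metis comp_apply f2_def)
  obtain b i j where b: "i \<in> {1..r}" "j \<in> {1..r}" "i \<noteq> j" "b \<noteq> 0" "f2 (E 3 4) = b *s E i j"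
    using kr[OF f2 r(3,4)] by auto
  have "E 3 4 + E 4 5 + E 5 3 = 0" using E_add[of 3 4 5] E_add[of 3 5 3] r E_self by simp
  then have "f2 (E 3 4 + s (E 3 4) + s (s (E 3 4))) = 0" using sE G0_0[OF f2] by simp
  then have "f2 (E 3 4) + s (f2 (E 3 4)) + s (s (f2 (E 3 4))) = 0" by (simp add: G0_add[OF f2] f2s)
  then have "b *s (E i j + s (E i j) + s (s (E i j))) = 0"
    unfolding b(5) by (simp add: acts_as_scale[OF s(2)] vector_add_ldistrib)
  then have "E i j + s (E i j) + s (s (E i j)) = 0" using b(4) by (simp add: vector_mul_eq_0)
  then obtain h3 e where h3: "h3 \<in> {id, s, s \<circ> s}" "e \<noteq> 0" "h3 (E i j) = e *s E 3 4"
    using cyc345_orbit[OF s(2) b(1-3)] by blast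
  have h3H: "h3 \<in> H" using h3(1) H_id s(1) H_compose by blast
  have h3s: "h3 (s x) = s (h3 x)" "h3 (E 1 2) = E 1 2" for x using h3(1) sE by auto
  have h3c: "h3 (y *s x) = y *s h3 x" for x y using h3(1) acts_as_scale[OF s(2)] by auto
  define f where "f = h3 \<circ> f2"
  define d where "d = b * e"
  have f: "f \<in> G0" unfolding f_def by (rule inG[OF h3H f2])
  have fs: "f (s x) = s (f x)" for x by (simp add: f_def f2s h3s)
  have f12: "f (E 1 2) = c2 *s E 1 2" using h2(3) h3s h3c by (simp add: f_def f2_def)
  have f34: "f (E 3 4) = d *s E 3 4" using b(5) h3(3) h3c by (simp add: f_def d_def)
  have f45: "f (E 4 5) = d *s E 4 5" using fs[of "E 3 4"] sE f34 acts_as_scale[OF s(2)] by simp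
  have d0: "d \<noteq> 0" using b(4) h3(2) by (simp add: d_def)
  obtain e' u' v' where e': "u' \<in> {1..r}" "v' \<in> {1..r}" "f (E 1 3) = e' *s E u' v'"
    using kr[OF f r(1,3)] by auto
  have "f (E 1 3) = (3 * c2) *s E 1 2 + d *s E 3 4 + (3 * d) *s E 4 5"
    unfolding E13_relation by (simp add: G0_add[OF f] G0_scale[OF f] f12 f34 f45 del: One_nat_def)
  then have "(3 * c2) *s E 1 2 + d *s E 3 4 + (3 * d) *s E 4 5 = e' *s E u' v'" using e'(3) by metis
  then have "d = c2 \<or> d = - c2" by (rule coefficient_ratio[OF h2(2) d0 e'(1,2)])
  then have "(\<forall>x. f x = d *s x) \<or> (\<forall>x. f x = d *s \<tau> x)"
  proof
    assume "d = c2"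
    then have "f x = d *s x" for x
      by (rule_tac linear_agree) (simp_all add: G0_add[OF f] G0_scale[OF f] f12 f34 f45 vector_add_ldistrib mult.commute \<open>d = c2\<close>[symmetric] del: One_nat_def)
    then show ?thesis by blast
  next
    assume "d = - c2"
    then have c2: "c2 = - d" by simp
    have tE: "\<tau> (E 1 2) = E 2 1" "\<tau> (E 3 4) = E 3 4" "\<tau> (E 4 5) = E 4 5"
      using acts_as_E[OF tau] r by (simp_all add: Transposition.transpose_def)
    have "f x = d *s \<tau> x" for x
      by (rule_tac linear_agree)
         (simp_all add: G0_add[OF f] G0_scale[OF f] f12 f34 f45 vector_add_ldistrib mult.commute
            acts_as_add[OF tau] acts_as_scale[OF tau] tE c2 E_minus[OF r(1,2), symmetric] del: One_nat_def)
    then show ?thesis by blast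
  qed
  moreover have "f x = (h3 \<circ> h2 \<circ> h1) (g x)" for x by (simp add: f_def f2_def f1_def)
  moreover have "h3 \<circ> h2 \<circ> h1 \<in> H" by (intro H_compose h3H h2(1) h1(1))
  ultimately show ?thesis using d0 by (intro bexI[of _ "h3 \<circ> h2 \<circ> h1"] exI[of _ d]) auto
qed

end

section \<open>Even arrangements of five distinct entries\<close>

context quinary begin

definition ramp :: "nat \<Rightarrow> 'k" where
  "ramp = lvec [0, 1, 2, 3, 4]"

lemma ramp_simps: "ramp 1 = 0" "ramp (Suc 0) = 0" "ramp 2 = 1" "ramp 3 = 2" "ramp 4 = 3" "ramp 5 = 4"
  unfolding ramp_def lvec_def using r5 by simp_all

lemma ramp_zero_sum: "ramp \<in> zero_sum_vecs r"
  unfolding ramp_def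
proof (rule lvec_zero_sum)
  show "admissible [0, 1, 2, 3, 4]" unfolding admissible_def using r5 numerals_mod_5 by simp
qed

lemma ramp_inj: "i \<in> {1..r} \<Longrightarrow> j \<in> {1..r} \<Longrightarrow> ramp i = ramp j \<Longrightarrow> i = j"
  unfolding five_positions using distinct_numerals_mod_5 nonzero_numerals_mod_5 by (elim disjE) (simp_all add: ramp_simps)

text \<open>Up to a constant, the vector lists the five field elements in an order of parity \<open>b\<close>.  Adding a constant permutes
the field elements by a power of a five-cycle, which is even, so the parity is well defined.\<close>

definition arrangement :: "bool \<Rightarrow> (nat \<Rightarrow> 'k) \<Rightarrow> bool" where
  "arrangement b a \<longleftrightarrow> (\<exists>p t. p permutes {1..r} \<and> evenperm p = b \<and> (\<forall>i\<in>{1..r}. a i = ramp (p i) + t))"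

lemma arrangement_ramp: "arrangement True ramp"
  unfolding arrangement_def
proof (intro exI[of _ id] exI[of _ 0] conjI)
  show "id permutes {1..r}" by (rule permutes_id)
  show "evenperm (id :: nat \<Rightarrow> nat) = True" using evenperm_id by simp
qed simp

lemma permutes_permutation: "p permutes {1..r} \<Longrightarrow> permutation p"
  using permutation_permutes by (metis finite_atLeastAtMost)

lemma evenperm_comp_iff: "p permutes {1..r} \<Longrightarrow> q permutes {1..r} \<Longrightarrow> evenperm (p \<circ> q) \<longleftrightarrow> (evenperm p = evenperm q)"
  by (simp add: evenperm_comp permutes_permutation)

text \<open>Adding \<open>1\<close> to the field elements is a five-cycle of positions, an even permutation.\<close>

lemma ramp_shift: "\<exists>q. q permutes {1..r} \<and> evenperm q \<and> (\<forall>j\<in>{1..r}. ramp (q j) = ramp j + u)"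
proof -
  let ?T = "Transposition.transpose :: nat \<Rightarrow> nat \<Rightarrow> nat \<Rightarrow> nat"
  let ?c = "?T 1 2 \<circ> ?T 2 3 \<circ> ?T 3 4 \<circ> ?T 4 5"
  have c: "?c permutes {1..r}" using r5 by (intro permutes_compose permutes_swap_id) auto
  have ce: "evenperm ?c" by (simp add: evenperm_comp permutation_compose permutation_swap_id evenperm_swap)
  have cv: "ramp (?c j) = ramp j + 1" if "j \<in> {1..r}" for j
    using that unfolding five_positions by (elim disjE) (simp_all add: Transposition.transpose_def ramp_simps numerals_mod_5)
  have "u \<in> range of_nat" using prime_field by simp
  then obtain m where "u = of_nat m" by blast
  moreover have "\<exists>q. q permutes {1..r} \<and> evenperm q \<and> (\<forall>j\<in>{1..r}. ramp (q j) = ramp j + of_nat m)"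
  proof (induction m)
    case 0
    show ?case
    proof (intro exI[of _ id] conjI)
      show "id permutes {1..r}" by (rule permutes_id)
      show "evenperm (id :: nat \<Rightarrow> nat)" using evenperm_id by simp
    qed simp
  next
    case (Suc m)
    then obtain q where q: "q permutes {1..r}" "evenperm q" "\<forall>j\<in>{1..r}. ramp (q j) = ramp j + of_nat m" by blast
    have "ramp ((?c \<circ> q) j) = ramp j + of_nat (Suc m)" if j: "j \<in> {1..r}" for j
    proof -
      have "q j \<in> {1..r}" using permutes_in_image[OF q(1)] j by blast
      then show ?thesis using cv[of "q j"] q(3) j by simp
    qed
    then show ?case using permutes_compose[OF q(1) c] evenperm_comp_iff[OF c q(1)] ce q(2) by blast
  qed
  ultimately show ?thesis by simp
qed

lemma arrangement_permute:
  assumes a: "arrangement b a" and s: "\<sigma> permutes {1..r}"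
  shows "arrangement (b = evenperm \<sigma>) (permute_coords \<sigma> a)"
proof -
  obtain p t where p: "p permutes {1..r}" "evenperm p = b" "\<forall>i\<in>{1..r}. a i = ramp (p i) + t"
    using a by (auto simp: arrangement_def)
  note i = permutes_inv[OF s]
  have "evenperm (p \<circ> inv' \<sigma>) \<longleftrightarrow> (b = evenperm \<sigma>)"
    using evenperm_comp_iff[OF p(1) i] p(2) evenperm_inv[OF permutes_permutation[OF s]] by simp
  moreover have "permute_coords \<sigma> a m = ramp ((p \<circ> inv' \<sigma>) m) + t" if "m \<in> {1..r}" for m
    using p(3) permutes_in_image[OF i] that by (simp add: permute_coords_def)
  ultimately show ?thesis unfolding arrangement_def using permutes_compose[OF i p(1)] by blast
qed

text \<open>Negation of the field elements is a product of two transpositions, and doubling is a four-cycle.\<close>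

lemma arrangement_scale:
  assumes a: "arrangement b a" shows "arrangement b (\<lambda>i. - a i)" "arrangement (\<not> b) (\<lambda>i. 2 * a i)"
proof -
  obtain p t where p: "p permutes {1..r}" "evenperm p = b" "\<forall>i\<in>{1..r}. a i = ramp (p i) + t"
    using a by (auto simp: arrangement_def)
  let ?T = "Transposition.transpose :: nat \<Rightarrow> nat \<Rightarrow> nat \<Rightarrow> nat"
  let ?n = "?T 2 5 \<circ> ?T 3 4" and ?m = "?T 2 3 \<circ> ?T 3 5 \<circ> ?T 5 4"
  have perm: "?n permutes {1..r}" "?m permutes {1..r}" using r5 by (auto intro!: permutes_compose permutes_swap_id)
  have even: "evenperm ?n" "\<not> evenperm ?m"
    by (simp_all add: evenperm_comp permutation_compose permutation_swap_id evenperm_swap)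
  have n: "ramp (?n j) = - ramp j" and m: "ramp (?m j) = 2 * ramp j" if "j \<in> {1..r}" for j
    using that unfolding five_positions
    by (elim disjE; simp add: Transposition.transpose_def ramp_simps minus_numerals_mod_5 numerals_mod_5)+
  have pr: "p i \<in> {1..r}" if "i \<in> {1..r}" for i using permutes_in_image[OF p(1)] that by blast
  have "- a i = ramp ((?n \<circ> p) i) + - t" if "i \<in> {1..r}" for i
    using p(3) that n[OF pr[OF that]] by (simp add: add.commute)
  then show "arrangement b (\<lambda>i. - a i)" unfolding arrangement_def
    using permutes_compose[OF p(1) perm(1)] evenperm_comp_iff[OF perm(1) p(1)] even p(2) by blast
  have "2 * a i = ramp ((?m \<circ> p) i) + 2 * t" if "i \<in> {1..r}" for i
    using p(3) that m[OF pr[OF that]] by (simp add: distrib_left)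
  then show "arrangement (\<not> b) (\<lambda>i. 2 * a i)" unfolding arrangement_def
    using permutes_compose[OF p(1) perm(2)] evenperm_comp_iff[OF perm(2) p(1)] even p(2) by blast
qed

definition even_arrangements :: "('k ^ 'n) set" where
  "even_arrangements = {D a |a. a \<in> zero_sum_vecs r \<and> arrangement True a}"

text \<open>Otherwise an even arrangement minus the root \<open>(1, -1, 0, 0, 0)\<close> would be an even arrangement, up to a
constant.  But it differs from the original one at exactly two positions, so the two are related
by a transposition.\<close>

lemma E12_not_sum:
  assumes x: "x \<in> even_arrangements" and y: "y \<in> even_arrangements" shows "E 1 2 \<noteq> x + y"
proof
  assume eq: "E 1 2 = x + y"
  obtain a where a: "a \<in> zero_sum_vecs r" "arrangement True a" "x = D a" using x by (auto simp: even_arrangements_def)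
  obtain b where b: "b \<in> zero_sum_vecs r" "arrangement True b" "y = D b" using y by (auto simp: even_arrangements_def)
  have r: "1 \<in> {1..r}" "2 \<in> {1..r}" using r5 by auto
  have "D (\<lambda>i. a i + b i) = D (root_vec 1 2)" using D_add[OF a(1) b(1)] a(3) b(3) eq by (simp add: E_def)
  then obtain t where t: "\<And>i. i \<in> {1..r} \<Longrightarrow> a i + b i = root_vec 1 2 i + t"
    using D_eq_iff[OF zero_sum_add[OF a(1) b(1)] zero_sum_root[OF r]] by blast
  obtain p s where p: "p permutes {1..r}" "evenperm p" "\<forall>i\<in>{1..r}. a i = ramp (p i) + s"
    using a(2) by (auto simp: arrangement_def)
  obtain q s' where q: "q permutes {1..r}" "evenperm q" "\<forall>i\<in>{1..r}. - b i = ramp (q i) + s'"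
    using arrangement_scale(1)[OF b(2)] by (auto simp: arrangement_def)
  define u where "u = s' + t - s"
  have pq: "ramp (p i) - root_vec 1 2 i = ramp (q i) + u" if "i \<in> {1..r}" for i
  proof -
    have "a i = root_vec 1 2 i + t + (- b i)" using t[OF that] by (simp add: eq_diff_eq)
    moreover have "a i = ramp (p i) + s" "- b i = ramp (q i) + s'" using p(3) q(3) that by blast+
    ultimately have "ramp (p i) + s = root_vec 1 2 i + t + (ramp (q i) + s')" by simp
    then show ?thesis unfolding u_def by (simp add: algebra_simps)
  qed
  obtain c where c: "c permutes {1..r}" "evenperm c" "\<forall>j\<in>{1..r}. ramp (c j) = ramp j + u" using ramp_shift by blast
  \<comment> \<open>Absorbing the constant \<open>u\<close>, the even permutations \<open>p\<close> and \<open>f\<close> agree except at \<open>1\<close> and \<open>2\<close>.\<close>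
  define f where "f = c \<circ> q"
  have f: "f permutes {1..r}" "evenperm f"
    unfolding f_def using permutes_compose[OF q(1) c(1)] evenperm_comp_iff[OF c(1) q(1)] c(2) q(2) by auto
  have pf: "ramp (p i) - root_vec 1 2 i = ramp (f i)" if i: "i \<in> {1..r}" for i
    using pq[OF i] c(3) permutes_in_image[OF q(1)] i by (simp add: f_def)
  have inr: "p i \<in> {1..r}" "f i \<in> {1..r}" if "i \<in> {1..r}" for i
    using permutes_in_image[OF p(1)] permutes_in_image[OF f(1)] that by blast+
  have same: "f i = p i" if "i \<in> {1..r}" "i \<noteq> 1" "i \<noteq> 2" for i
    using pf[OF that(1)] that inr[OF that(1)] by (intro ramp_inj) (simp_all add: root_vec_def)
  have ne: "f 1 \<noteq> p 1" using pf[OF r(1)] by (auto simp: root_vec_def)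
  have swap: "f 1 = p 2" "f 2 = p 1"
  proof -
    have im: "p ` {1..r} = f ` {1..r}" using permutes_image[OF p(1)] permutes_image[OF f(1)] by simp
    have "f 1 \<in> p ` {1..r}" using im r(1) by blast
    then obtain i where i: "i \<in> {1..r}" "f 1 = p i" by blast
    show f1: "f 1 = p 2"
    proof (rule ccontr)
      assume "f 1 \<noteq> p 2"
      then have "i \<noteq> 1" "i \<noteq> 2" using i ne by auto
      then have "f 1 = f i" "i \<noteq> 1" using same[OF i(1)] i(2) by auto
      then show False using permutes_inj[OF f(1)] by (auto simp: inj_eq)
    qed
    have "p 1 \<in> f ` {1..r}" using im r(1) by blast
    then obtain k where k: "k \<in> {1..r}" "p 1 = f k" by blast
    show "f 2 = p 1"
    proof (rule ccontr)
      assume "f 2 \<noteq> p 1"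
      then have "k \<noteq> 1" "k \<noteq> 2" using k ne by auto
      then have "p 1 = p k" "k \<noteq> 1" using same[OF k(1)] k(2) by auto
      then show False using permutes_inj[OF p(1)] by (auto simp: inj_eq)
    qed
  qed
  let ?t = "Transposition.transpose 1 2 :: nat \<Rightarrow> nat"
  have tp: "?t permutes {1..r}" using r by (rule permutes_swap_id)
  have "f = p \<circ> ?t"
  proof (rule permutes_eqI[OF f(1) permutes_compose[OF tp p(1)]])
    fix i assume "i \<in> {1..r}"
    then show "f i = (p \<circ> ?t) i" using same[of i] swap by (auto simp: Transposition.transpose_def)
  qed
  then show False using evenperm_comp_iff[OF p(1) tp] f(2) p(2) by (simp add: evenperm_swap)
qed

lemma E12_not_even_arrangement: "E 1 2 \<notin> even_arrangements"
proof
  assume "E 1 2 \<in> even_arrangements"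
  then obtain a where a: "a \<in> zero_sum_vecs r" "arrangement True a" "E 1 2 = D a" by (auto simp: even_arrangements_def)
  have r: "1 \<in> {1..r}" "2 \<in> {1..r}" "3 \<in> {1..r}" "4 \<in> {1..r}" using r5 by auto
  obtain t where "\<And>i. i \<in> {1..r} \<Longrightarrow> root_vec 1 2 i = a i + t"
    using D_eq_iff[OF zero_sum_root[OF r(1,2)] a(1)] a(3) unfolding E_def by blast
  from this[OF r(3)] this[OF r(4)] have "a 3 + t = a 4 + t" by (simp add: root_vec_def)
  then have "a 3 = a 4" by simp
  moreover obtain p s where p: "p permutes {1..r}" "\<forall>i\<in>{1..r}. a i = ramp (p i) + s" using a(2) by (auto simp: arrangement_def)
  ultimately have "ramp (p 3) = ramp (p 4)" using r by simp
  then have "p 3 = p 4" using ramp_inj permutes_in_image[OF p(1)] r by blast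
  then show False using permutes_inj[OF p(1)] by (auto simp: inj_eq)
qed

lemma even_arrangements_H: assumes h: "h \<in> H" and x: "x \<in> even_arrangements" shows "h x \<in> even_arrangements"
proof -
  obtain a where a: "a \<in> zero_sum_vecs r" "arrangement True a" "x = D a" using x by (auto simp: even_arrangements_def)
  obtain \<sigma> where s: "acts_as h \<sigma>" "evenperm \<sigma>" using H_acts[OF h] by blast
  have "arrangement True (permute_coords \<sigma> a)" using arrangement_permute[OF a(2) acts_as_perm[OF s(1)]] s(2) by simp
  then show ?thesis using acts_asD[OF s(1) a(1)] acts_as_zero_sum[OF s(1) a(1)] a(3) by (auto simp: even_arrangements_def)
qed

lemma even_arrangements_minus: assumes x: "x \<in> even_arrangements" shows "- x \<in> even_arrangements"
proof -
  obtain a where a: "a \<in> zero_sum_vecs r" "arrangement True a" "x = D a" using x by (auto simp: even_arrangements_def)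
  have "D (\<lambda>i. (- 1) * a i) = - x" using D_scale[OF a(1), of "-1"] a(3) by simp
  moreover have "(\<lambda>i. (- 1) * a i) \<in> zero_sum_vecs r" by (rule zero_sum_scale[OF a(1)])
  ultimately show ?thesis using arrangement_scale(1)[OF a(2)] by (auto simp: even_arrangements_def intro!: exI[of _ "\<lambda>i. - a i"])
qed

text \<open>Modulo \<open>H\<close> the scalars in \<open>G0\<close> are \<open>1\<close> and \<open>-1\<close>.  The elements involving the transposition \<open>\<tau>\<close> have scalar
factors whose pairwise products again belong to \<open>{1, -1}\<close>, so these factors all belong to \<open>{2, 3}\<close> or all to \<open>{1, -1}\<close>.
In the first case even arrangements remain even, because doubling and \<open>\<tau>\<close> both change the parity.  In
the second case roots go to roots.\<close>

lemma no_scalars_not_cover2: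
  assumes two: "(\<lambda>x. 2 *s x) \<notin> G0"
  shows "\<not> (\<forall>v w. v \<noteq> 0 \<longrightarrow> cover2 G0 v w)"
proof
  assume cov: "\<forall>v w. v \<noteq> 0 \<longrightarrow> cover2 G0 v w"
  have r: "1 \<in> {1..r}" "2 \<in> {1..r}" using r5 by auto
  let ?t = "Transposition.transpose 1 2 :: nat \<Rightarrow> nat"
  have tp: "?t permutes {1..r}" using r by (rule permutes_swap_id)
  obtain \<tau> where tau: "acts_as \<tau> ?t" using acts_exists[OF tp] by blast
  have tt: "\<tau> (\<tau> x) = x" for x
  proof -
    have "?t \<circ> ?t = id" by simp
    then have "\<tau> \<circ> \<tau> = id" using acts_as_compose[OF tau tau] acts_as_id acts_as_fun_eq by metis
    then show ?thesis by (metis comp_apply id_apply)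
  qed
  have scal: "c = 1 \<or> c = - 1" if g: "g \<in> G0" "\<And>x. g x = c *s x" and c: "c \<noteq> 0" for g c
  proof -
    have "c \<noteq> 2" using g two by (metis ext)
    moreover have "c \<noteq> 3"
    proof
      assume c: "c = 3"
      have "g \<circ> g \<circ> g \<in> G0" using g(1) G0_compose by blast
      moreover have "g \<circ> g \<circ> g = (\<lambda>x. 2 *s x)" using numerals_mod_5 c by (simp add: fun_eq_iff g(2))
      ultimately show False using two by simp
    qed
    ultimately show ?thesis using elements_mod_5[of c] c minus_numerals_mod_5(1) by auto
  qed
  have inG: "h \<circ> f \<in> G0" if "h \<in> H" "f \<in> G0" for h f using that H_G0 G0_compose by blast
  define twisted where "twisted = (\<lambda>c. \<exists>g\<in>G0. \<forall>x. g x = c *s \<tau> x)"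
  have elems: "\<exists>h\<in>H. \<exists>c. c \<noteq> 0 \<and> ((c = 1 \<or> c = - 1) \<and> (\<forall>x. h (g x) = c *s x) \<or> twisted c \<and> (\<forall>x. h (g x) = c *s \<tau> x))"
    if g: "g \<in> G0" for g
  proof -
    obtain h c where h: "h \<in> H" "c \<noteq> 0" "(\<forall>x. h (g x) = c *s x) \<or> (\<forall>x. h (g x) = c *s \<tau> x)"
      using G0_mod_H[OF g tau] by blast
    note hg = inG[OF h(1) g]
    from h(3) show ?thesis
    proof
      assume *: "\<forall>x. h (g x) = c *s x"
      then have "c = 1 \<or> c = - 1" using scal[OF hg _ h(2)] by simp
      then show ?thesis using h(1,2) * by blast
    next
      assume *: "\<forall>x. h (g x) = c *s \<tau> x"
      then have "twisted c" unfolding twisted_def using hg by (intro bexI[of _ "h \<circ> g"]) auto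
      then show ?thesis using h(1,2) * by blast
    qed
  qed
  have undo: "\<exists>k\<in>H. \<forall>x. k (h x) = x" if "h \<in> H" for h
    using H_inverse[OF that] by (metis comp_apply id_apply)
  show False
  proof (cases "\<exists>c. (c = 2 \<or> c = 3) \<and> twisted c")
    case True
    then obtain c1 where c1: "c1 = 2 \<or> c1 = 3" "twisted c1" by blast
    have tw: "c = 2 \<or> c = 3" if c: "twisted c" "c \<noteq> 0" for c
    proof -
      obtain g1 where g1: "g1 \<in> G0" "\<And>x. g1 x = c1 *s \<tau> x" using c1(2) unfolding twisted_def by blast
      obtain g where g: "g \<in> G0" "\<And>x. g x = c *s \<tau> x" using c(1) unfolding twisted_def by blast
      have "g1 \<circ> g \<in> G0" using g1(1) g(1) G0_compose by blast
      moreover have "(g1 \<circ> g) x = (c1 * c) *s x" for x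
        by (simp add: g1(2) g(2) acts_as_scale[OF tau] tt)
      moreover have "c1 * c \<noteq> 0" using c1(1) c(2) nonzero_numerals_mod_5 by auto
      ultimately have "c1 * c = 1 \<or> c1 * c = - 1" by (rule scal)
      then show ?thesis using elements_mod_5[of c] c1(1) c(2) distinct_numerals_mod_5
        by (elim disjE) (simp_all add: minus_numerals_mod_5 numerals_mod_5)
    qed
    have vvE: "D ramp \<in> even_arrangements"
      unfolding even_arrangements_def using ramp_zero_sum arrangement_ramp by blast
    have tvE: "c *s \<tau> (D ramp) \<in> even_arrangements" if c: "c = 2 \<or> c = 3" for c
    proof -
      have "arrangement True ramp" by (rule arrangement_ramp)
      moreover have "\<not> evenperm ?t" by (simp add: evenperm_swap)
      ultimately have "arrangement False (permute_coords ?t ramp)" using arrangement_permute[OF _ tp, of True ramp] by simp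
      then have 2: "arrangement True (\<lambda>i. 2 * permute_coords ?t ramp i)" using arrangement_scale(2) by fastforce
      then have "arrangement True (\<lambda>i. - (2 * permute_coords ?t ramp i))" by (rule arrangement_scale(1))
      then have 3: "arrangement True (\<lambda>i. 3 * permute_coords ?t ramp i)"
        by (metis (no_types, lifting) ext minus_numerals_mod_5(2) mult_minus_left)
      have "arrangement True (\<lambda>i. c * permute_coords ?t ramp i)" using 2 3 c by auto
      moreover have "(\<lambda>i. c * permute_coords ?t ramp i) \<in> zero_sum_vecs r"
        by (rule zero_sum_scale[OF acts_as_zero_sum[OF tau ramp_zero_sum]])
      moreover have "c *s \<tau> (D ramp) = D (\<lambda>i. c * permute_coords ?t ramp i)"
        using D_scale[OF acts_as_zero_sum[OF tau ramp_zero_sum]] acts_asD[OF tau ramp_zero_sum] by simp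
      ultimately show ?thesis unfolding even_arrangements_def by blast
    qed
    have orb: "g (D ramp) \<in> even_arrangements" if g: "g \<in> G0" for g
    proof -
      obtain h c where h: "h \<in> H" "c \<noteq> 0" "(c = 1 \<or> c = - 1) \<and> (\<forall>x. h (g x) = c *s x) \<or> twisted c \<and> (\<forall>x. h (g x) = c *s \<tau> x)"
        using elems[OF g] by blast
      obtain k where k: "k \<in> H" "\<And>x. k (h x) = x" using undo[OF h(1)] by blast
      have "h (g (D ramp)) \<in> even_arrangements"
        using h(3) vvE even_arrangements_minus[OF vvE] tvE tw[OF _ h(2)] by auto
      then show ?thesis using even_arrangements_H[OF k(1)] k(2) by metis
    qed
    have sph: "sphere G0 (D ramp) \<subseteq> even_arrangements"
      using orb even_arrangements_minus by (auto simp: sphere_def)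
    have "D ramp \<noteq> 0"
    proof
      assume "D ramp = 0"
      then obtain t where "\<forall>i\<in>{1..r}. ramp i = t" using D_eq_0_iff[OF ramp_zero_sum] by blast
      then have "ramp 1 = ramp 2" using r by simp
      then show False by (simp add: ramp_simps)
    qed
    then have "cover2 G0 (D ramp) (E 1 2)" using cov by blast
    moreover have "E 1 2 \<noteq> 0" by (rule E_nonzero[OF r]) simp
    ultimately show False
      using sph E12_not_sum E12_not_even_arrangement
      unfolding cover2_def cover1_def by blast
  next
    case False
    have orb: "\<exists>u v. u \<in> {1..r} \<and> v \<in> {1..r} \<and> u \<noteq> v \<and> g (E 1 2) = E u v" if g: "g \<in> G0" for g
    proof -
      obtain h c where h: "h \<in> H" "c \<noteq> 0" "(c = 1 \<or> c = - 1) \<and> (\<forall>x. h (g x) = c *s x) \<or> twisted c \<and> (\<forall>x. h (g x) = c *s \<tau> x)"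
        using elems[OF g] by blast
      obtain k where k: "k \<in> H" "\<And>x. k (h x) = x" using undo[OF h(1)] by blast
      have "twisted c \<Longrightarrow> c = 1 \<or> c = - 1" using False elements_mod_5[of c] h(2) minus_numerals_mod_5(1) by auto
      moreover have "\<tau> (E 1 2) = E 2 1" using acts_as_E[OF tau r] by simp
      ultimately have "h (g (E 1 2)) = E 1 2 \<or> h (g (E 1 2)) = E 2 1"
        using h(3) E_minus[OF r] E_minus[OF r(2,1)] by auto
      then have "\<exists>m n. {m, n} \<subseteq> {1..r} \<and> m \<noteq> n \<and> h (g (E 1 2)) = E m n"
      proof
        assume "h (g (E 1 2)) = E 1 2" then show ?thesis using r by (intro exI[of _ 1] exI[of _ 2]) auto
      next
        assume "h (g (E 1 2)) = E 2 1" then show ?thesis using r by (intro exI[of _ 2] exI[of _ 1]) auto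
      qed
      then obtain m n where mn: "m \<in> {1..r}" "n \<in> {1..r}" "m \<noteq> n" "h (g (E 1 2)) = E m n" by auto
      obtain \<sigma> where s: "acts_as k \<sigma>" using H_acts[OF k(1)] by blast
      note p = acts_as_perm[OF s]
      have "g (E 1 2) = E (\<sigma> m) (\<sigma> n)" using k(2) mn(4) acts_as_E[OF s mn(1,2)] by metis
      moreover have "\<sigma> m \<in> {1..r}" "\<sigma> n \<in> {1..r}" using permutes_in_image[OF p] mn by blast+
      moreover have "\<sigma> m \<noteq> \<sigma> n" using permutes_inj[OF p] mn(3) by (simp add: inj_eq)
      ultimately show ?thesis by blast
    qed
    have sph: "\<exists>u v. u \<in> {1..r} \<and> v \<in> {1..r} \<and> u \<noteq> v \<and> x = E u v" if x: "x \<in> sphere G0 (E 1 2)" for x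
    proof -
      obtain g where g: "g \<in> G0" "x = g (E 1 2) \<or> x = - g (E 1 2)" using x by (auto simp: sphere_def)
      obtain u v where "u \<in> {1..r}" "v \<in> {1..r}" "u \<noteq> v" "g (E 1 2) = E u v" using orb[OF g(1)] by blast
      then show ?thesis using g(2) E_minus[of u v] by metis
    qed
    have ramp: "D ramp = of_list [0, 1, 2, 3, 4]" by (simp add: ramp_def of_list_def)
    have adm: "admissible [0, 1, 2, 3, 4]" unfolding admissible_def using r5 numerals_mod_5 by simp
    have "\<not> cover1 G0 (E 1 2) (D ramp)" unfolding ramp
    proof (rule not_cover1_if_far[OF quinary_keeps_roots adm])
      show "3 \<le> length (filter (\<lambda>x. x \<noteq> t) [0, 1, 2, 3, 4])" for t :: 'k
        using elements_mod_5[of t] distinct_numerals_mod_5 nonzero_numerals_mod_5 by (elim disjE) simp_all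
    qed
    moreover have "cover2 G0 (E 1 2) (D ramp)" using cov E_nonzero[of 1 2] r by auto
    ultimately obtain x y where xy: "x \<in> sphere G0 (E 1 2)" "y \<in> sphere G0 (E 1 2)" "D ramp = x + y"
      unfolding cover2_def by blast
    obtain i j where x: "i \<in> {1..r}" "j \<in> {1..r}" "i \<noteq> j" "x = E i j" using sph[OF xy(1)] by blast
    obtain k l where y: "k \<in> {1..r}" "l \<in> {1..r}" "k \<noteq> l" "y = E k l" using sph[OF xy(2)] by blast
    let ?f = "\<lambda>m. root_vec i j m + root_vec k l m :: 'k"
    note zr = zero_sum_root[OF x(1,2), where ?'a = 'k] zero_sum_root[OF y(1,2), where ?'a = 'k]
    have "D ramp = D ?f" using D_add[OF zr] xy(3) x(4) y(4) by (simp add: E_def)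
    then obtain t where t: "\<And>m. m \<in> {1..r} \<Longrightarrow> ramp m = ?f m + t"
      using D_eq_iff[OF ramp_zero_sum zero_sum_add[OF zr]] by blast
    have inj: "m = n" if "m \<in> {1..r}" "n \<in> {1..r}" "?f m = ?f n" for m n
      using t[OF that(1)] t[OF that(2)] that by (intro ramp_inj) simp_all
    show False
    proof (cases "distinct [i, j, k, l]")
      case True
      then have "?f i = ?f k" by (auto simp: root_vec_def)
      then show False using inj[OF x(1) y(1)] True by simp
    next
      case False
      have "card {i, j, k, l} \<le> 3"
      proof -
        have "card (set [i, j, k, l]) < length [i, j, k, l]"
          using False card_distinct card_length le_neq_implies_less by metis
        then show ?thesis by simp
      qed
      moreover have "{1..r} \<subseteq> {i, j, k, l} \<union> ({1..r} - {i, j, k, l})" by blast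
      moreover have "card {1..r} = 5" using r5 by simp
      moreover have "card ({1..r} - {i, j, k, l}) = 5 - card {i, j, k, l}"
        using x(1,2) y(1,2) r5 by (subst card_Diff_subset) auto
      ultimately have "2 \<le> card ({1..r} - {i, j, k, l})" by simp
      then obtain m n where mn: "m \<in> {1..r} - {i, j, k, l}" "n \<in> {1..r} - {i, j, k, l}" "m \<noteq> n"
        by (meson card_2_iff' obtain_subset_with_card_n subsetD)
      then have "?f m = ?f n" by (simp add: root_vec_def)
      then show False using inj[of m n] mn by blast
    qed
  qed
qed

end

section \<open>Upper bound in the presence of all scalars\<close>

locale quinary_scalars = quinary r H D G0
  for r and H :: "('k::{field,finite} ^ 'n \<Rightarrow> 'k ^ 'n) set" and D G0 +
  assumes scalars: "c \<noteq> 0 \<Longrightarrow> (\<lambda>x. c *s x) \<in> G0"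
begin

lemma same_orbit_scale: "c \<noteq> 0 \<Longrightarrow> same_orbit v (c *s v)"
  unfolding same_orbit_def using scalars by (intro bexI[of _ "\<lambda>x. c *s x"]) auto

lemma admissible_5: "admissible xs \<longleftrightarrow> length xs = 5 \<and> sum_list xs = 0"
  unfolding admissible_def using r5 by simp

lemma same_orbit_affine:
  assumes xs: "admissible xs" and ys: "admissible ys" and c: "c \<noteq> 0"
    and eq: "mset (map (\<lambda>x. c * x + t) xs) = mset ys" and nd: "\<not> distinct ys"
  shows "same_orbit (of_list xs) (of_list ys)"
proof -
  have "mset (map (\<lambda>x. x + t) (map ((*) c) xs)) = mset ys" using eq by (simp add: o_def)
  then have "same_orbit (of_list (map ((*) c) xs)) (of_list ys)"
    using same_orbit_of_list[OF of_list_scale(2)[OF xs] ys _ nd] by blast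
  then show ?thesis using same_orbit_scale[OF c, of "of_list xs"] same_orbit_trans unfolding of_list_scale(1)[OF xs] by blast
qed

lemma arrangement_same_orbit:
  assumes a: "a \<in> zero_sum_vecs r" "arrangement True a" shows "same_orbit (D a) (D ramp)"
proof -
  obtain p t where p: "p permutes {1..r}" "evenperm p" "\<forall>i\<in>{1..r}. a i = ramp (p i) + t"
    using a(2) by (auto simp: arrangement_def)
  obtain h where h: "h \<in> H" "acts_as h p" using even_acts[OF p(1,2)] by blast
  have "permute_coords p a i = ramp i + t" if i: "i \<in> {1..r}" for i
  proof -
    have "inv' p i \<in> {1..r}" using permutes_in_image[OF permutes_inv[OF p(1)]] i by blast
    then show ?thesis using p(3) permutes_inverses(1)[OF p(1)] by (simp add: permute_coords_def)
  qed
  then have "D (permute_coords p a) = D ramp"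
    using D_eq_iff[OF acts_as_zero_sum[OF h(2) a(1)] ramp_zero_sum] by blast
  then show ?thesis using same_orbit_H[OF h(1), of "D a"] acts_asD[OF h(2) a(1)] by simp
qed

text \<open>If the entries form an odd arrangement, the scalar \<open>2\<close> turns it into an even one.\<close>

lemma same_orbit_distinct:
  assumes xs: "admissible xs" "distinct xs" shows "same_orbit (of_list xs) (D ramp)"
proof -
  have l: "length xs = r" using xs(1) by (simp add: admissible_def)
  have "card (set xs) = CARD('k)" using distinct_card[OF xs(2)] l r5 card5 by simp
  then have set: "set xs = UNIV" by (intro card_subset_eq) auto
  have V: "distinct [0, 1, 2, 3, 4 :: 'k]" "set [0, 1, 2, 3, 4 :: 'k] = UNIV"
    using distinct_numerals_mod_5 nonzero_numerals_mod_5 elements_mod_5 by auto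
  have "mset xs = mset [0, 1, 2, 3, 4]"
    using xs(2) V set by (metis set_eq_iff_mset_eq_distinct)
  then have "entries (lvec xs) = entries ramp"
    unfolding ramp_def using entries_lvec[OF l] entries_lvec[of "[0, 1, 2, 3, 4]"] r5 by simp
  then obtain p where p: "p permutes {1..r}" "\<forall>x\<in>{1..r}. lvec xs x = ramp (p x)"
    using image_mset_eq_implies_permutes[of "{1..r}" "lvec xs" ramp] by (auto simp: entries_def)
  then have a: "arrangement (evenperm p) (lvec xs)" unfolding arrangement_def by (intro exI[of _ p] exI[of _ 0]) simp
  note z = lvec_zero_sum[OF xs(1)]
  show ?thesis
  proof (cases "evenperm p")
    case True
    then show ?thesis using arrangement_same_orbit[OF z] a by (simp add: of_list_def)
  next
    case False
    then have "arrangement True (\<lambda>i. 2 * lvec xs i)" using arrangement_scale(2)[OF a] by simp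
    then have "same_orbit (D (\<lambda>i. 2 * lvec xs i)) (D ramp)" by (rule arrangement_same_orbit[OF zero_sum_scale[OF z]])
    then have "same_orbit (2 *s of_list xs) (D ramp)" using D_scale[OF z, of 2] by (simp add: of_list_def)
    then show ?thesis using same_orbit_scale[OF nonzero_numerals_mod_5(1)] same_orbit_trans by blast
  qed
qed

text \<open>If two entries coincide, subtract their value to obtain \<open>(0, 0, x, y, w)\<close> with \<open>x + y + w = 0\<close>.  If one of the three
vanishes, this is a multiple of a root; otherwise two of them coincide.\<close>

lemma quinary_orbits:
  assumes v: "v \<noteq> 0"
  shows "same_orbit v (D ramp) \<or> same_orbit v (of_list [1, 4, 0, 0, 0]) \<or> same_orbit v (of_list [1, 1, 4, 4, 0])"
proof -
  obtain xs where xs: "admissible xs" "v = of_list xs" using of_list_surj by blast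
  have admB: "admissible [1, 4, 0, 0, 0]" and admC: "admissible [1, 1, 4, 4, 0]"
    unfolding admissible_5 using numerals_mod_5 by simp_all
  show ?thesis
  proof (cases "distinct xs")
    case True
    then show ?thesis using same_orbit_distinct[OF xs(1)] xs(2) by simp
  next
    case False
    then obtain as bs cs z where xs': "xs = as @ [z] @ bs @ [z] @ cs" using not_distinct_decomp by blast
    have "length (as @ bs @ cs) = 3" using xs(1) unfolding xs' admissible_5 by simp
    moreover have "\<exists>x y z. ls = [x, y, z]" if "length ls = 3" for ls :: "'k list"
      using that by (auto simp: length_Suc_conv numeral_3_eq_3)
    ultimately obtain x' y' z' where rest: "as @ bs @ cs = [x', y', z']" by blast
    define x y w where "x = x' - z" "y = y' - z" "w = z' - z"
    have mxs: "mset xs = {#z, z#} + mset (as @ bs @ cs)" unfolding xs' by simp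
    have m: "mset (map (\<lambda>u. u + - z) xs) = mset [0, 0, x, y, w]"
      using arg_cong[OF mxs, of "image_mset (\<lambda>u. u + - z)"] unfolding rest x_y_w_def by simp
    have shift: "sum_list (map (\<lambda>u. u + t) ls) = sum_list ls + of_nat (length ls) * t" for t and ls :: "'k list"
      by (induction ls) (simp_all add: algebra_simps)
    have "sum_list (map (\<lambda>u. u + - z) xs) = 0"
      unfolding shift using xs(1) five_eq_0 by (simp add: admissible_5)
    then have "sum_list [0, 0, x, y, w] = 0" using m by (metis sum_mset_sum_list)
    then have s: "x + y + w = 0" by (simp add: add.assoc)
    have adm: "admissible [0, 0, x, y, w]" unfolding admissible_5 using s by (simp add: add.assoc)
    have ev: "same_orbit v (of_list [0, 0, x, y, w])" unfolding xs(2) by (rule same_orbit_of_list[OF xs(1) adm m]) simp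
    have toB: ?thesis if "c \<noteq> 0" "mset (map (\<lambda>x. c * x + t) [0, 0, x, y, w]) = mset [1, 4, 0, 0, 0]" for c t
      using same_orbit_trans[OF ev same_orbit_affine[OF adm admB that]] by simp
    have toC: ?thesis if "c \<noteq> 0" "mset (map (\<lambda>x. c * x + t) [0, 0, x, y, w]) = mset [1, 1, 4, 4, 0]" for c t
      using same_orbit_trans[OF ev same_orbit_affine[OF adm admC that]] by simp
    have w: "w = 4 * (x + y)"
    proof -
      have "- 1 * (x + y) = w" using minus_unique[OF s] by simp
      then show ?thesis unfolding minus_numerals_mod_5 by (rule sym)
    qed
    have nz: "\<not> (x = 0 \<and> y = 0)"
    proof
      assume "x = 0 \<and> y = 0"
      then have "of_list [0, 0, x, y, w] = 0" using w of_list_zero r5 by (simp add: eval_nat_numeral)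
      then show False using ev same_orbit_0 v by simp
    qed
    note simps = numerals_mod_5 add_mset_commute
    show ?thesis
    proof (cases "x = 0")
      case True
      then have "y \<noteq> 0" using nz by simp
      then show ?thesis using elements_mod_5[of y] True w
        by (elim disjE) (simp, (rule toB[of 1 0] toB[of 2 0] toB[of 3 0] toB[of 4 0]; simp add: simps nonzero_numerals_mod_5; fail)+)
    next
      case False
      then show ?thesis using elements_mod_5[of x] elements_mod_5[of y] w nonzero_numerals_mod_5
        by (elim disjE; hypsubst?; (simp; fail)?)
           (((rule toB[of 1 0] toB[of 2 0] toB[of 3 0] toB[of 4 0]; simp add: simps nonzero_numerals_mod_5; fail) |
             (rule toC[of 1 0] toC[of 1 1] toC[of 1 2] toC[of 1 3] toC[of 1 4]
                   toC[of 2 0] toC[of 2 1] toC[of 2 2] toC[of 2 3] toC[of 2 4]; simp add: simps nonzero_numerals_mod_5; fail))+)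
    qed
  qed
qed

lemma quinary_cover2:
  assumes v: "v \<noteq> 0" shows "cover2 G0 v w"
proof -
  let ?B = "[1, 4, 0, 0, 0] :: 'k list" and ?C = "[1, 1, 4, 4, 0] :: 'k list" and ?V = "[0, 1, 2, 3, 4] :: 'k list"
  have adm: "admissible ?B" "admissible ?C" unfolding admissible_5 using numerals_mod_5 by simp_all
  have V: "D ramp = of_list ?V" by (simp add: ramp_def of_list_def)
  have inV: "of_list xs \<in> sphere G0 (D ramp)" if "length xs = 5" "sum_list xs = 0" "distinct xs" for xs
    using same_orbit_distinct[of xs] that same_orbit_sym unfolding admissible_5 sphere_iff by blast
  have inB: "of_list xs \<in> sphere G0 (of_list ?B)"
    if "length xs = 5" "sum_list xs = 0" "c \<noteq> 0" "mset (map (\<lambda>x. c * x + t) xs) = mset ?B" for xs c t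
    using same_orbit_sym[OF same_orbit_affine[OF _ adm(1) that(3,4)]] that(1,2) unfolding admissible_5 sphere_iff by simp
  have inC: "of_list xs \<in> sphere G0 (of_list ?C)"
    if "length xs = 5" "sum_list xs = 0" "c \<noteq> 0" "mset (map (\<lambda>x. c * x + t) xs) = mset ?C" for xs c t
    using same_orbit_sym[OF same_orbit_affine[OF _ adm(2) that(3,4)]] that(1,2) unfolding admissible_5 sphere_iff by simp
  note simps = numerals_mod_5 add_mset_commute nonzero_numerals_mod_5 nonzero_numerals_mod_5[symmetric] distinct_numerals_mod_5
  have sum: "cover2 G0 u (of_list (map2 (+) xs ys))"
    if "of_list xs \<in> sphere G0 u" "of_list ys \<in> sphere G0 u" "length xs = 5" "sum_list xs = 0" "length ys = 5" "sum_list ys = 0" for u xs ys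
    using cover2_sum[OF _ _ that(1,2)] that(3-6) unfolding admissible_5 by simp
  \<comment> \<open>Explicit decompositions; each summand has the required orbit after an affine change of entries.\<close>
  have VB: "cover2 G0 (D ramp) (of_list ?B)"
    using sum[OF inV inV, of "[1, 0, 2, 3, 4]" "[0, 4, 3, 2, 1]"] by (simp add: simps)
  have VC: "cover2 G0 (D ramp) (of_list ?C)"
    using sum[OF inV inV, of "[0, 2, 1, 4, 3]" "[1, 4, 3, 0, 2]"] by (simp add: simps)
  have BC: "cover2 G0 (of_list ?B) (of_list ?C)"
    using sum[OF inB[where c = 1 and t = 0] inB[where c = 1 and t = 0], of "[1, 0, 4, 0, 0]" "[0, 1, 0, 4, 0]"]
    by (simp add: simps)
  have CB: "cover2 G0 (of_list ?C) (of_list ?B)"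
    using sum[OF inC[where c = 3 and t = 1] inC[where c = 2 and t = 1], of "[1, 0, 1, 0, 3]" "[0, 4, 4, 0, 2]"]
    by (simp add: simps)
  have toV: "cover2 G0 u (D ramp)" if "cover2 G0 u (of_list xs)" "length xs = 5" "sum_list xs = 0" "distinct xs" for u xs
  proof (rule cover_same_orbit(2)[OF _ same_orbit_sym that(1)])
    show "same_orbit (of_list xs) (D ramp)" using same_orbit_distinct[of xs] that(2-4) unfolding admissible_5 by blast
    show "same_orbit u u" using same_orbit_H[OF H_id, of u] by simp
  qed
  have "cover2 G0 (of_list ?B) (of_list [1, 4, 2, 3, 0])"
    using sum[OF inB[where c = 1 and t = 0] inB[where c = 3 and t = 0], of "[1, 4, 0, 0, 0]" "[0, 0, 2, 3, 0]"]
    by (simp add: simps)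
  then have BV: "cover2 G0 (of_list ?B) (D ramp)" by (rule toV) (simp_all add: simps)
  have "cover2 G0 (of_list ?C) (of_list [3, 4, 1, 2, 0])"
    using sum[OF inC[where c = 1 and t = 0] inC[where c = 2 and t = 0], of "[1, 1, 4, 4, 0]" "[2, 3, 2, 3, 0]"]
    by (simp add: simps)
  then have CV: "cover2 G0 (of_list ?C) (D ramp)" by (rule toV) (simp_all add: simps)
  show ?thesis
  proof (rule cover_reps(2)[of "{D ramp, of_list ?B, of_list ?C}"])
    show "\<exists>\<rho>\<in>{D ramp, of_list ?B, of_list ?C}. same_orbit v \<rho>" if "v \<noteq> 0" for v using quinary_orbits[OF that] by blast
    show "cover2 G0 \<rho> \<sigma>" if "\<rho> \<in> {D ramp, of_list ?B, of_list ?C}" "\<sigma> \<in> {D ramp, of_list ?B, of_list ?C}" for \<rho> \<sigma>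
      using that VB VC BC CB BV CV cover2_refl by (elim insertE emptyE) simp_all
  qed fact
qed

end

section \<open>Direct products of scalars and the alternating group\<close>

lemma bij_scalar: "c \<noteq> 0 \<Longrightarrow> bij (\<lambda>x :: 'k::field ^ 'n. c *s x)"
  by (rule bij_betw_byWitness[where f' = "\<lambda>x. inverse c *s x"]) (auto simp: vector_smult_assoc)

context prime_deleted_affine begin

text \<open>The action is faithful, so mapping an even permutation to the map by which it acts is an isomorphism.\<close>

lemma H_iso_alt:
  assumes H: "subgroup H (BijGroup UNIV)" shows "perm_grp UNIV H \<cong> alt_group r"
proof -
  define F where "F = (\<lambda>\<sigma>. SOME h. acts_as h \<sigma>)"
  have F: "acts_as (F \<sigma>) \<sigma>" if "\<sigma> \<in> carrier (alt_group r)" for \<sigma>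
    using acts_exists[of \<sigma>] that unfolding F_def alt_group_carrier by (metis someI_ex)
  have FH: "F \<sigma> \<in> H" if "\<sigma> \<in> carrier (alt_group r)" for \<sigma>
    using H_I[OF F[OF that]] that by (simp add: alt_group_carrier)
  have bijF: "bij (F \<sigma>)" if "\<sigma> \<in> carrier (alt_group r)" for \<sigma>
    using FH[OF that] H_G0 G0_bij by blast
  have "F \<in> iso (alt_group r) (perm_grp UNIV H)"
  proof (rule isoI)
    show "F \<in> hom (alt_group r) (perm_grp UNIV H)"
    proof (rule homI)
      show "F \<sigma> \<in> carrier (perm_grp UNIV H)" if "\<sigma> \<in> carrier (alt_group r)" for \<sigma>
        using FH[OF that] by (simp add: perm_grp_simps)
      fix \<sigma> \<tau> assume st: "\<sigma> \<in> carrier (alt_group r)" "\<tau> \<in> carrier (alt_group r)"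
      have c: "\<sigma> \<circ> \<tau> \<in> carrier (alt_group r)"
        using monoid.m_closed[OF group.is_monoid[OF alt_group_is_group] st] by (simp add: alt_group_mult)
      have "F (\<sigma> \<circ> \<tau>) = F \<sigma> \<circ> F \<tau>"
        by (rule acts_as_fun_eq[OF F[OF c] acts_as_compose[OF F[OF st(1)] F[OF st(2)]]])
      then show "F (\<sigma> \<otimes>\<^bsub>alt_group r\<^esub> \<tau>) = F \<sigma> \<otimes>\<^bsub>perm_grp UNIV H\<^esub> F \<tau>"
        using bijF st by (simp add: alt_group_mult perm_grp_simps BijGroup_UNIV)
    qed
    show "bij_betw F (carrier (alt_group r)) (carrier (perm_grp UNIV H))"
    proof (rule bij_betw_imageI)
      show "inj_on F (carrier (alt_group r))"
        using F acts_as_unique by (intro inj_onI) metis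
      show "F ` carrier (alt_group r) = carrier (perm_grp UNIV H)"
      proof
        show "F ` carrier (alt_group r) \<subseteq> carrier (perm_grp UNIV H)" using FH by (auto simp: perm_grp_simps)
        show "carrier (perm_grp UNIV H) \<subseteq> F ` carrier (alt_group r)"
        proof
          fix h assume "h \<in> carrier (perm_grp UNIV H)"
          then have "h \<in> H" by (simp add: perm_grp_simps)
          then obtain \<sigma> where s: "acts_as h \<sigma>" "evenperm \<sigma>" using H_acts by blast
          then have c: "\<sigma> \<in> carrier (alt_group r)" using acts_as_perm by (simp add: alt_group_carrier)
          have "h = F \<sigma>" by (rule acts_as_fun_eq[OF s(1) F[OF c]])
          then show "h \<in> F ` carrier (alt_group r)" using c by blast
        qed
      qed
    qed
  qed
  then show ?thesis using group.iso_sym[OF alt_group_is_group] by (auto simp: is_iso_def)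
qed

text \<open>For the converse the copy of the alternating group is \<open>H\<close> itself: scalars commute with linear maps, and only the
trivial scalar belongs to \<open>H\<close>.\<close>

lemma contains_scalars_iff:
  assumes G0: "subgroup G0 (BijGroup UNIV)" and H: "subgroup H (BijGroup UNIV)"
  shows "contains_scalars_times_alt r G0 \<longleftrightarrow> (\<forall>c. c \<noteq> 0 \<longrightarrow> (\<lambda>x. c *s x) \<in> G0)"
proof
  assume "contains_scalars_times_alt r G0"
  then obtain A where A: "subgroup A (perm_grp UNIV G0)" and
    hom: "(\<lambda>(z, a). z \<otimes>\<^bsub>perm_grp UNIV G0\<^esub> a)
          \<in> hom (perm_grp UNIV nonzero_scalars \<times>\<times> perm_grp UNIV A) (perm_grp UNIV G0)"
    unfolding contains_scalars_times_alt_def by blast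
  have "id \<in> A" using subgroup.one_closed[OF A] by (simp add: perm_grp_simps BijGroup_UNIV)
  show "\<forall>c. c \<noteq> 0 \<longrightarrow> (\<lambda>x. c *s x) \<in> G0"
  proof (intro allI impI)
    fix c :: 'k assume c: "c \<noteq> 0"
    let ?z = "\<lambda>x :: 'k ^ 'n. c *s x"
    have "?z \<in> nonzero_scalars" using c by (auto simp: nonzero_scalars_def)
    then have "(?z, id) \<in> carrier (perm_grp UNIV nonzero_scalars \<times>\<times> perm_grp UNIV A)"
      using \<open>id \<in> A\<close> by (simp add: perm_grp_simps)
    from hom_in_carrier[OF hom this] have "?z \<otimes>\<^bsub>BijGroup UNIV\<^esub> id \<in> G0" by (simp add: perm_grp_simps)
    moreover have "?z \<otimes>\<^bsub>BijGroup UNIV\<^esub> id = ?z \<circ> id"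
      by (rule BijGroup_UNIV(3)[OF bij_scalar[OF c] bij_id])
    ultimately show "?z \<in> G0" by (simp only: comp_id)
  qed
next
  assume sc: "\<forall>c. c \<noteq> 0 \<longrightarrow> (\<lambda>x. c *s x) \<in> G0"
  have nz: "z \<in> nonzero_scalars \<Longrightarrow> \<exists>c. c \<noteq> 0 \<and> z = (\<lambda>x. c *s x)" for z :: "'k ^ 'n \<Rightarrow> 'k ^ 'n"
    by (simp add: nonzero_scalars_def)
  have bij: "z \<in> nonzero_scalars \<Longrightarrow> bij z" "a \<in> H \<Longrightarrow> bij a" for z a :: "'k ^ 'n \<Rightarrow> 'k ^ 'n"
    using nz bij_scalar H_G0 G0_bij by blast+
  have zG: "z \<in> nonzero_scalars \<Longrightarrow> z \<in> G0" for z :: "'k ^ 'n \<Rightarrow> 'k ^ 'n" using nz sc by blast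
  have m: "z \<otimes>\<^bsub>perm_grp UNIV K\<^esub> a = z \<circ> a" if "bij z" "bij a" for z a :: "'k ^ 'n \<Rightarrow> 'k ^ 'n" and K
    using BijGroup_UNIV(3)[OF that] by (simp add: perm_grp_simps)
  show "contains_scalars_times_alt r G0"
    unfolding contains_scalars_times_alt_def
  proof (intro exI[of _ H] conjI)
    show "subgroup H (perm_grp UNIV G0)"
      unfolding perm_grp_def by (rule group.subgroup_incl[OF group_BijGroup H G0 H_G0])
    show "perm_grp UNIV H \<cong> alt_group r" by (rule H_iso_alt[OF H])
    show "(\<lambda>(z, a). z \<otimes>\<^bsub>perm_grp UNIV G0\<^esub> a) \<in> hom (perm_grp UNIV nonzero_scalars \<times>\<times> perm_grp UNIV H) (perm_grp UNIV G0)"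
    proof (rule homI)
      fix x :: "('k ^ 'n \<Rightarrow> 'k ^ 'n) \<times> ('k ^ 'n \<Rightarrow> 'k ^ 'n)"
      assume "x \<in> carrier (perm_grp UNIV nonzero_scalars \<times>\<times> perm_grp UNIV H)"
      then obtain z a where x: "x = (z, a)" "z \<in> nonzero_scalars" "a \<in> H" by (auto simp: perm_grp_simps)
      then show "(case x of (z, a) \<Rightarrow> z \<otimes>\<^bsub>perm_grp UNIV G0\<^esub> a) \<in> carrier (perm_grp UNIV G0)"
        using m[OF bij(1)[OF x(2)] bij(2)[OF x(3)]] zG[OF x(2)] H_G0 G0_compose by (auto simp: perm_grp_simps(1))
    next
      fix x y :: "('k ^ 'n \<Rightarrow> 'k ^ 'n) \<times> ('k ^ 'n \<Rightarrow> 'k ^ 'n)"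
      assume "x \<in> carrier (perm_grp UNIV nonzero_scalars \<times>\<times> perm_grp UNIV H)"
        "y \<in> carrier (perm_grp UNIV nonzero_scalars \<times>\<times> perm_grp UNIV H)"
      then obtain z a z' a' where x: "x = (z, a)" "z \<in> nonzero_scalars" "a \<in> H"
        and y: "y = (z', a')" "z' \<in> nonzero_scalars" "a' \<in> H" by (auto simp: perm_grp_simps)
      obtain c where c: "z' = (\<lambda>x. c *s x)" using nz[OF y(2)] by blast
      have "a \<in> G0" using x(3) H_G0 by blast
      then have com: "a \<circ> z' = z' \<circ> a" unfolding c by (simp add: fun_eq_iff G0_scale)
      note b = bij(1)[OF x(2)] bij(2)[OF x(3)] bij(1)[OF y(2)] bij(2)[OF y(3)]
      have "z \<circ> z' \<circ> (a \<circ> a') = z \<circ> (z' \<circ> a) \<circ> a'" by (simp only: comp_assoc)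
      also have "\<dots> = z \<circ> a \<circ> (z' \<circ> a')" unfolding com[symmetric] by (simp only: comp_assoc)
      finally have e: "z \<circ> z' \<circ> (a \<circ> a') = z \<circ> a \<circ> (z' \<circ> a')" .
      note bb = bij_comp[OF b(3,1)] bij_comp[OF b(4,2)] bij_comp[OF b(2,1)] bij_comp[OF b(4,3)]
      have "x \<otimes>\<^bsub>perm_grp UNIV nonzero_scalars \<times>\<times> perm_grp UNIV H\<^esub> y = (z \<circ> z', a \<circ> a')"
        unfolding x(1) y(1) mult_DirProd m[OF b(1,3)] m[OF b(2,4)] ..
      then show "(case x \<otimes>\<^bsub>perm_grp UNIV nonzero_scalars \<times>\<times> perm_grp UNIV H\<^esub> y of (z, a) \<Rightarrow> z \<otimes>\<^bsub>perm_grp UNIV G0\<^esub> a)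
         = (case x of (z, a) \<Rightarrow> z \<otimes>\<^bsub>perm_grp UNIV G0\<^esub> a) \<otimes>\<^bsub>perm_grp UNIV G0\<^esub>
           (case y of (z, a) \<Rightarrow> z \<otimes>\<^bsub>perm_grp UNIV G0\<^esub> a)"
        unfolding x(1) y(1) by (simp only: prod.case m[OF b(1,2)] m[OF b(3,4)] m[OF bb(1,2)] m[OF bb(3,4)] e)
    qed
    show "inj_on (\<lambda>(z, a). z \<otimes>\<^bsub>perm_grp UNIV G0\<^esub> a) (nonzero_scalars \<times> H)"
    proof (rule inj_onI)
      fix x y :: "('k ^ 'n \<Rightarrow> 'k ^ 'n) \<times> ('k ^ 'n \<Rightarrow> 'k ^ 'n)"
      assume "x \<in> nonzero_scalars \<times> H" "y \<in> nonzero_scalars \<times> H"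
        and eq: "(case x of (z, a) \<Rightarrow> z \<otimes>\<^bsub>perm_grp UNIV G0\<^esub> a) = (case y of (z, a) \<Rightarrow> z \<otimes>\<^bsub>perm_grp UNIV G0\<^esub> a)"
      then obtain z a z' a' where x: "x = (z, a)" "z \<in> nonzero_scalars" "a \<in> H"
        and y: "y = (z', a')" "z' \<in> nonzero_scalars" "a' \<in> H" by auto
      obtain c where c: "c \<noteq> 0" "z = (\<lambda>x. c *s x)" using nz[OF x(2)] by blast
      obtain c' where c': "c' \<noteq> 0" "z' = (\<lambda>x. c' *s x)" using nz[OF y(2)] by blast
      have "z \<circ> a = z' \<circ> a'"
        using eq m[OF bij(1)[OF x(2)] bij(2)[OF x(3)]] m[OF bij(1)[OF y(2)] bij(2)[OF y(3)]] unfolding x(1) y(1) by simp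
      then have e: "c *s a v = c' *s a' v" for v unfolding c(2) c'(2) by (metis comp_apply)
      obtain k where k: "k \<in> H" "k \<circ> a' = id" using H_inverse[OF y(3)] by blast
      have kG: "k \<in> G0" using k(1) H_G0 by blast
      have ka: "(k \<circ> a) v = (c' / c) *s v" for v
      proof -
        have "a v = (c' / c) *s a' v"
          using arg_cong[OF e[of v], of "\<lambda>w. (1 / c) *s w"] c(1) by (simp add: vector_smult_assoc)
        then have "k (a v) = (c' / c) *s k (a' v)" by (simp add: G0_scale[OF kG])
        then show ?thesis using k(2) by (metis comp_apply id_apply)
      qed
      have "c' / c = 1" by (rule H_scalar[OF H_compose[OF k(1) x(3)] ka])
      then have cc: "c' = c" using c(1) by simp
      have "a v = a' v" for v using e[of v] c(1) unfolding cc by (simp add: vec_eq_iff)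
      then show "x = y" unfolding x(1) y(1) c(2) c'(2) cc by auto
    qed
  qed
qed

section \<open>Conclusion\<close>

text \<open>In each case an explicit vector has five entries different from every constant \<open>t\<close> with \<open>of_nat r * t = 0\<close>.  If \<open>r\<close> is
nonzero in the field, only \<open>t = 0\<close> has to be considered.\<close>

lemma generic_not_cover2:
  assumes ex2: "\<not> (CARD('k) = 2 \<and> r \<in> {5, 6, 8, 10})" and ex3: "\<not> (CARD('k) = 3 \<and> r = 6)"
    and ex5: "\<not> (CARD('k) = 5 \<and> r = 5)"
  shows "\<not> (\<forall>v w. v \<noteq> 0 \<longrightarrow> cover2 G0 v w)"
proof -
  have "card {0, 1 :: 'k} \<le> CARD('k)" by (intro card_mono) auto
  then have q2: "2 \<le> CARD('k)" by simp
  have small: "CARD('k) = 2" if "(2::'k) = 0"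
    using of_nat_0_iff[of 2] that q2 by (auto dest!: dvd_imp_le)
  have "CARD('k) = 3" if "(3::'k) = 0"
  proof -
    have "CARD('k) dvd 3" using of_nat_0_iff[of 3] that by simp
    then have "CARD('k) \<le> 3" "CARD('k) dvd 3" by (auto dest: dvd_imp_le)
    then show ?thesis using q2 by (cases "CARD('k) = 2") auto
  qed
  note small3 = this
  have small5: "CARD('k) = 5" if "(5::'k) = 0"
  proof -
    have d: "CARD('k) dvd 5" using of_nat_0_iff[of 5] that by simp
    then have "CARD('k) \<le> 5" by (auto dest: dvd_imp_le)
    then have "CARD('k) = 2 \<or> CARD('k) = 3 \<or> CARD('k) = 4 \<or> CARD('k) = 5" using q2 by linarith
    then show ?thesis using d by (elim disjE) simp_all
  qed
  have kr: "keeps_roots" unfolding keeps_roots_def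
    using G0_root small3 small5 ex3 ex5 by blast
  note nc = not_covering(2)[OF kr]
  show ?thesis
  proof (cases "CARD('k) = 2")
    case True
    have r7: "7 \<le> r" "even r \<Longrightarrow> 12 \<le> r"
    proof -
      show "7 \<le> r" using ex2 True r_ge_5 by (cases "r = 5"; cases "r = 6") auto
      assume "even r"
      then have "r \<noteq> 7" "r \<noteq> 9" "r \<noteq> 11" by auto
      then show "12 \<le> r" using ex2 True \<open>7 \<le> r\<close> by (cases "r = 8"; cases "r = 10") auto
    qed
    have adm: "admissible (ones 6)" using True r7 by (intro ones_admissible) auto
    show ?thesis
    proof (rule nc[OF adm])
      fix t :: 'k assume t: "of_nat r * t = 0"
      have "t = 0 \<or> t = 1" by (rule binary_field(1)[OF True])
      then show "5 \<le> length (filter (\<lambda>x. x \<noteq> t) (ones 6))"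
      proof
        assume "t = 0" then show ?thesis by (simp add: ones_def)
      next
        assume "t = 1"
        then have "even r" using t of_nat_0_iff[of r] True by simp
        then show ?thesis using r7(2) \<open>t = 1\<close> by (simp add: ones_def)
      qed
    qed
  next
    case False
    then have two: "(2::'k) \<noteq> 0" using small by blast
    have m1: "(1::'k) \<noteq> - 1" "(- 1::'k) \<noteq> 1"
    proof -
      show "(1::'k) \<noteq> - 1" using two by (metis add.right_inverse one_add_one)
      then show "(- 1::'k) \<noteq> 1" by metis
    qed
    show ?thesis
    proof (cases "of_nat r = (0::'k)")
      case nz: False
      let ?w = "[1, 1, 1, - 1, - 2] @ replicate (r - 5) 0 :: 'k list"
      have adm: "admissible ?w" using r_ge_5 by (simp add: admissible_def sum_list_replicate)
      show ?thesis
      proof (rule nc[OF adm])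
        fix t :: 'k assume "of_nat r * t = 0"
        then have "t = 0" using nz by simp
        then show "5 \<le> length (filter (\<lambda>x. x \<noteq> t) ?w)" using two by simp
      qed
    next
      case z: True
      have "r = 7 \<or> r = 9 \<or> 10 \<le> r"
      proof (rule ccontr)
        assume "\<not> ?thesis"
        then have "r = 5 \<or> r = 6 \<or> r = 8" using r_ge_5 by linarith
        then show False
        proof (elim disjE)
          assume "r = 5" then show False using z small5 ex5 by simp
        next
          assume r: "r = 6"
          have "(2::'k) * 3 = of_nat r" using r by simp
          then have "(3::'k) = 0" using z two by (metis mult_eq_0_iff)
          then show False using small3 ex3 r by blast
        next
          assume r: "r = 8"
          have "(2::'k) * (2 * 2) = of_nat r" using r by simp
          then show False using z two by (metis mult_eq_0_iff)
        qed
      qed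
      then show ?thesis
      proof (elim disjE)
        assume r: "r = 7"
        have seven: "(7::'k) = 0" using z r by simp
        have three: "(3::'k) \<noteq> 0"
        proof
          assume "(3::'k) = 0"
          moreover have "(1::'k) = 7 - 2 * 3" by simp
          ultimately show False using seven by simp
        qed
        let ?w = "[1, 1, - 1, - 1, 2, - 2, 0] :: 'k list"
        have adm: "admissible ?w" unfolding admissible_def using r by simp
        have "(2::'k) * 2 \<noteq> 0" using two by (metis mult_eq_0_iff)
        then have four: "(4::'k) \<noteq> 0" by simp
        have "(2::'k) - 1 \<noteq> 0" by simp
        then have ne1: "(2::'k) \<noteq> 1" by (metis diff_self)
        have ne: "(2::'k) \<noteq> 1" "(2::'k) \<noteq> - 1" "(2::'k) \<noteq> - 2" "(1::'k) \<noteq> - 2" "(- 1::'k) \<noteq> - 2"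
          using three four ne1 by (simp_all add: eq_neg_iff_add_eq_0)
        show ?thesis
        proof (rule nc[OF adm])
          fix t :: 'k
          consider "t = 1" | "t = - 1" | "t = 2" | "t = - 2" | "t = 0" | "t \<notin> set ?w" by auto
          then show "5 \<le> length (filter (\<lambda>x. x \<noteq> t) ?w)"
            by cases (simp_all add: ne ne[symmetric] two two[symmetric] m1)
        qed
      next
        assume r: "r = 9"
        let ?w = "[1, 1, 1, - 1, - 1, - 1, 0, 0, 0] :: 'k list"
        have adm: "admissible ?w" unfolding admissible_def using r by simp
        show ?thesis
        proof (rule nc[OF adm])
          fix t :: 'k
          show "5 \<le> length (filter (\<lambda>x. x \<noteq> t) ?w)"
            using m1 by (cases "t = 1"; cases "t = - 1"; cases "t = 0") auto
        qed
      next
        assume r: "10 \<le> r"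
        let ?w = "replicate 5 1 @ replicate 5 (- 1) @ replicate (r - 10) 0 :: 'k list"
        have adm: "admissible ?w" unfolding admissible_def using r by (simp add: sum_list_replicate)
        show ?thesis
        proof (rule nc[OF adm])
          fix t :: 'k
          show "5 \<le> length (filter (\<lambda>x. x \<noteq> t) ?w)"
            using m1 by (cases "t = 1") auto
        qed
      qed
    qed
  qed
qed

lemma binary_not_cover1:
  assumes card: "CARD('k) = 2" and r: "r \<in> {5, 8, 10}"
  shows "\<not> (\<forall>v w. v \<noteq> 0 \<longrightarrow> cover1 G0 v w)"
proof -
  have "\<not> (r = 6 \<and> (3::'k) = 0)" "\<not> (r = 5 \<and> (5::'k) = 0)"
    using r of_nat_0_iff[of 5] card by auto
  then have kr: "keeps_roots" unfolding keeps_roots_def using G0_root by blast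
  have adm: "admissible (ones 4)" using card r_ge_5 by (intro ones_admissible) auto
  show ?thesis
  proof (rule not_covering(1)[OF kr adm])
    fix t :: 'k assume t: "of_nat r * t = 0"
    have "t = 0 \<or> t = 1" by (rule binary_field(1)[OF card])
    then show "3 \<le> length (filter (\<lambda>x. x \<noteq> t) (ones 4))"
    proof
      assume "t = 0" then show ?thesis by (simp add: ones_def)
    next
      assume "t = 1"
      then have "even r" using t of_nat_0_iff[of r] card by simp
      then have "8 \<le> r" using r by auto
      then show ?thesis using \<open>t = 1\<close> by (simp add: ones_def)
    qed
  qed
qed

end

lemma (in quinary) quinary_not_cover1: "\<not> (\<forall>v w. v \<noteq> 0 \<longrightarrow> cover1 G0 v w)"
proof -
  have adm: "admissible [0, 1, 2, 3, 4]" unfolding admissible_def using r5 numerals_mod_5 by simp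
  show ?thesis
  proof (rule not_covering(1)[OF quinary_keeps_roots adm])
    show "3 \<le> length (filter (\<lambda>x. x \<noteq> t) [0, 1, 2, 3, 4])" for t :: 'k
      using elements_mod_5[of t] distinct_numerals_mod_5 nonzero_numerals_mod_5 by (elim disjE) simp_all
  qed
qed

lemma (in quinary) all_scalars:
  assumes two: "(\<lambda>x. 2 *s x) \<in> G0" and c: "c \<noteq> 0" shows "(\<lambda>x. c *s x) \<in> G0"
proof -
  let ?t = "\<lambda>x :: 'k ^ 'n. 2 *s x"
  have id: "id \<in> G0" using H_id H_G0 by blast
  have "?t \<circ> ?t \<in> G0" "?t \<circ> ?t \<circ> ?t \<in> G0" using two G0_compose by blast+
  moreover have "?t \<circ> ?t = (\<lambda>x. 4 *s x)" "?t \<circ> ?t \<circ> ?t = (\<lambda>x. 3 *s x)"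
    using numerals_mod_5 by (simp_all add: fun_eq_iff vector_smult_assoc)
  ultimately have "(\<lambda>x. 4 *s x) \<in> G0" "(\<lambda>x. 3 *s x) \<in> G0" by simp_all
  moreover have "(\<lambda>x. 1 *s x) \<in> G0" using id by (simp add: id_def)
  ultimately show ?thesis using elements_mod_5[of c] c two by (elim disjE) simp_all
qed

lemma (in quinary) quinary_cover2_iff:
  "(\<forall>v w. v \<noteq> 0 \<longrightarrow> cover2 G0 v w) \<longleftrightarrow> (\<forall>c. c \<noteq> 0 \<longrightarrow> (\<lambda>x. c *s x) \<in> G0)"
proof
  assume "\<forall>v w. v \<noteq> 0 \<longrightarrow> cover2 G0 v w"
  then have "(\<lambda>x. 2 *s x) \<in> G0" using no_scalars_not_cover2 by blast
  then show "\<forall>c. c \<noteq> 0 \<longrightarrow> (\<lambda>x. c *s x) \<in> G0" using all_scalars by blast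
next
  assume "\<forall>c. c \<noteq> 0 \<longrightarrow> (\<lambda>x. c *s x) \<in> G0"
  then interpret quinary_scalars r H D G0 by unfold_locales blast
  show "\<forall>v w. v \<noteq> 0 \<longrightarrow> cover2 G0 v w" using quinary_cover2 by blast
qed

theorem corollary1p10:
  fixes G G0 H :: "('k::{field,finite} ^ 'n \<Rightarrow> 'k ^ 'n) set"
    and r :: nat
  assumes "H = last_derived (BijGroup UNIV) G0"
    and "primitive_affine G G0"
    and "quasisimple (perm_grp UNIV H)"
    and "perm_grp UNIV H Mod group_center (perm_grp UNIV H) \<cong> alt_group r"
    and "fully_deleted_perm_module r H"
    and "absolutely_irreducible_on H"
    and "\<not> realisable_over_proper_subfield H"
  shows "(orbdiam G UNIV = 1 \<longleftrightarrow> r = 6 \<and> CARD('k) = 2) \<and>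
         (orbdiam G UNIV = 2 \<longleftrightarrow>
            (CARD('k) = 2 \<and> (r = 5 \<or> r = 8 \<or> r = 10)) \<or>
            (CARD('k) = 3 \<and> r = 6) \<or>
            (CARD('k) = 5 \<and> r = 5 \<and> contains_scalars_times_alt 5 G0))"
proof -
  have r5: "5 \<le> r" by (rule alternating_degree_ge_5[OF assms(3,4)])
  note Hf = last_derived_facts[OF assms(2,1)]
  note G0f = point_stabilizer[OF assms(2)]
  obtain D where D: "deleted_rep r H D" using deleted_rep_exists[OF assms(5) r5] by blast
  interpret deleted_rep r H D by fact
  have prime: "range of_nat = (UNIV :: 'k set)" by (rule field_is_prime[OF assms(7)])
  have scale: "g (c *s x) = c *s g x" if g: "g \<in> G0" for g c x
  proof -
    obtain s where "field_aut s" "\<And>c x. g (c *s x) = s c *s g x"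
      using g assms(2) unfolding primitive_affine_def GammaL_def by blast
    then show ?thesis using prime_field_aut[OF prime] by simp
  qed
  interpret prime_deleted_affine r H D G0
    by unfold_locales (use G0f Hf scale prime in auto)
  define C1 where "C1 \<longleftrightarrow> (\<forall>v w. v \<noteq> 0 \<longrightarrow> cover1 G0 v w)"
  define C2 where "C2 \<longleftrightarrow> (\<forall>v w. v \<noteq> 0 \<longrightarrow> cover2 G0 v w)"
  have C12: "C1 \<Longrightarrow> C2" unfolding C1_def C2_def cover2_def by blast
  have d1: "orbdiam G UNIV = 1 \<longleftrightarrow> C1" unfolding C1_def by (rule orbdiam_eq_1[OF assms(2)])
  have d2: "orbdiam G UNIV = 2 \<longleftrightarrow> C2 \<and> \<not> C1" unfolding C1_def C2_def by (rule orbdiam_eq_2[OF assms(2)])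
  consider (six) "CARD('k) = 2" "r = 6" | (bin) "CARD('k) = 2" "r \<in> {5, 8, 10}" | (ter) "CARD('k) = 3" "r = 6"
    | (quin) "CARD('k) = 5" "r = 5"
    | (gen) "\<not> (CARD('k) = 2 \<and> r \<in> {5, 6, 8, 10})" "\<not> (CARD('k) = 3 \<and> r = 6)" "\<not> (CARD('k) = 5 \<and> r = 5)"
    by auto
  then show ?thesis
  proof cases
    case six
    then have C1 unfolding C1_def using binary_6_cover1 by blast
    then show ?thesis using six d1 d2 by simp
  next
    case bin
    then have "C2" "\<not> C1" unfolding C1_def C2_def using binary_5_8_10_cover2 binary_not_cover1 by blast+
    then show ?thesis using bin d1 d2 by auto
  next
    case ter
    then have "C2" "\<not> C1" unfolding C1_def C2_def using ternary_6_cover2 ternary_6_not_cover1 by blast+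
    then show ?thesis using ter d1 d2 by simp
  next
    case quin
    then interpret quinary r H D G0 by unfold_locales
    have "\<not> C1" unfolding C1_def by (rule quinary_not_cover1)
    moreover have "C2 \<longleftrightarrow> contains_scalars_times_alt r G0"
      unfolding C2_def contains_scalars_iff[OF point_stabilizer_subgroup[OF assms(2)] Hf(1)] by (rule quinary_cover2_iff)
    ultimately show ?thesis using quin d1 d2 by simp
  next
    case gen
    then have "\<not> C2" unfolding C2_def by (rule generic_not_cover2)
    then show ?thesis using gen C12 d1 d2 by auto
  qed
qed

end
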